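(* Assume the setting described in the context, and suppose that ENNAMCQ holds, i.e. $0\notin\nabla R(w)+N_C(w)$ for every $w\in C$ with $R(w)\ge 0$. Suppose $\widehat\gamma_t\le M_\gamma\widehat\gamma_{t+1}$ for some $M_\gamma>1$ and every $t\ge0$, let $\{\mu_k\}$ be positive and nonincreasing with $\mu_k=\Theta((1+k)^{-r})$ for some $r\in(0,1)$, and let $\zeta_k\le\bar\zeta\mu_k^q$ with $\bar\zeta>0$, $q>1/r$, and in addition $\zeta_k=\Theta(\mu_k^q)$. Suppose each $\zeta$-accurate Moreau point required by IVSP is computed by the projected-gradient routine ME of the context with the corresponding tolerance $\zeta$. Let $B_{\rm ls}$ be a uniform bound on the number of trial Moreau evaluations per outer iteration, with $B_{\rm ls}=1$ for Strategy I. Then the overall first-order/projection complexity of IVSP through outer iteration $K$ is $$O\bigl(B_{\rm ls}\,\kappa_{\psi,\rho}\,K\log K\bigr).$$ In particular, for $r=1/3$, IVSP computes an $\varepsilon$-KKT point of the problem $\min_{w\in C}f(w)$ s.t. $R(w)\le0$ with overall first-order/projection complexity $$O\Bigl(B_{\rm ls}\,\kappa_{\psi,\rho}\,\varepsilon^{-3}\log\frac1\varepsilon\Bigr)=\widetilde O(\varepsilon^{-3}).$$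
   Context: Problem setting. $X\subset\mathbb R^n$ and $Y\subset\mathbb R^m$ are nonempty, compact, convex; $C=X\times Y$ and $w=(x,y)$ denotes a point of $C$. The functions $f,g$ are real-valued, continuously differentiable on a neighborhood of $C$, and $\nabla f,\nabla g$ are $L_f$- resp. $L_g$-Lipschitz on $C$. $\sigma\ge0$ is such that $g(x,\cdot)+\frac\sigma2\|\cdot\|^2$ is convex on $Y$ for every $x\in X$. Fix $\rho>0$ with $\rho\sigma<1$ and $\delta>0$. Put $\psi_\rho(z;x,y)=g(x,z)+\frac1{2\rho}\|z-y\|^2$, $g_\rho(x,y)=\min_{z\in Y}\psi_\rho(z;x,y)$, with unique minimizer $z_\rho(x,y)$, and $R(w)=g(w)-g_\rho(w)-\delta$. $R$ is continuously differentiable on $C$ with $\nabla R(w)=\bigl(\nabla_xg(x,y)-\nabla_xg(x,z_\rho(w)),\ \nabla_yg(x,y)-\rho^{-1}(y-z_\rho(w))\bigr)$. $N_C$ is the normal cone, $P_C$, $P_Y$ Euclidean projections, $[t]_+=\max\{t,0\}$. A point $w\in C$ is an $\varepsilon$-KKT point if some $\lambda\ge0$ satisfies $\operatorname{dist}(0,\nabla f(w)+\lambda\nabla R(w)+N_C(w))\le\varepsilon$, $[R(w)]_+\le\varepsilon$, $|\lambda R(w)|\le\varepsilon$. Smoothing. For each $\mu>0$, $\phi_\mu:\mathbb R\to\mathbb R$ is convex, $C^1$, nondecreasing, and for constants $a_1,a_2,b_\phi,c_\phi\ge0$: $0\le\phi_\mu'\le1$; $[t]_+-a_1\mu\le\phi_\mu(t)\le[t]_++a_2\mu$;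 $|\phi_\mu'(t)-\phi_\mu'(s)|\le\frac{b_\phi}{\mu}|t-s|$; $\phi_{\mu_1}(t)\le\phi_{\mu_0}(t)+c_\phi(\mu_0-\mu_1)$ for $0<\mu_1\le\mu_0$. Set $a_\phi=a_1+a_2>0$. Constants. $m_\rho=\rho^{-1}-\sigma$; $L_{xy},L_{yy}>0$ are Lipschitz constants of $y\mapsto\nabla_xg(x,y)$ and $y\mapsto\nabla_yg(x,y)$ on $Y$, uniform in $x\in X$; $L_{\psi,\rho}=L_{yy}+\rho^{-1}$; $\kappa_{\psi,\rho}=L_{\psi,\rho}/m_\rho$; $L_R,B_R>0$ are a Lipschitz constant and a norm bound of $\nabla R$ on $C$; $L_{a,\rho}=\sqrt{L_{xy}^2+\rho^{-2}}$; $D_\rho(\zeta)=L_{a,\rho}\sqrt{2\zeta/m_\rho}$; $E_{\mu,\rho}(\zeta)=D_\rho(\zeta)+\frac{b_\phi B_R}{\mu}\zeta$; $L_G=b_\phi B_R^2+\mu_0L_R$. IVSP algorithm. Parameters: $c_1,c_2,\underline\vartheta>0$, $\hat\vartheta\in(0,2)$, $w^0\in C$, positive nonincreasing sequences $\mu_k\downarrow0$, $\zeta_k\downarrow0$, a strictly decreasing positive grid $\widehat\gamma_t\downarrow0$, $t_0=0$. A point $\widetilde z\in Y$ is $\zeta$-accurate at $w$ if $0\le\psi_\rho(\widetilde z;w)-g_\rho(w)\le\zeta$; it defines $\widetilde R(w)=g(w)-\psi_\rho(\widetilde z;w)-\delta$ and $\widetilde\nabla R(w)$, obtained from the formula for $\nabla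 R(w)$ by replacing $z_\rho(w)$ with $\widetilde z$. Start with a $\zeta_0$-accurate point $\widetilde z^0$ at $w^0$. At iteration $k$, with the current $\zeta_k$-accurate point $\widetilde z^k$ at $w^k$ and the associated $\widetilde R^k$, set $\gamma_k=\widehat\gamma_{t_k}$, $\widetilde\nabla G^k=\phi_{\mu_k}'(\widetilde R^k)\widetilde\nabla R(w^k)$ and, for $L>0$, $w_L^k=P_C\bigl(w^k-\frac{\mu_k}{L}[\gamma_k\nabla f(w^k)+\widetilde\nabla G^k]\bigr)$; compute a $\zeta_{k+1}$-accurate point $\widetilde z^+_{k,L}$ at $w_L^k$ with associated residual $\widetilde R^+_{k,L}$ (one trial Moreau evaluation). Let $E_k^0=E_{\mu_k,\rho}(\zeta_k)$, $\vartheta_{k,L}=\max\{\min\{\mu_kE_k^0/\|w_L^k-w^k\|,\hat\vartheta L\},\underline\vartheta\}$ (the ratio is $+\infty$ if $w_L^k=w^k$), $\tau_{k,L}=\frac{\mu_k}{2\vartheta_{k,L}}(E_k^0)^2+\zeta_k+\zeta_{k+1}$. Choice of $L_k$: Strategy I uses a fixed $L_k=L\ge L_{\rm safe}:=\max\{\underline\vartheta/\hat\vartheta,\ (c_1+\widehat\gamma_0\mu_0L_f+L_G)/(2-\hat\vartheta)\}$. Strategy II starts from some $L_{k,0}\in[L_{\min},L_{\max}]$ ($0<L_{\min}\le L_{\max}<\infty$) and doubles $L$ until $$\gamma_kf(w_L^k)+\phi_{\mu_k}(\widetilde R^+_{k,L}+\zeta_{k+1})\le\gamma_kf(w^k)+\phi_{\mu_k}(\widetilde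 R^k)-\tfrac{c_1}{2\mu_k}\|w_L^k-w^k\|^2+\tau_{k,L};$$ $L_k$ is the accepted $L$. Set $w^{k+1}=w^k_{L_k}$, $\widetilde z^{k+1}=\widetilde z^+_{k,L_k}$ (retained for the next iteration, not recomputed), $\widetilde R^{k+1}=\widetilde R^+_{k,L_k}$. Penalty update: if $\widetilde R^{k+1}>2a_\phi\mu_k$ and $\|w^{k+1}-w^k\|\le c_2\mu_k\gamma_k$ then $t_{k+1}=t_k+1$, otherwise $t_{k+1}=t_k$. Routine ME$(w,z^{\rm init},\zeta)$, $w=(x,y)\in C$, $z^{\rm init}\in Y$, $\zeta>0$: with $\eta=1/L_{\psi,\rho}$, $z^0=z^{\rm init}$, iterate $z^{j+1}=P_Y\bigl(z^j-\eta[\nabla_yg(x,z^j)+\rho^{-1}(z^j-y)]\bigr)$, $r^j=(z^j-z^{j+1})/\eta$, and return $\widetilde z=z^{j+1}$ at the first $j$ with $\|r^j\|^2\le2m_\rho\zeta$. The returned point is $\zeta$-accurate at $w$. The initial evaluation uses any starting point in $Y$; trial evaluations at iteration $k$ start from $\widetilde z^k$. Conventions. First-order/projection complexity counts the total number of gradient evaluations of $f,g$ and of projections onto $Y$ and $C$ performed (both inside ME and in the outer iterations). Constants hidden in $O$ may depend on the problem data and algorithm parameters (including $\delta,\rho,r,q$) but not on $K$ or $\varepsilon$; bounds in $\varepsilon$ are for $\varepsilon\to0$. $\widetilde O$ suppresses logarithmic factors. *)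

theory Defs
  imports "HOL-Analysis.Analysis" "HOL-Library.Landau_Symbols"
begin

section \<open>Problem data\<close>

text \<open>
  \<open>X \<subseteq> \<real>\<^sup>n\<close> and \<open>Y \<subseteq> \<real>\<^sup>m\<close> live in two arbitrary Euclidean spaces; the product type carries the
  Euclidean norm. The gradients are data, tied to the functions by \<open>GDERIV\<close> below; the partial
  gradients of \<open>g\<close> are the two components of \<open>grad_g\<close>.
\<close>

record ('a, 'b) problem =
  Xs :: "'a set"
  Ys :: "'b set"
  ff :: "'a \<times> 'b \<Rightarrow> real"
  grad_f :: "'a \<times> 'b \<Rightarrow> 'a \<times> 'b"
  gg :: "'a \<times> 'b \<Rightarrow> real"
  grad_g :: "'a \<times> 'b \<Rightarrow> 'a \<times> 'b"
  Lf :: real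
  Lg :: real
  sigma :: real
  rho :: real
  delta :: real
  Lxy :: real
  Lyy :: real
  LR :: real
  BR :: real

definition Cs :: "('a, 'b) problem \<Rightarrow> ('a \<times> 'b) set" where
  "Cs P = Xs P \<times> Ys P"

definition psi :: "('a::euclidean_space, 'b::euclidean_space) problem \<Rightarrow> 'b \<Rightarrow> 'a \<times> 'b \<Rightarrow> real" where
  "psi P z w = gg P (fst w, z) + 1 / (2 * rho P) * (norm (z - snd w))\<^sup>2"

definition g_rho :: "('a::euclidean_space, 'b::euclidean_space) problem \<Rightarrow> 'a \<times> 'b \<Rightarrow> real" where
  "g_rho P w = (INF z\<in>Ys P. psi P z w)"

definition z_rho :: "('a::euclidean_space, 'b::euclidean_space) problem \<Rightarrow> 'a \<times> 'b \<Rightarrow> 'b" where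
  "z_rho P w = arg_min_on (\<lambda>z. psi P z w) (Ys P)"

definition resid :: "('a::euclidean_space, 'b::euclidean_space) problem \<Rightarrow> 'a \<times> 'b \<Rightarrow> real" where
  "resid P w = gg P w - g_rho P w - delta P"

text \<open>
  The residual and its gradient with an arbitrary \<open>z\<close> in place of the exact minimizer. The set
  \<open>C\<close> may have empty interior, so the gradient of \<open>R\<close> on \<open>C\<close> is fixed by its explicit formula.
\<close>

definition resid_at :: "('a::euclidean_space, 'b::euclidean_space) problem \<Rightarrow> 'a \<times> 'b \<Rightarrow> 'b \<Rightarrow> real" where
  "resid_at P w z = gg P w - psi P z w - delta P"

definition grad_resid_at ::
  "('a::euclidean_space, 'b::euclidean_space) problem \<Rightarrow> 'a \<times> 'b \<Rightarrow> 'b \<Rightarrow> 'a \<times> 'b" where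
  "grad_resid_at P w z =
     (fst (grad_g P w) - fst (grad_g P (fst w, z)),
      snd (grad_g P w) - (1 / rho P) *\<^sub>R (snd w - z))"

definition grad_resid ::
  "('a::euclidean_space, 'b::euclidean_space) problem \<Rightarrow> 'a \<times> 'b \<Rightarrow> 'a \<times> 'b" where
  "grad_resid P w = grad_resid_at P w (z_rho P w)"

definition accurate ::
  "('a::euclidean_space, 'b::euclidean_space) problem \<Rightarrow> 'a \<times> 'b \<Rightarrow> real \<Rightarrow> 'b \<Rightarrow> bool" where
  "accurate P w \<epsilon> z \<longleftrightarrow> z \<in> Ys P \<and> 0 \<le> psi P z w - g_rho P w \<and> psi P z w - g_rho P w \<le> \<epsilon>"

definition C1_near ::
  "'c::euclidean_space set \<Rightarrow> ('c \<Rightarrow> real) \<Rightarrow> ('c \<Rightarrow> 'c) \<Rightarrow> bool" where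
  "C1_near S h dh \<longleftrightarrow>
     (\<exists>U. open U \<and> S \<subseteq> U \<and> (\<forall>w\<in>U. GDERIV h w :> dh w) \<and> continuous_on U dh)"

definition valid_problem :: "('a::euclidean_space, 'b::euclidean_space) problem \<Rightarrow> bool" where
  "valid_problem P \<longleftrightarrow>
     Xs P \<noteq> {} \<and> compact (Xs P) \<and> convex (Xs P) \<and>
     Ys P \<noteq> {} \<and> compact (Ys P) \<and> convex (Ys P) \<and>
     C1_near (Cs P) (ff P) (grad_f P) \<and> C1_near (Cs P) (gg P) (grad_g P) \<and>
     (Lf P)-lipschitz_on (Cs P) (grad_f P) \<and> (Lg P)-lipschitz_on (Cs P) (grad_g P) \<and>
     sigma P \<ge> 0 \<and>
     (\<forall>x\<in>Xs P. convex_on (Ys P) (\<lambda>y. gg P (x, y) + sigma P / 2 * (norm y)\<^sup>2)) \<and>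
     rho P > 0 \<and> rho P * sigma P < 1 \<and> delta P > 0 \<and>
     Lxy P > 0 \<and> (\<forall>x\<in>Xs P. (Lxy P)-lipschitz_on (Ys P) (\<lambda>y. fst (grad_g P (x, y)))) \<and>
     Lyy P > 0 \<and> (\<forall>x\<in>Xs P. (Lyy P)-lipschitz_on (Ys P) (\<lambda>y. snd (grad_g P (x, y)))) \<and>
     LR P > 0 \<and> (LR P)-lipschitz_on (Cs P) (grad_resid P) \<and>
     BR P > 0 \<and> (\<forall>w\<in>Cs P. norm (grad_resid P w) \<le> BR P)"

definition normal_cone :: "'c::real_inner set \<Rightarrow> 'c \<Rightarrow> 'c set" where
  "normal_cone S w = {v. \<forall>u\<in>S. v \<bullet> (u - w) \<le> 0}"

definition eps_KKT ::
  "('a::euclidean_space, 'b::euclidean_space) problem \<Rightarrow> real \<Rightarrow> 'a \<times> 'b \<Rightarrow> bool" where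
  "eps_KKT P \<epsilon> w \<longleftrightarrow> w \<in> Cs P \<and>
     (\<exists>l\<ge>0.
        infdist 0 {grad_f P w + l *\<^sub>R grad_resid P w + v | v. v \<in> normal_cone (Cs P) w} \<le> \<epsilon> \<and>
        max (resid P w) 0 \<le> \<epsilon> \<and>
        \<bar>l * resid P w\<bar> \<le> \<epsilon>)"

definition ENNAMCQ :: "('a::euclidean_space, 'b::euclidean_space) problem \<Rightarrow> bool" where
  "ENNAMCQ P \<longleftrightarrow>
     (\<forall>w\<in>Cs P. resid P w \<ge> 0 \<longrightarrow> 0 \<notin> {grad_resid P w + v | v. v \<in> normal_cone (Cs P) w})"

definition m_rho :: "('a, 'b) problem \<Rightarrow> real" where
  "m_rho P = 1 / rho P - sigma P"

definition L_psi :: "('a, 'b) problem \<Rightarrow> real" where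
  "L_psi P = Lyy P + 1 / rho P"

definition kappa :: "('a, 'b) problem \<Rightarrow> real" where
  "kappa P = L_psi P / m_rho P"


section \<open>Smoothing family\<close>

record smoothing =
  phi :: "real \<Rightarrow> real \<Rightarrow> real"
  dphi :: "real \<Rightarrow> real \<Rightarrow> real"
  a1 :: real
  a2 :: real
  b_phi :: real
  c_phi :: real

definition a_phi :: "smoothing \<Rightarrow> real" where
  "a_phi S = a1 S + a2 S"

definition valid_smoothing :: "smoothing \<Rightarrow> bool" where
  "valid_smoothing S \<longleftrightarrow>
     a1 S \<ge> 0 \<and> a2 S \<ge> 0 \<and> b_phi S \<ge> 0 \<and> c_phi S \<ge> 0 \<and> a_phi S > 0 \<and>
     (\<forall>m>0. convex_on UNIV (phi S m) \<and> mono (phi S m) \<and>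
        (\<forall>t. (phi S m has_real_derivative dphi S m t) (at t)) \<and>
        continuous_on UNIV (dphi S m) \<and>
        (\<forall>t. 0 \<le> dphi S m t \<and> dphi S m t \<le> 1) \<and>
        (\<forall>t. max t 0 - a1 S * m \<le> phi S m t \<and> phi S m t \<le> max t 0 + a2 S * m) \<and>
        (\<forall>t s. \<bar>dphi S m t - dphi S m s\<bar> \<le> b_phi S / m * \<bar>t - s\<bar>)) \<and>
     (\<forall>m0 m1 t. 0 < m1 \<and> m1 \<le> m0 \<longrightarrow> phi S m1 t \<le> phi S m0 t + c_phi S * (m0 - m1))"


section \<open>Algorithm parameters\<close>

text \<open>
  \<open>Fixed L\<close> is Strategy I; \<open>Doubling L\<^sub>m\<^sub>i\<^sub>n L\<^sub>m\<^sub>a\<^sub>x\<close> is Strategy II. The initial trial values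
  \<open>L\<^bsub>k,0\<^esub>\<close> of Strategy II are an input of the run (\<open>L0\<close> below), not a parameter.
\<close>

datatype step_rule = Fixed real | Doubling real real

record ('a, 'b) params =
  c1 :: real
  c2 :: real
  th_low :: real
  th_hat :: real
  w0 :: "'a \<times> 'b"
  mu :: "nat \<Rightarrow> real"
  zeta :: "nat \<Rightarrow> real"
  ghat :: "nat \<Rightarrow> real"
  rule :: step_rule

definition D_rho :: "('a, 'b) problem \<Rightarrow> real \<Rightarrow> real" where
  "D_rho P z = sqrt ((Lxy P)\<^sup>2 + (1 / rho P)\<^sup>2) * sqrt (2 * z / m_rho P)"

definition E_rho :: "('a, 'b) problem \<Rightarrow> smoothing \<Rightarrow> real \<Rightarrow> real \<Rightarrow> real" where
  "E_rho P S m z = D_rho P z + b_phi S * BR P / m * z"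

definition L_G :: "('a, 'b) problem \<Rightarrow> smoothing \<Rightarrow> ('a, 'b) params \<Rightarrow> real" where
  "L_G P S A = b_phi S * (BR P)\<^sup>2 + mu A 0 * LR P"

definition L_safe :: "('a, 'b) problem \<Rightarrow> smoothing \<Rightarrow> ('a, 'b) params \<Rightarrow> real" where
  "L_safe P S A =
     max (th_low A / th_hat A)
         ((c1 A + ghat A 0 * mu A 0 * Lf P + L_G P S A) / (2 - th_hat A))"

definition valid_rule :: "('a, 'b) problem \<Rightarrow> smoothing \<Rightarrow> ('a, 'b) params \<Rightarrow> bool" where
  "valid_rule P S A \<longleftrightarrow>
     (case rule A of
        Fixed L \<Rightarrow> L \<ge> L_safe P S A
      | Doubling Lmin Lmax \<Rightarrow> 0 < Lmin \<and> Lmin \<le> Lmax)"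

definition valid_params :: "('a, 'b) problem \<Rightarrow> smoothing \<Rightarrow> ('a, 'b) params \<Rightarrow> bool" where
  "valid_params P S A \<longleftrightarrow>
     c1 A > 0 \<and> c2 A > 0 \<and> th_low A > 0 \<and> 0 < th_hat A \<and> th_hat A < 2 \<and> w0 A \<in> Cs P \<and>
     (\<forall>k. mu A k > 0) \<and> decseq (mu A) \<and> mu A \<longlonglongrightarrow> 0 \<and>
     (\<forall>k. zeta A k > 0) \<and> decseq (zeta A) \<and> zeta A \<longlonglongrightarrow> 0 \<and>
     (\<forall>t. ghat A t > 0) \<and> (\<forall>t. ghat A (Suc t) < ghat A t) \<and> ghat A \<longlonglongrightarrow> 0 \<and>
     valid_rule P S A"


section \<open>The routine ME\<close>

primrec ME_iter ::
  "('a::euclidean_space, 'b::euclidean_space) problem \<Rightarrow> 'a \<times> 'b \<Rightarrow> 'b \<Rightarrow> nat \<Rightarrow> 'b" where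
  "ME_iter P w zi 0 = zi"
| "ME_iter P w zi (Suc j) =
     closest_point (Ys P)
       (ME_iter P w zi j -
        (1 / L_psi P) *\<^sub>R (snd (grad_g P (fst w, ME_iter P w zi j)) +
                         (1 / rho P) *\<^sub>R (ME_iter P w zi j - snd w)))"

definition ME_res ::
  "('a::euclidean_space, 'b::euclidean_space) problem \<Rightarrow> 'a \<times> 'b \<Rightarrow> 'b \<Rightarrow> nat \<Rightarrow> 'b" where
  "ME_res P w zi j = L_psi P *\<^sub>R (ME_iter P w zi j - ME_iter P w zi (Suc j))"

definition ME_stop ::
  "('a::euclidean_space, 'b::euclidean_space) problem \<Rightarrow> 'a \<times> 'b \<Rightarrow> 'b \<Rightarrow> real \<Rightarrow> nat \<Rightarrow> bool" where
  "ME_stop P w zi \<epsilon> j \<longleftrightarrow> (norm (ME_res P w zi j))\<^sup>2 \<le> 2 * m_rho P * \<epsilon>"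

definition ME_steps ::
  "('a::euclidean_space, 'b::euclidean_space) problem \<Rightarrow> 'a \<times> 'b \<Rightarrow> 'b \<Rightarrow> real \<Rightarrow> nat" where
  "ME_steps P w zi \<epsilon> = Suc (LEAST j. ME_stop P w zi \<epsilon> j)"

definition ME ::
  "('a::euclidean_space, 'b::euclidean_space) problem \<Rightarrow> 'a \<times> 'b \<Rightarrow> 'b \<Rightarrow> real \<Rightarrow> 'b" where
  "ME P w zi \<epsilon> = ME_iter P w zi (ME_steps P w zi \<epsilon>)"

text \<open>Each step evaluates one gradient of \<open>g\<close> and one projection onto \<open>Y\<close>.\<close>

definition ME_cost ::
  "('a::euclidean_space, 'b::euclidean_space) problem \<Rightarrow> 'a \<times> 'b \<Rightarrow> 'b \<Rightarrow> real \<Rightarrow> nat" where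
  "ME_cost P w zi \<epsilon> = 2 * ME_steps P w zi \<epsilon>"

text \<open>
  \<open>LEAST\<close> is unspecified when the stopping test never holds, so termination is a separate
  predicate; it also records that the returned point has the requested accuracy.
\<close>

definition ME_ok ::
  "('a::euclidean_space, 'b::euclidean_space) problem \<Rightarrow> 'a \<times> 'b \<Rightarrow> 'b \<Rightarrow> real \<Rightarrow> bool" where
  "ME_ok P w zi \<epsilon> \<longleftrightarrow> (\<exists>j. ME_stop P w zi \<epsilon> j) \<and> accurate P w \<epsilon> (ME P w zi \<epsilon>)"


section \<open>One iteration of IVSP\<close>

text \<open>
  Arguments \<open>k w z t\<close>: iteration counter, current iterate, its current accurate point, and the
  current index into the penalty grid.
\<close>

definition trial_w ::
  "('a::euclidean_space, 'b::euclidean_space) problem \<Rightarrow> smoothing \<Rightarrow> ('a, 'b) params \<Rightarrow>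
   nat \<Rightarrow> 'a \<times> 'b \<Rightarrow> 'b \<Rightarrow> nat \<Rightarrow> real \<Rightarrow> 'a \<times> 'b" where
  "trial_w P S A k w z t L =
     closest_point (Cs P)
       (w - (mu A k / L) *\<^sub>R
            (ghat A t *\<^sub>R grad_f P w +
             dphi S (mu A k) (resid_at P w z) *\<^sub>R grad_resid_at P w z))"

definition trial_z ::
  "('a::euclidean_space, 'b::euclidean_space) problem \<Rightarrow> smoothing \<Rightarrow> ('a, 'b) params \<Rightarrow>
   nat \<Rightarrow> 'a \<times> 'b \<Rightarrow> 'b \<Rightarrow> nat \<Rightarrow> real \<Rightarrow> 'b" where
  "trial_z P S A k w z t L = ME P (trial_w P S A k w z t L) z (zeta A (Suc k))"

definition trial_resid ::
  "('a::euclidean_space, 'b::euclidean_space) problem \<Rightarrow> smoothing \<Rightarrow> ('a, 'b) params \<Rightarrow>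
   nat \<Rightarrow> 'a \<times> 'b \<Rightarrow> 'b \<Rightarrow> nat \<Rightarrow> real \<Rightarrow> real" where
  "trial_resid P S A k w z t L =
     resid_at P (trial_w P S A k w z t L) (trial_z P S A k w z t L)"

definition theta ::
  "('a::euclidean_space, 'b::euclidean_space) problem \<Rightarrow> smoothing \<Rightarrow> ('a, 'b) params \<Rightarrow>
   nat \<Rightarrow> 'a \<times> 'b \<Rightarrow> 'b \<Rightarrow> nat \<Rightarrow> real \<Rightarrow> real" where
  "theta P S A k w z t L =
     (let d = norm (trial_w P S A k w z t L - w);
          E = E_rho P S (mu A k) (zeta A k)
      in max (if d = 0 then th_hat A * L else min (mu A k * E / d) (th_hat A * L)) (th_low A))"

definition tau ::
  "('a::euclidean_space, 'b::euclidean_space) problem \<Rightarrow> smoothing \<Rightarrow> ('a, 'b) params \<Rightarrow>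
   nat \<Rightarrow> 'a \<times> 'b \<Rightarrow> 'b \<Rightarrow> nat \<Rightarrow> real \<Rightarrow> real" where
  "tau P S A k w z t L =
     mu A k / (2 * theta P S A k w z t L) * (E_rho P S (mu A k) (zeta A k))\<^sup>2 +
     zeta A k + zeta A (Suc k)"

definition accepts ::
  "('a::euclidean_space, 'b::euclidean_space) problem \<Rightarrow> smoothing \<Rightarrow> ('a, 'b) params \<Rightarrow>
   nat \<Rightarrow> 'a \<times> 'b \<Rightarrow> 'b \<Rightarrow> nat \<Rightarrow> real \<Rightarrow> bool" where
  "accepts P S A k w z t L \<longleftrightarrow>
     ghat A t * ff P (trial_w P S A k w z t L) +
       phi S (mu A k) (trial_resid P S A k w z t L + zeta A (Suc k))
     \<le> ghat A t * ff P w + phi S (mu A k) (resid_at P w z)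
       - c1 A / (2 * mu A k) * (norm (trial_w P S A k w z t L - w))\<^sup>2
       + tau P S A k w z t L"

definition trial_L :: "('a, 'b) params \<Rightarrow> (nat \<Rightarrow> real) \<Rightarrow> nat \<Rightarrow> nat \<Rightarrow> real" where
  "trial_L A L0 k i = (case rule A of Fixed L \<Rightarrow> L | Doubling Lmin Lmax \<Rightarrow> 2 ^ i * L0 k)"

text \<open>The index of the accepted trial; the iteration performs one trial more than this.\<close>

definition accepted ::
  "('a::euclidean_space, 'b::euclidean_space) problem \<Rightarrow> smoothing \<Rightarrow> ('a, 'b) params \<Rightarrow>
   (nat \<Rightarrow> real) \<Rightarrow> nat \<Rightarrow> 'a \<times> 'b \<Rightarrow> 'b \<Rightarrow> nat \<Rightarrow> nat" where
  "accepted P S A L0 k w z t =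
     (case rule A of
        Fixed L \<Rightarrow> 0
      | Doubling Lmin Lmax \<Rightarrow> (LEAST i. accepts P S A k w z t (trial_L A L0 k i)))"

definition step_L ::
  "('a::euclidean_space, 'b::euclidean_space) problem \<Rightarrow> smoothing \<Rightarrow> ('a, 'b) params \<Rightarrow>
   (nat \<Rightarrow> real) \<Rightarrow> nat \<Rightarrow> 'a \<times> 'b \<Rightarrow> 'b \<Rightarrow> nat \<Rightarrow> real" where
  "step_L P S A L0 k w z t = trial_L A L0 k (accepted P S A L0 k w z t)"

definition ivsp_step ::
  "('a::euclidean_space, 'b::euclidean_space) problem \<Rightarrow> smoothing \<Rightarrow> ('a, 'b) params \<Rightarrow>
   (nat \<Rightarrow> real) \<Rightarrow> nat \<Rightarrow> ('a \<times> 'b) \<times> 'b \<times> nat \<Rightarrow> ('a \<times> 'b) \<times> 'b \<times> nat" where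
  "ivsp_step P S A L0 k = (\<lambda>(w, z, t).
     let L = step_L P S A L0 k w z t;
         w' = trial_w P S A k w z t L;
         z' = trial_z P S A k w z t L
     in (w', z',
         if resid_at P w' z' > 2 * a_phi S * mu A k \<and> norm (w' - w) \<le> c2 A * mu A k * ghat A t
         then Suc t else t))"

text \<open>
  Outside ME, an iteration evaluates three gradients, namely those of \<open>f\<close> and \<open>g\<close> at \<open>w\<close> and that
  of \<open>g\<close> at \<open>(x, z)\<close>, and every trial projects once onto \<open>C\<close>.
\<close>

definition ivsp_step_cost ::
  "('a::euclidean_space, 'b::euclidean_space) problem \<Rightarrow> smoothing \<Rightarrow> ('a, 'b) params \<Rightarrow>
   (nat \<Rightarrow> real) \<Rightarrow> nat \<Rightarrow> ('a \<times> 'b) \<times> 'b \<times> nat \<Rightarrow> nat" where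
  "ivsp_step_cost P S A L0 k = (\<lambda>(w, z, t).
     3 + (\<Sum>i\<le>accepted P S A L0 k w z t.
            1 + ME_cost P (trial_w P S A k w z t (trial_L A L0 k i)) z (zeta A (Suc k))))"


section \<open>Runs of IVSP\<close>

text \<open>A run is determined by the starting point \<open>zi\<close> of the first evaluation and by \<open>L0\<close>.\<close>

primrec ivsp ::
  "('a::euclidean_space, 'b::euclidean_space) problem \<Rightarrow> smoothing \<Rightarrow> ('a, 'b) params \<Rightarrow>
   'b \<Rightarrow> (nat \<Rightarrow> real) \<Rightarrow> nat \<Rightarrow> ('a \<times> 'b) \<times> 'b \<times> nat" where
  "ivsp P S A zi L0 0 = (w0 A, ME P (w0 A) zi (zeta A 0), 0)"
| "ivsp P S A zi L0 (Suc k) = ivsp_step P S A L0 k (ivsp P S A zi L0 k)"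

definition ivsp_w ::
  "('a::euclidean_space, 'b::euclidean_space) problem \<Rightarrow> smoothing \<Rightarrow> ('a, 'b) params \<Rightarrow>
   'b \<Rightarrow> (nat \<Rightarrow> real) \<Rightarrow> nat \<Rightarrow> 'a \<times> 'b" where
  "ivsp_w P S A zi L0 k = fst (ivsp P S A zi L0 k)"

definition ivsp_cost ::
  "('a::euclidean_space, 'b::euclidean_space) problem \<Rightarrow> smoothing \<Rightarrow> ('a, 'b) params \<Rightarrow>
   'b \<Rightarrow> (nat \<Rightarrow> real) \<Rightarrow> nat \<Rightarrow> nat" where
  "ivsp_cost P S A zi L0 K =
     ME_cost P (w0 A) zi (zeta A 0) +
     (\<Sum>k\<le>K. ivsp_step_cost P S A L0 k (ivsp P S A zi L0 k))"

definition valid_inputs ::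
  "('a, 'b) problem \<Rightarrow> ('a, 'b) params \<Rightarrow> 'b \<Rightarrow> (nat \<Rightarrow> real) \<Rightarrow> bool" where
  "valid_inputs P A zi L0 \<longleftrightarrow> zi \<in> Ys P \<and>
     (case rule A of
        Fixed L \<Rightarrow> True
      | Doubling Lmin Lmax \<Rightarrow> (\<forall>k. Lmin \<le> L0 k \<and> L0 k \<le> Lmax))"

text \<open>Under Strategy II the bound entails that every line search terminates.\<close>

definition ls_bound ::
  "('a::euclidean_space, 'b::euclidean_space) problem \<Rightarrow> smoothing \<Rightarrow> ('a, 'b) params \<Rightarrow>
   'b \<Rightarrow> (nat \<Rightarrow> real) \<Rightarrow> nat \<Rightarrow> bool" where
  "ls_bound P S A zi L0 B \<longleftrightarrow>
     (case rule A of
        Fixed L \<Rightarrow> B = 1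
      | Doubling Lmin Lmax \<Rightarrow>
          (\<forall>k. case ivsp P S A zi L0 k of (w, z, t) \<Rightarrow>
             (\<exists>i. Suc i \<le> B \<and> accepts P S A k w z t (trial_L A L0 k i))))"

definition evaluations_ok ::
  "('a::euclidean_space, 'b::euclidean_space) problem \<Rightarrow> smoothing \<Rightarrow> ('a, 'b) params \<Rightarrow>
   'b \<Rightarrow> (nat \<Rightarrow> real) \<Rightarrow> bool" where
  "evaluations_ok P S A zi L0 \<longleftrightarrow>
     ME_ok P (w0 A) zi (zeta A 0) \<and>
     (\<forall>k. case ivsp P S A zi L0 k of (w, z, t) \<Rightarrow>
        (\<forall>i\<le>accepted P S A L0 k w z t.
           ME_ok P (trial_w P S A k w z t (trial_L A L0 k i)) z (zeta A (Suc k))))"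


section \<open>Suppressing logarithmic factors\<close>

definition soft_O :: "real filter \<Rightarrow> (real \<Rightarrow> real) \<Rightarrow> (real \<Rightarrow> real) set" where
  "soft_O F h = {u. \<exists>p::nat. u \<in> O[F](\<lambda>x. h x * ln (h x) ^ p)}"

end

theory Submission
  imports Defs
begin

text \<open>
  Growth of \<open>\<psi>\<close> makes the inner projected-gradient routine converge linearly, so an evaluation of
  accuracy \<open>\<zeta>\<^sub>k\<close> costs \<open>O(\<kappa> log (1/\<zeta>\<^sub>k)) = O(\<kappa> log k)\<close>, which gives the bound through iteration \<open>K\<close>.
  For the KKT bound, \<open>\<gamma>\<^sub>k (f - min f) + \<phi>\<^sub>\<mu>(R) + c \<mu>\<^sub>k\<close> decreases by \<open>\<parallel>w\<^sup>k\<^sup>+\<^sup>1 - w\<^sup>k\<parallel>\<^sup>2 / \<mu>\<^sub>k\<close> up to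
  summable errors. The constraint qualification holds uniformly by compactness, which excludes penalty
  updates once \<open>\<gamma>\<^sub>k\<close> is small; hence \<open>\<gamma>\<^sub>k\<close> stays bounded below. In a window \<open>[N, 2N]\<close> some iteration
  then has no update and \<open>\<parallel>w\<^sup>k\<^sup>+\<^sup>1 - w\<^sup>k\<parallel>\<^sup>2 / \<mu>\<^sub>k = O(1/N)\<close>, and for \<open>\<mu>\<^sub>k \<sim> k\<^sup>-\<^sup>1\<^sup>/\<^sup>3\<close> all KKT residuals at
  \<open>w\<^sup>k\<^sup>+\<^sup>1\<close>, being \<open>O(\<mu>\<^sub>k + \<parallel>w\<^sup>k\<^sup>+\<^sup>1 - w\<^sup>k\<parallel> / \<mu>\<^sub>k)\<close>, are \<open>O(N\<^sup>-\<^sup>1\<^sup>/\<^sup>3)\<close>.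
\<close>

section \<open>Gradients relative to a convex set\<close>

text \<open>\<open>C\<close> may have empty interior, so all derivatives are taken within the set,
  and a predicate relates a function to a given gradient field instead of choosing one. The
  constants of the conclusion are fixed before \<open>zi\<close>, \<open>L0\<close> and the line
  search bound; hence every estimate on runs is obtained outside the run to which it is applied. The
  exponent 1/3 is a balance: \<open>step^2 / \<mu> = O(1/N)\<close> gives
  \<open>(step / \<mu>)^2 = O(1 / (N \<mu>))\<close>, and \<open>step / \<mu>\<close> then has the
  order of \<mu> exactly when \<mu> is of order N^(-1/3). The condition q > 1/r enters as r q > 1,
  which makes the tolerances summable. For r = 1/3 it also gives q > 3, so the tolerances are
  O(\<mu>^2); this cancels the factor 1/\<mu> that smoothing puts into the gradient error. The lower
  bound on the tolerances keeps ln (1 / \<open>zeta A k\<close>) of order ln k.\<close>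

definition has_grad_on :: "'c::real_inner set \<Rightarrow> ('c \<Rightarrow> real) \<Rightarrow> ('c \<Rightarrow> 'c) \<Rightarrow> bool" where
  "has_grad_on S h dh \<longleftrightarrow> (\<forall>z\<in>S. (h has_derivative (\<lambda>d. d \<bullet> dh z)) (at z within S))"

lemma C1_near_has_grad_on: "C1_near S h dh \<Longrightarrow> has_grad_on S h dh"
  unfolding C1_near_def has_grad_on_def gderiv_def by (meson has_derivative_at_withinI subsetD)

lemma has_grad_on_imp_continuous_on: "has_grad_on S h dh \<Longrightarrow> continuous_on S h"
  unfolding has_grad_on_def continuous_on_eq_continuous_within
  by (metis has_derivative_continuous)

lemma has_grad_on_add:
  assumes "has_grad_on S h dh" "has_grad_on S k dk"
  shows "has_grad_on S (\<lambda>z. h z + k z) (\<lambda>z. dh z + dk z)"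
  using assms unfolding has_grad_on_def by (auto simp: inner_add_right intro!: has_derivative_add)

lemma has_grad_on_cmult:
  assumes "has_grad_on S h dh"
  shows "has_grad_on S (\<lambda>z. c * h z) (\<lambda>z. c *\<^sub>R dh z)"
  using assms unfolding has_grad_on_def
  by (auto intro!: has_derivative_mult_right)

lemma has_grad_on_norm_sq: "has_grad_on S (\<lambda>z. (norm (z - a))\<^sup>2) (\<lambda>z. 2 *\<^sub>R (z - a))"
  unfolding has_grad_on_def power2_norm_eq_inner
  by (auto intro!: derivative_eq_intros simp: inner_commute)

lemma has_grad_on_compose:
  assumes "has_grad_on S h dh" "\<And>t. (p has_real_derivative dp t) (at t)"
  shows "has_grad_on S (\<lambda>z. p (h z)) (\<lambda>z. dp (h z) *\<^sub>R dh z)"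
  unfolding has_grad_on_def
proof
  fix z assume "z \<in> S"
  then have "(h has_derivative (\<lambda>d. d \<bullet> dh z)) (at z within S)"
    using assms(1) unfolding has_grad_on_def by auto
  from has_derivative_compose[OF this assms(2)[of "h z", unfolded has_field_derivative_def]]
  show "((\<lambda>z. p (h z)) has_derivative (\<lambda>d. d \<bullet> dp (h z) *\<^sub>R dh z)) (at z within S)"
    by (simp add: mult.commute)
qed

text \<open>A quadratic error is o(distance). This is how \<open>R\<close> gets its derivative: it
  contains a minimum over \<open>z\<close>, which the calculus rules above do not reach.\<close>

lemma has_grad_on_remainder:
  fixes h :: "'c::real_inner \<Rightarrow> real"
  assumes "\<And>u v. u \<in> S \<Longrightarrow> v \<in> S \<Longrightarrow> \<bar>h v - h u - dh u \<bullet> (v - u)\<bar> \<le> M * (norm (v - u))\<^sup>2"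
  shows "has_grad_on S h dh"
  unfolding has_grad_on_def
proof
  fix u assume u: "u \<in> S"
  show "(h has_derivative (\<lambda>d. d \<bullet> dh u)) (at u within S)"
    unfolding has_derivative_within_alt
  proof (intro conjI allI impI)
    show "bounded_linear (\<lambda>d. d \<bullet> dh u)" by (rule bounded_linear_inner_left)
  next
    fix e :: real assume e: "e > 0"
    have "norm (h v - h u - (v - u) \<bullet> dh u) \<le> e * norm (v - u)"
      if v: "v \<in> S" and d: "norm (v - u) < e / (\<bar>M\<bar> + 1)" for v
    proof -
      have "norm (h v - h u - (v - u) \<bullet> dh u) \<le> M * (norm (v - u))\<^sup>2"
        using assms[OF u v] by (simp add: inner_commute)
      also have "\<dots> \<le> ((\<bar>M\<bar> + 1) * norm (v - u)) * norm (v - u)"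
        by (simp only: power2_eq_square mult.assoc[symmetric]) (intro mult_right_mono, auto)
      also have "\<dots> \<le> e * norm (v - u)"
        using d by (intro mult_right_mono) (auto simp: field_simps)
      finally show ?thesis .
    qed
    then show "\<exists>d>0. \<forall>y\<in>S. norm (y - u) < d \<longrightarrow> norm (h y - h u - (y - u) \<bullet> dh u) \<le> e * norm (y - u)"
      using e by (intro exI[of _ "e / (\<bar>M\<bar> + 1)"]) auto
  qed
qed

text \<open>Convexity keeps the segment inside \<open>S\<close>; the derivative is within
  \<open>{0..1}\<close> because only one side is available at the endpoints.\<close>

lemma segment_derivative:
  assumes "has_grad_on S h dh" "convex S" "u \<in> S" "v \<in> S" "0 \<le> t" "t \<le> 1"
  shows "((\<lambda>t. h (u + t *\<^sub>R (v - u))) has_real_derivative dh (u + t *\<^sub>R (v - u)) \<bullet> (v - u))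
           (at t within {0..1})"
proof -
  have mem: "u + s *\<^sub>R (v - u) \<in> S" if "s \<in> {0..1}" for s
  proof -
    have "(1 - s) *\<^sub>R u + s *\<^sub>R v \<in> S" using that assms by (intro convexD) auto
    then show ?thesis by (simp add: algebra_simps)
  qed
  have 1: "((\<lambda>t. u + t *\<^sub>R (v - u)) has_derivative (\<lambda>s. s *\<^sub>R (v - u))) (at t within {0..1})"
    by (auto intro!: derivative_eq_intros)
  have 2: "(h has_derivative (\<lambda>d. d \<bullet> dh (u + t *\<^sub>R (v - u))))
      (at (u + t *\<^sub>R (v - u)) within (\<lambda>t. u + t *\<^sub>R (v - u)) ` {0..1})"
  proof (rule has_derivative_subset)
    show "(h has_derivative (\<lambda>d. d \<bullet> dh (u + t *\<^sub>R (v - u)))) (at (u + t *\<^sub>R (v - u)) within S)"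
      using assms(1) mem[of t] assms(5,6) unfolding has_grad_on_def by simp
    show "(\<lambda>t. u + t *\<^sub>R (v - u)) ` {0..1} \<subseteq> S" using mem by auto
  qed
  have "(\<lambda>s. (s *\<^sub>R (v - u)) \<bullet> dh (u + t *\<^sub>R (v - u))) = (*) (dh (u + t *\<^sub>R (v - u)) \<bullet> (v - u))"
    by (simp add: fun_eq_iff inner_commute)
  with has_derivative_in_compose[OF 1 2] show ?thesis
    unfolding has_field_derivative_def by argo
qed

lemma grad_lipschitz_upper:
  assumes g: "has_grad_on S h dh" and "convex S" and L: "M-lipschitz_on S dh" and uv: "u \<in> S" "v \<in> S"
  shows "h v \<le> h u + dh u \<bullet> (v - u) + M / 2 * (norm (v - u))\<^sup>2"
proof -
  define d where "d = v - u"
  let ?p = "\<lambda>t. u + t *\<^sub>R d"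
  let ?k = "\<lambda>t. h (?p t) - (dh u \<bullet> d) * t - M / 2 * (norm d)\<^sup>2 * t\<^sup>2"
  let ?k' = "\<lambda>t. dh (?p t) \<bullet> d - dh u \<bullet> d - M * (norm d)\<^sup>2 * t"
  have der: "(?k has_real_derivative ?k' t) (at t within {0..1})" if "0 \<le> t" "t \<le> 1" for t
    using segment_derivative[OF g \<open>convex S\<close> uv that] unfolding d_def
    by (auto intro!: derivative_eq_intros)
  have neg: "?k' t \<le> 0" if t: "0 \<le> t" "t \<le> 1" for t
  proof -
    have "(1 - t) *\<^sub>R u + t *\<^sub>R v \<in> S" using t \<open>convex S\<close> uv by (intro convexD) auto
    then have "?p t \<in> S" by (simp add: algebra_simps d_def)
    then have "norm (dh (?p t) - dh u) \<le> M * norm (t *\<^sub>R d)"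
      using lipschitz_onD[OF L, of "?p t" u] uv by (simp add: dist_norm)
    then have "(dh (?p t) - dh u) \<bullet> d \<le> (M * norm (t *\<^sub>R d)) * norm d"
      using norm_cauchy_schwarz[of "dh (?p t) - dh u" d] mult_right_mono[of _ _ "norm d"]
      by (meson norm_ge_zero order_trans)
    then show ?thesis using t by (simp add: inner_diff_left power2_eq_square mult_ac)
  qed
  have "\<exists>t\<in>{0..1}. ?k 1 - ?k 0 = ?k' t * (1 - 0)"
    by (rule mvt_very_simple) (use der in \<open>auto simp: has_field_derivative_def\<close>)
  then have "?k 1 \<le> ?k 0" using neg by fastforce
  then show ?thesis by (simp add: d_def)
qed

lemma grad_lipschitz_abs:
  assumes g: "has_grad_on S h dh" and "convex S" and L: "M-lipschitz_on S dh" and uv: "u \<in> S" "v \<in> S"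
  shows "\<bar>h v - h u - dh u \<bullet> (v - u)\<bar> \<le> M / 2 * (norm (v - u))\<^sup>2"
proof -
  have "has_grad_on S (\<lambda>z. - 1 * h z) (\<lambda>z. - 1 *\<^sub>R dh z)" by (rule has_grad_on_cmult[OF g])
  moreover have "M-lipschitz_on S (\<lambda>z. - 1 *\<^sub>R dh z)"
    using L by (auto simp: lipschitz_on_def dist_minus)
  ultimately have "- 1 * h v \<le> - 1 * h u + (- 1 *\<^sub>R dh u) \<bullet> (v - u) + M / 2 * (norm (v - u))\<^sup>2"
    using grad_lipschitz_upper \<open>convex S\<close> uv by blast
  then show ?thesis using grad_lipschitz_upper[OF assms]
    by (simp only: inner_scaleR_left abs_le_iff) auto
qed

lemma grad_bounded_lipschitz:
  assumes "has_grad_on S h dh" "convex S" "\<And>z. z \<in> S \<Longrightarrow> norm (dh z) \<le> B" "u \<in> S" "v \<in> S"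
  shows "\<bar>h u - h v\<bar> \<le> B * norm (u - v)"
proof -
  have "norm (h u - h v) \<le> B * norm (u - v)"
  proof (rule differentiable_bound[OF \<open>convex S\<close> _ _ \<open>u \<in> S\<close> \<open>v \<in> S\<close>])
    show "(h has_derivative (\<lambda>d. d \<bullet> dh x)) (at x within S)" if "x \<in> S" for x
      using assms that unfolding has_grad_on_def by auto
    show "onorm (\<lambda>d. d \<bullet> dh x) \<le> B" if "x \<in> S" for x
    proof (rule onorm_bound)
      show "0 \<le> B" using assms(3)[OF that] norm_ge_zero order_trans by blast
      fix d
      have "norm (d \<bullet> dh x) \<le> norm d * norm (dh x)"
        by (simp add: Cauchy_Schwarz_ineq2)
      also have "\<dots> \<le> norm d * B"
        using assms(3)[OF that] by (intro mult_left_mono) auto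
      finally show "norm (d \<bullet> dh x) \<le> B * norm d" by (simp add: mult.commute)
    qed
  qed
  then show ?thesis by simp
qed

text \<open>Chord slopes from \<open>u\<close> towards \<open>v\<close> never exceed
  \<open>h v - h u\<close>, and their limit at \<open>t = 0\<close> is the directional
  derivative.\<close>

lemma convex_on_gradient_ineq:
  assumes cv: "convex_on S h" and g: "has_grad_on S h dh" and uv: "u \<in> S" "v \<in> S"
  shows "h u + dh u \<bullet> (v - u) \<le> h v"
proof -
  have S: "convex S" using cv by (rule convex_on_imp_convex)
  have "((\<lambda>t. h (u + t *\<^sub>R (v - u))) has_real_derivative dh u \<bullet> (v - u)) (at 0 within {0..1})"
    using segment_derivative[OF g S uv, of 0] by simp
  then have lim: "((\<lambda>t. (h (u + t *\<^sub>R (v - u)) - h u) / t) \<longlongrightarrow> dh u \<bullet> (v - u)) (at 0 within {0..1})"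
    by (simp add: has_field_derivative_iff)
  have "eventually (\<lambda>t. (h (u + t *\<^sub>R (v - u)) - h u) / t \<le> h v - h u) (at 0 within {0..1::real})"
    unfolding eventually_at_filter
  proof (intro always_eventually allI impI)
    fix t :: real assume "t \<noteq> 0" "t \<in> {0..1}"
    then have t: "0 < t" "t \<le> 1" by auto
    have "h ((1 - t) *\<^sub>R u + t *\<^sub>R v) \<le> (1 - t) * h u + t * h v"
      by (rule convex_onD[OF cv]) (use t uv in auto)
    then show "(h (u + t *\<^sub>R (v - u)) - h u) / t \<le> h v - h u"
      using t by (simp add: field_simps algebra_simps)
  qed
  moreover have "at (0::real) within {0..1} \<noteq> bot"
    using not_trivial_limit_within_ball[of 0 "{0..1::real}"]
    by (simp add: trivial_limit_within islimpt_finite)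
  ultimately have "dh u \<bullet> (v - u) \<le> h v - h u"
    by (intro tendsto_upperbound[OF lim])
  then show ?thesis by simp
qed

section \<open>The Moreau subproblem and the projected-gradient step\<close>

locale moreau =
  fixes P :: "('a::euclidean_space, 'b::euclidean_space) problem"
  assumes vp: "valid_problem P"
begin

abbreviation "C \<equiv> Cs P"
abbreviation "Y \<equiv> Ys P"
abbreviation "X \<equiv> Xs P"
abbreviation "m \<equiv> m_rho P"
abbreviation "L \<equiv> L_psi P"
abbreviation "R \<equiv> resid P"
abbreviation "dR \<equiv> grad_resid P"

definition dpsi :: "'b \<Rightarrow> 'a \<times> 'b \<Rightarrow> 'b" where
  "dpsi z w = snd (grad_g P (fst w, z)) + (1 / rho P) *\<^sub>R (z - snd w)"

text \<open>Gradient of \<open>psi P z\<close> in \<open>w\<close> for frozen \<open>z\<close>. By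
  the envelope principle, \<open>grad_g P w\<close> minus this field at \<open>z = z_rho P w\<close>
  is the gradient of the residual.\<close>

definition dpsi_w :: "'b \<Rightarrow> 'a \<times> 'b \<Rightarrow> 'a \<times> 'b" where
  "dpsi_w z w = (fst (grad_g P (fst w, z)), (1 / rho P) *\<^sub>R (snd w - z))"

lemma X: "X \<noteq> {}" "compact X" "convex X" and Y: "Y \<noteq> {}" "compact Y" "convex Y" "closed Y"
  using vp compact_imp_closed unfolding valid_problem_def by auto

lemma C: "C \<noteq> {}" "compact C" "convex C" "closed C"
  using X Y compact_imp_closed[OF compact_Times] unfolding Cs_def
  by (auto intro: compact_Times convex_Times)

lemma in_C: "w \<in> C \<longleftrightarrow> fst w \<in> X \<and> snd w \<in> Y" "w \<in> C \<Longrightarrow> z \<in> Y \<Longrightarrow> (fst w, z) \<in> C"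
  by (auto simp: Cs_def mem_Times_iff)

lemma rho_pos: "rho P > 0" and m_pos: "m > 0" and m_less_L: "m < L" and L_pos: "L > 0"
proof -
  show r: "rho P > 0" using vp unfolding valid_problem_def by auto
  show m: "m > 0" using vp r unfolding valid_problem_def m_rho_def by (simp add: field_simps)
  show l: "m < L" using vp r unfolding valid_problem_def m_rho_def L_psi_def by simp
  show "L > 0" using m l by simp
qed

lemma LR_pos: "LR P > 0" and BR_pos: "BR P > 0"
  using vp unfolding valid_problem_def by auto

lemma has_grad_f: "has_grad_on C (ff P) (grad_f P)" and has_grad_g: "has_grad_on C (gg P) (grad_g P)"
  using vp unfolding valid_problem_def by (auto intro: C1_near_has_grad_on)

lemma lip_f: "(Lf P)-lipschitz_on C (grad_f P)" and lip_g: "(Lg P)-lipschitz_on C (grad_g P)"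
  and lip_R: "(LR P)-lipschitz_on C dR"
  and lip_xy: "x \<in> X \<Longrightarrow> (Lxy P)-lipschitz_on Y (\<lambda>y. fst (grad_g P (x, y)))"
  and lip_yy: "x \<in> X \<Longrightarrow> (Lyy P)-lipschitz_on Y (\<lambda>y. snd (grad_g P (x, y)))"
  and dR_bound: "w \<in> C \<Longrightarrow> norm (dR w) \<le> BR P"
  using vp unfolding valid_problem_def by auto

lemma has_grad_g_y:
  assumes "x \<in> X"
  shows "has_grad_on Y (\<lambda>z. gg P (x, z)) (\<lambda>z. snd (grad_g P (x, z)))"
  unfolding has_grad_on_def
proof
  fix z assume z: "z \<in> Y"
  have 1: "((\<lambda>z. (x, z)) has_derivative (\<lambda>d. (0, d))) (at z within Y)"
    by (auto intro!: derivative_eq_intros)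
  have "(gg P has_derivative (\<lambda>d. d \<bullet> grad_g P (x, z))) (at (x, z) within C)"
    using has_grad_g assms z unfolding has_grad_on_def by (simp add: in_C)
  then have 2: "(gg P has_derivative (\<lambda>d. d \<bullet> grad_g P (x, z))) (at (x, z) within (\<lambda>z. (x, z)) ` Y)"
    by (rule has_derivative_subset) (use assms in \<open>auto simp: in_C\<close>)
  show "((\<lambda>z. gg P (x, z)) has_derivative (\<lambda>d. d \<bullet> snd (grad_g P (x, z)))) (at z within Y)"
    using has_derivative_in_compose[OF 1 2] by (simp add: inner_prod_def)
qed

lemma has_grad_psi:
  assumes "w \<in> C"
  shows "has_grad_on Y (\<lambda>z. psi P z w) (\<lambda>z. dpsi z w)"
proof -
  have "has_grad_on Y (\<lambda>z. gg P (fst w, z) + 1 / (2 * rho P) * (norm (z - snd w))\<^sup>2)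
     (\<lambda>z. snd (grad_g P (fst w, z)) + (1 / (2 * rho P)) *\<^sub>R (2 *\<^sub>R (z - snd w)))"
    using assms by (intro has_grad_on_add has_grad_g_y has_grad_on_cmult has_grad_on_norm_sq)
      (auto simp: in_C)
  then show ?thesis unfolding psi_def[abs_def] dpsi_def[abs_def] by simp
qed

lemma lip_dpsi:
  assumes "w \<in> C"
  shows "L-lipschitz_on Y (\<lambda>z. dpsi z w)"
proof -
  have "(1 / rho P)-lipschitz_on Y (\<lambda>z. (1 / rho P) *\<^sub>R (z - snd w))"
    using rho_pos by (intro lipschitz_onI) (auto simp: dist_norm scaleR_diff_right[symmetric])
  then show ?thesis unfolding dpsi_def L_psi_def
    using assms by (intro lipschitz_on_add lip_yy) (auto simp: in_C)
qed

lemma psi_smooth: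
  assumes "w \<in> C" "z \<in> Y" "u \<in> Y"
  shows "psi P u w \<le> psi P z w + dpsi z w \<bullet> (u - z) + L / 2 * (norm (u - z))\<^sup>2"
  by (rule grad_lipschitz_upper[OF has_grad_psi _ lip_dpsi]) (use assms Y in auto)

text \<open>The proximal term equals its own second-order expansion, with curvature
  \<open>1 / rho P\<close>, and \<open>g\<close> has curvature at least \<open>- sigma P\<close>;
  the modulus \<open>m\<close> is what remains.\<close>

lemma psi_strongly_convex:
  assumes "w \<in> C" "z \<in> Y" "u \<in> Y"
  shows "psi P z w + dpsi z w \<bullet> (u - z) + m / 2 * (norm (u - z))\<^sup>2 \<le> psi P u w"
proof -
  let ?x = "fst w" let ?y = "snd w"
  have x: "?x \<in> X" using assms in_C by auto
  have cv: "convex_on Y (\<lambda>y. gg P (?x, y) + sigma P / 2 * (norm (y - 0))\<^sup>2)"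
    using vp x unfolding valid_problem_def by auto
  have "has_grad_on Y (\<lambda>y. gg P (?x, y) + sigma P / 2 * (norm (y - 0))\<^sup>2)
      (\<lambda>y. snd (grad_g P (?x, y)) + (sigma P / 2) *\<^sub>R (2 *\<^sub>R (y - 0)))"
    by (intro has_grad_on_add has_grad_g_y x has_grad_on_cmult has_grad_on_norm_sq)
  from convex_on_gradient_ineq[OF cv this assms(2,3)]
  have "gg P (?x, z) + snd (grad_g P (?x, z)) \<bullet> (u - z) - sigma P / 2 * (norm (u - z))\<^sup>2
      \<le> gg P (?x, u)"
    by (simp add: power2_norm_eq_inner algebra_simps inner_commute)
  moreover have "1 / (2 * rho P) * (norm (z - ?y))\<^sup>2 + ((1 / rho P) *\<^sub>R (z - ?y)) \<bullet> (u - z)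
      + 1 / (2 * rho P) * (norm (u - z))\<^sup>2 = 1 / (2 * rho P) * (norm (u - ?y))\<^sup>2"
    using rho_pos by (simp add: power2_norm_eq_inner inner_commute field_simps inner_diff_left inner_diff_right)
  ultimately show ?thesis
    unfolding psi_def dpsi_def m_rho_def by (simp add: inner_add_left algebra_simps diff_divide_distrib)
qed

definition pg_step :: "'a \<times> 'b \<Rightarrow> 'b \<Rightarrow> 'b" where
  "pg_step w z = closest_point Y (z - (1 / L) *\<^sub>R dpsi z w)"

lemma pg_step_in: "pg_step w z \<in> Y"
  unfolding pg_step_def using Y closest_point_in_set by auto

text \<open>Sum of three inequalities: optimality of the projection, smoothness between
  \<open>z\<close> and the new point, strong convexity between \<open>z\<close> and
  \<open>u\<close>. The vector \<open>r\<close> is the gradient mapping. Quadratic growth, the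
  contraction rate and the validity of the stopping test are all instances of this one
  estimate.\<close>

lemma pg_step_ineq:
  assumes "w \<in> C" "z \<in> Y" "u \<in> Y"
  defines "r \<equiv> L *\<^sub>R (z - pg_step w z)"
  shows "psi P (pg_step w z) w + r \<bullet> (u - z) + (norm r)\<^sup>2 / (2 * L) + m / 2 * (norm (u - z))\<^sup>2
      \<le> psi P u w"
proof -
  let ?z = "pg_step w z" let ?d = "dpsi z w"
  have "(z - (1 / L) *\<^sub>R ?d - ?z) \<bullet> (u - ?z) \<le> 0"
    unfolding pg_step_def using closest_point_dot[of Y u] Y assms(3) by auto
  then have "L * ((z - (1 / L) *\<^sub>R ?d - ?z) \<bullet> (u - ?z)) \<le> 0"
    using L_pos by (simp add: mult_le_0_iff)
  also have "L * ((z - (1 / L) *\<^sub>R ?d - ?z) \<bullet> (u - ?z)) = (r - ?d) \<bullet> (u - ?z)"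
    unfolding r_def using L_pos by (simp add: inner_diff_left algebra_simps)
  finally have "r \<bullet> (u - ?z) \<le> ?d \<bullet> (u - ?z)" by (simp add: inner_diff_left)
  moreover have "?d \<bullet> (u - z) = ?d \<bullet> (u - ?z) + ?d \<bullet> (?z - z)" by (simp add: inner_diff_right)
  moreover have "r \<bullet> (u - ?z) = r \<bullet> (u - z) + (norm r)\<^sup>2 / L"
  proof -
    have "(norm r)\<^sup>2 / L = r \<bullet> (z - ?z)"
      unfolding power2_norm_eq_inner using L_pos by (simp add: r_def)
    then show ?thesis by (simp add: inner_diff_right)
  qed
  moreover have "L / 2 * (norm (?z - z))\<^sup>2 = (norm r)\<^sup>2 / (2 * L)"
    unfolding r_def using L_pos by (simp add: power2_eq_square norm_minus_commute)
  moreover note psi_smooth[OF assms(1,2) pg_step_in[of w z]] psi_strongly_convex[OF assms(1-3)]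
  moreover have "(norm r)\<^sup>2 / L = 2 * ((norm r)\<^sup>2 / (2 * L))" by simp
  ultimately show ?thesis by linarith
qed

lemma psi_continuous: "w \<in> C \<Longrightarrow> continuous_on Y (\<lambda>z. psi P z w)"
  by (rule has_grad_on_imp_continuous_on[OF has_grad_psi])

lemma z_rho_min: "w \<in> C \<Longrightarrow> z_rho P w \<in> Y" "w \<in> C \<Longrightarrow> u \<in> Y \<Longrightarrow> psi P (z_rho P w) w \<le> psi P u w"
proof -
  have *: "is_arg_min (\<lambda>z. psi P z w) (\<lambda>z. z \<in> Y) (z_rho P w)" if w: "w \<in> C"
    unfolding z_rho_def arg_min_on_def arg_min_def
    using continuous_attains_inf[OF Y(2,1) psi_continuous[OF w]]
    by (intro someI_ex[of "is_arg_min (\<lambda>z. psi P z w) (\<lambda>z. z \<in> Y)"])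
      (auto simp: is_arg_min_def not_less)
  show "w \<in> C \<Longrightarrow> z_rho P w \<in> Y" "w \<in> C \<Longrightarrow> u \<in> Y \<Longrightarrow> psi P (z_rho P w) w \<le> psi P u w"
    using * unfolding is_arg_min_def by (auto simp: not_less)
qed

lemma g_rho_eq: "w \<in> C \<Longrightarrow> g_rho P w = psi P (z_rho P w) w"
  unfolding g_rho_def by (rule cInf_eq_minimum) (auto intro: z_rho_min)

text \<open>The projected-gradient inequality at the minimizer itself forces \<open>r = 0\<close> there, and then
  reads as quadratic growth; no separate optimality condition is needed.\<close>

lemma psi_growth:
  assumes "w \<in> C" "u \<in> Y"
  shows "m / 2 * (norm (u - z_rho P w))\<^sup>2 \<le> psi P u w - g_rho P w"
proof -
  let ?z = "z_rho P w"
  let ?r = "L *\<^sub>R (?z - pg_step w ?z)"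
  have z: "?z \<in> Y" using z_rho_min assms by auto
  have "psi P ?z w \<le> psi P (pg_step w ?z) w" using assms(1) pg_step_in by (rule z_rho_min)
  then have "(norm ?r)\<^sup>2 / (2 * L) \<le> 0" using pg_step_ineq[OF assms(1) z z] by simp
  then have "?r = 0" using L_pos by (simp add: divide_le_0_iff)
  then have "pg_step w ?z = ?z" using L_pos by simp
  then show ?thesis using pg_step_ineq[OF assms(1) z assms(2)] g_rho_eq[OF assms(1)] by simp
qed

lemma accurate_dist:
  assumes "w \<in> C" "accurate P w e z"
  shows "norm (z - z_rho P w) \<le> sqrt (2 * e / m)"
proof -
  have "m / 2 * (norm (z - z_rho P w))\<^sup>2 \<le> e"
    using psi_growth[OF assms(1)] assms(2) unfolding accurate_def by fastforce
  then have "(norm (z - z_rho P w))\<^sup>2 \<le> 2 * e / m" using m_pos by (simp add: field_simps)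
  then show ?thesis using real_le_rsqrt by blast
qed

subsection \<open>Linear convergence of the projected-gradient routine\<close>

lemma ME_iter_Suc: "ME_iter P w zi (Suc j) = pg_step w (ME_iter P w zi j)"
  by (simp add: pg_step_def dpsi_def)

declare ME_iter.simps(2) [simp del]

lemma ME_iter_in: "zi \<in> Y \<Longrightarrow> ME_iter P w zi j \<in> Y"
  by (cases j) (auto simp: ME_iter_Suc pg_step_in)

text \<open>Expanding the square produces the cross term \<open>r \<bullet> (?z - z)\<close>. The
  step inequality with \<open>u\<close> the minimizer controls it, since the value at the new point
  is no smaller than the minimum.\<close>

lemma pg_step_contract:
  assumes "w \<in> C" "z \<in> Y"
  shows "(norm (pg_step w z - z_rho P w))\<^sup>2 \<le> (1 - m / L) * (norm (z - z_rho P w))\<^sup>2"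
proof -
  let ?z = "z_rho P w" let ?p = "pg_step w z"
  define r where "r = L *\<^sub>R (z - ?p)"
  have p: "?p = z - (1 / L) *\<^sub>R r" using L_pos by (simp add: r_def)
  have "psi P ?z w \<le> psi P ?p w" using assms(1) pg_step_in by (rule z_rho_min)
  then have "r \<bullet> (?z - z) + (norm r)\<^sup>2 / (2 * L) + m / 2 * (norm (?z - z))\<^sup>2 \<le> 0"
    using pg_step_ineq[OF assms(1,2) z_rho_min(1)[OF assms(1)]] unfolding r_def by linarith
  then have "2 / L * (r \<bullet> (?z - z) + (norm r)\<^sup>2 / (2 * L) + m / 2 * (norm (?z - z))\<^sup>2) \<le> 0"
    using L_pos by (simp add: divide_le_0_iff mult_le_0_iff)
  then have *: "2 / L * (r \<bullet> (?z - z)) + (norm r)\<^sup>2 / L\<^sup>2 + m / L * (norm (?z - z))\<^sup>2 \<le> 0"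
    using L_pos by (simp add: distrib_left power2_eq_square mult.commute)
  have "(norm (?p - ?z))\<^sup>2 = (norm (z - ?z))\<^sup>2 + 2 / L * (r \<bullet> (?z - z)) + (norm r)\<^sup>2 / L\<^sup>2"
    unfolding p power2_norm_eq_inner
    by (simp add: inner_diff_left inner_diff_right inner_commute algebra_simps power2_eq_square)
  then show ?thesis using * by (simp add: algebra_simps norm_minus_commute)
qed

text \<open>The diameter of \<open>Y\<close> replaces the initial distance, so the bound does not
  see the starting point; warm starts need no separate analysis.\<close>

lemma ME_iter_dist:
  assumes "w \<in> C" "zi \<in> Y"
  shows "(norm (ME_iter P w zi j - z_rho P w))\<^sup>2 \<le> (1 - m / L) ^ j * (diameter Y)\<^sup>2"
proof (induction j)
  case 0
  have "norm (zi - z_rho P w) \<le> diameter Y"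
    using diameter_bounded_bound[of Y zi "z_rho P w"] assms z_rho_min(1) Y compact_imp_bounded
    by (auto simp: dist_norm)
  then show ?case by (simp add: power_mono)
next
  case (Suc j)
  have "0 \<le> 1 - m / L" using m_less_L L_pos by simp
  then show ?case
    using order_trans[OF pg_step_contract[OF assms(1) ME_iter_in[OF assms(2)]] mult_left_mono[OF Suc]]
    by (simp add: ME_iter_Suc mult.assoc)
qed

text \<open>The residual is \<open>L\<close> times a difference of two iterates, both within the
  current distance to the minimizer, so its square is at most \<open>4 * L\<^sup>2\<close> times
  that squared distance. The rate \<open>1 - m / L\<close> is at most
  \<open>exp (- 1 / kappa P)\<close>.\<close>

lemma ME_stop_if:
  assumes "w \<in> C" "zi \<in> Y" "2 * L\<^sup>2 * (diameter Y)\<^sup>2 / (m * e) \<le> exp (real j / kappa P)" "e > 0"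
  shows "ME_stop P w zi e j"
proof -
  let ?D = "(norm (ME_iter P w zi j - z_rho P w))\<^sup>2"
  have k: "kappa P > 0" "m / L = 1 / kappa P" using m_pos L_pos by (auto simp: kappa_def)
  have "(norm (ME_iter P w zi (Suc j) - z_rho P w))\<^sup>2 \<le> ?D"
    unfolding ME_iter_Suc
    using order_trans[OF pg_step_contract[OF assms(1) ME_iter_in[OF assms(2)]] mult_right_mono[of "1 - m / L" 1]]
      m_pos L_pos by (auto simp: mult_le_cancel_right1)
  then have "norm (ME_iter P w zi (Suc j) - z_rho P w) \<le> norm (ME_iter P w zi j - z_rho P w)"
    by (rule power2_le_imp_le) simp
  then have "norm (ME_iter P w zi j - ME_iter P w zi (Suc j)) \<le> 2 * norm (ME_iter P w zi j - z_rho P w)"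
    using norm_triangle_ineq4[of "ME_iter P w zi j - z_rho P w" "ME_iter P w zi (Suc j) - z_rho P w"] by simp
  then have "(norm (ME_res P w zi j))\<^sup>2 \<le> (L * (2 * norm (ME_iter P w zi j - z_rho P w)))\<^sup>2"
    unfolding ME_res_def using L_pos by (intro power_mono) auto
  also have "\<dots> = 4 * L\<^sup>2 * ?D" by (simp add: power_mult_distrib)
  also have "\<dots> \<le> 4 * L\<^sup>2 * (exp (- real j / kappa P) * (diameter Y)\<^sup>2)"
  proof (intro mult_left_mono order_trans[OF ME_iter_dist[OF assms(1,2)]] mult_right_mono)
    have "(1 - m / L) ^ j \<le> exp (- (m / L)) ^ j"
      using exp_ge_add_one_self[of "- (m / L)"] m_less_L L_pos by (intro power_mono) auto
    then show "(1 - m / L) ^ j \<le> exp (- real j / kappa P)"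
      by (simp add: exp_of_nat_mult[symmetric] k(2))
  qed auto
  also have "\<dots> \<le> 2 * m * e"
  proof -
    have "2 * L\<^sup>2 * (diameter Y)\<^sup>2 \<le> exp (real j / kappa P) * (m * e)"
      using assms(3,4) m_pos by (simp add: pos_divide_le_eq)
    then have "exp (- real j / kappa P) * (2 * L\<^sup>2 * (diameter Y)\<^sup>2)
        \<le> exp (- real j / kappa P) * (exp (real j / kappa P) * (m * e))"
      by (intro mult_left_mono) auto
    also have "\<dots> = m * e" by (simp add: mult.assoc[symmetric] exp_add[symmetric])
    finally show ?thesis by (simp add: mult_ac)
  qed
  finally show ?thesis unfolding ME_stop_def .
qed

lemma ME_steps_bound:
  assumes "w \<in> C" "zi \<in> Y" "e > 0" "2 * L\<^sup>2 * (diameter Y)\<^sup>2 / (m * e) \<le> M" "1 \<le> M"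
  shows "\<exists>j. ME_stop P w zi e j" "real (ME_steps P w zi e) \<le> kappa P * ln M + 2"
proof -
  have k: "kappa P > 0" using m_pos L_pos by (auto simp: kappa_def)
  \<comment> \<open>The \<open>+ 2\<close> of the claim is one for this rounding and one for the
    \<open>Suc\<close> in \<open>ME_steps\<close>. The hypothesis \<open>1 \<le> M\<close> makes the
    rounded number nonnegative.\<close>
  define j where "j = nat \<lceil>kappa P * ln M\<rceil>"
  have nn: "0 \<le> kappa P * ln M" using k assms(5) by simp
  then have "kappa P * ln M \<le> real j" unfolding j_def by linarith
  then have "ln M \<le> real j / kappa P" using k by (simp add: field_simps)
  then have "M \<le> exp (real j / kappa P)" using assms(5) by (simp add: ln_le_cancel_iff[symmetric] ln_ge_iff)
  then have stop: "ME_stop P w zi e j" using ME_stop_if[OF assms(1,2) _ assms(3)] assms(4) by auto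
  then show "\<exists>j. ME_stop P w zi e j" by auto
  have "(LEAST j. ME_stop P w zi e j) \<le> j" using stop by (rule Least_le)
  moreover have "real j \<le> kappa P * ln M + 1" using nn unfolding j_def by linarith
  ultimately show "real (ME_steps P w zi e) \<le> kappa P * ln M + 2" unfolding ME_steps_def by linarith
qed

lemma ME_ok:
  assumes "w \<in> C" "zi \<in> Y" "e > 0"
  shows "ME_ok P w zi e"
proof -
  have ex: "\<exists>j. ME_stop P w zi e j"
    by (rule ME_steps_bound(1)[OF assms, of "max 1 (2 * L\<^sup>2 * (diameter Y)\<^sup>2 / (m * e))"]) auto
  define j where "j = (LEAST j. ME_stop P w zi e j)"
  have "ME_stop P w zi e j" unfolding j_def using ex by (rule LeastI_ex)
  then have st: "(norm (ME_res P w zi j))\<^sup>2 \<le> 2 * m * e" unfolding ME_stop_def .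
  let ?z = "ME_iter P w zi j" let ?z' = "pg_step w ?z" let ?r = "ME_res P w zi j"
  have "?z \<in> Y" using ME_iter_in assms by auto
  from pg_step_ineq[OF assms(1) this z_rho_min(1)[OF assms(1)]]
  have "psi P ?z' w + ?r \<bullet> (z_rho P w - ?z) + (norm ?r)\<^sup>2 / (2 * L)
      + m / 2 * (norm (z_rho P w - ?z))\<^sup>2 \<le> g_rho P w"
    using g_rho_eq assms by (simp add: ME_res_def ME_iter_Suc)
  \<comment> \<open>Completing the square: whatever the unknown minimizer is, the linear and
    quadratic terms cannot fall below \<open>- (norm ?r)\<^sup>2 / (2 * m)\<close>, and the stopping
    test bounds exactly this quantity.\<close>
  moreover have "0 \<le> (norm ?r)\<^sup>2 / (2 * m) + ?r \<bullet> (z_rho P w - ?z) + m / 2 * (norm (z_rho P w - ?z))\<^sup>2"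
  proof -
    have "0 \<le> (norm (?r + m *\<^sub>R (z_rho P w - ?z)))\<^sup>2 / (2 * m)" using m_pos by simp
    also have "\<dots> = (norm ?r)\<^sup>2 / (2 * m) + ?r \<bullet> (z_rho P w - ?z) + m / 2 * (norm (z_rho P w - ?z))\<^sup>2"
      using m_pos by (simp only: power2_norm_eq_inner inner_add_left inner_add_right inner_scaleR_left
          inner_scaleR_right) (simp add: field_simps inner_commute)
    finally show ?thesis .
  qed
  moreover have "0 \<le> (norm ?r)\<^sup>2 / (2 * L)" using L_pos by simp
  moreover have "(norm ?r)\<^sup>2 / (2 * m) \<le> e" using st m_pos by (simp add: field_simps)
  moreover have "g_rho P w \<le> psi P ?z' w"
    using g_rho_eq assms(1) pg_step_in z_rho_min(2) by auto
  ultimately have "accurate P w e ?z'"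
    unfolding accurate_def using pg_step_in by auto
  moreover have "ME P w zi e = ?z'" unfolding ME_def ME_steps_def j_def by (simp add: ME_iter_Suc)
  ultimately show ?thesis unfolding ME_ok_def using ex by simp
qed

end

section \<open>The residual and its gradient\<close>

lemma norm_fst_diff_le: "norm (fst u - fst v) \<le> norm (u - v)"
  and norm_snd_diff_le: "norm (snd u - snd v) \<le> norm (u - v)"
  for u v :: "'a::real_normed_vector \<times> 'b::real_normed_vector"
  by (metis fst_diff norm_fst_le prod.collapse, metis snd_diff norm_snd_le prod.collapse)

context moreau
begin

lemma grad_resid_at_eq: "grad_resid_at P w z = grad_g P w - dpsi_w z w"
  unfolding grad_resid_at_def dpsi_w_def by (simp add: prod_eq_iff)

lemma dpsi_w_lipschitz:
  assumes "w \<in> C" "z \<in> Y" "z' \<in> Y"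
  shows "norm (dpsi_w z w - dpsi_w z' w) \<le> sqrt ((Lxy P)\<^sup>2 + (1 / rho P)\<^sup>2) * norm (z - z')"
proof -
  let ?a = "fst (grad_g P (fst w, z)) - fst (grad_g P (fst w, z'))"
  have a: "norm ?a \<le> Lxy P * norm (z - z')"
    using lipschitz_onD[OF lip_xy assms(2,3), of "fst w"] assms(1) in_C by (auto simp: dist_norm)
  have b: "norm ((1 / rho P) *\<^sub>R (z' - z)) = 1 / rho P * norm (z - z')"
    using rho_pos by (simp add: norm_minus_commute)
  have "norm (dpsi_w z w - dpsi_w z' w) = norm (?a, (1 / rho P) *\<^sub>R (z' - z))"
    unfolding dpsi_w_def by (simp add: scaleR_diff_right)
  also have "\<dots> = sqrt ((norm ?a)\<^sup>2 + (1 / rho P * norm (z - z'))\<^sup>2)"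
    unfolding norm_Pair b ..
  also have "\<dots> \<le> sqrt ((Lxy P * norm (z - z'))\<^sup>2 + (1 / rho P * norm (z - z'))\<^sup>2)"
    using a by (intro real_sqrt_le_mono add_right_mono power_mono) auto
  also have "\<dots> = sqrt ((Lxy P)\<^sup>2 + (1 / rho P)\<^sup>2) * norm (z - z')"
    unfolding power_mult_distrib distrib_right[symmetric] by (simp add: real_sqrt_mult)
  finally show ?thesis .
qed

lemma grad_resid_at_error:
  assumes "w \<in> C" "accurate P w e z"
  shows "norm (grad_resid_at P w z - dR w) \<le> D_rho P e"
proof -
  have "norm (grad_resid_at P w z - dR w) = norm (dpsi_w z w - dpsi_w (z_rho P w) w)"
    unfolding grad_resid_def grad_resid_at_eq by (simp add: norm_minus_commute)
  also have "\<dots> \<le> sqrt ((Lxy P)\<^sup>2 + (1 / rho P)\<^sup>2) * norm (z - z_rho P w)"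
    using assms z_rho_min by (intro dpsi_w_lipschitz) (auto simp: accurate_def)
  also have "\<dots> \<le> D_rho P e"
    unfolding D_rho_def using accurate_dist[OF assms] by (intro mult_left_mono) auto
  finally show ?thesis .
qed

lemma D_rho_nonneg: "0 \<le> e \<Longrightarrow> 0 \<le> D_rho P e"
  unfolding D_rho_def using m_pos by simp

lemma resid_at_bounds:
  assumes "accurate P w e z"
  shows "resid_at P w z \<le> R w" "R w \<le> resid_at P w z + e"
  using assms unfolding accurate_def resid_at_def resid_def by auto

text \<open>The minimizer inherits Lipschitz continuity from the assumed Lipschitz continuity of
  \<open>grad_resid\<close>, whose second component determines it.\<close>

lemma z_rho_lipschitz:
  obtains K where "K \<ge> 0" "\<And>u v. u \<in> C \<Longrightarrow> v \<in> C \<Longrightarrow> norm (z_rho P u - z_rho P v) \<le> K * norm (u - v)"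
proof
  let ?K = "1 + rho P * (Lg P + LR P)"
  have Lg: "Lg P \<ge> 0" using lip_g lipschitz_on_nonneg by auto
  show "0 \<le> ?K" using Lg LR_pos rho_pos by simp
  fix u v assume uv: "u \<in> C" "v \<in> C"
  have z: "z_rho P w = snd w - rho P *\<^sub>R (snd (grad_g P w) - snd (dR w))" for w
    unfolding grad_resid_def grad_resid_at_def using rho_pos by simp
  have "norm (grad_g P u - grad_g P v) \<le> Lg P * norm (u - v)"
    "norm (dR u - dR v) \<le> LR P * norm (u - v)"
    using lipschitz_onD[OF lip_g uv] lipschitz_onD[OF lip_R uv] by (auto simp: dist_norm)
  then have 1: "norm (snd (grad_g P u) - snd (grad_g P v)) \<le> Lg P * norm (u - v)"
      "norm (snd (dR u) - snd (dR v)) \<le> LR P * norm (u - v)" "norm (snd u - snd v) \<le> norm (u - v)"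
    by (auto intro: order_trans[OF norm_snd_diff_le] norm_snd_diff_le)
  have "z_rho P u - z_rho P v = (snd u - snd v) - rho P *\<^sub>R ((snd (grad_g P u) - snd (grad_g P v))
      - (snd (dR u) - snd (dR v)))"
    unfolding z by (simp add: algebra_simps)
  then have "norm (z_rho P u - z_rho P v) \<le> norm (snd u - snd v)
      + norm (rho P *\<^sub>R ((snd (grad_g P u) - snd (grad_g P v)) - (snd (dR u) - snd (dR v))))"
    by (simp only: norm_triangle_ineq4)
  also have "\<dots> \<le> norm (snd u - snd v) + rho P * (norm (snd (grad_g P u) - snd (grad_g P v))
      + norm (snd (dR u) - snd (dR v)))"
    using rho_pos norm_triangle_ineq4 by (simp add: mult_left_mono)
  also have "\<dots> \<le> norm (u - v) + rho P * (Lg P * norm (u - v) + LR P * norm (u - v))"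
    using 1 rho_pos by (intro add_mono mult_left_mono) auto
  finally show "norm (z_rho P u - z_rho P v) \<le> ?K * norm (u - v)" by (simp add: algebra_simps)
qed

lemma psi_w_remainder:
  assumes "u \<in> C" "v \<in> C" "z \<in> Y"
  shows "\<bar>psi P z v - psi P z u - dpsi_w z u \<bullet> (v - u)\<bar> \<le> (Lg P / 2 + 1 / (2 * rho P)) * (norm (v - u))\<^sup>2"
proof -
  let ?u = "(fst u, z)" let ?v = "(fst v, z)"
  have Lg: "Lg P \<ge> 0" using lip_g lipschitz_on_nonneg by auto
  have "\<bar>gg P ?v - gg P ?u - grad_g P ?u \<bullet> (?v - ?u)\<bar> \<le> Lg P / 2 * (norm (?v - ?u))\<^sup>2"
    using assms C in_C by (intro grad_lipschitz_abs[OF has_grad_g _ lip_g]) auto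
  also have "\<dots> \<le> Lg P / 2 * (norm (v - u))\<^sup>2"
    using Lg norm_fst_diff_le[of v u] by (intro mult_left_mono power_mono) (auto simp: norm_Pair)
  finally have "\<bar>gg P ?v - gg P ?u - fst (grad_g P ?u) \<bullet> (fst v - fst u)\<bar> \<le> Lg P / 2 * (norm (v - u))\<^sup>2"
    by (simp add: inner_prod_def)
  moreover have "1 / (2 * rho P) * (norm (z - snd v))\<^sup>2 - 1 / (2 * rho P) * (norm (z - snd u))\<^sup>2
      - (1 / rho P) * ((snd u - z) \<bullet> (snd v - snd u)) = 1 / (2 * rho P) * (norm (snd v - snd u))\<^sup>2"
    using rho_pos by (simp add: power2_norm_eq_inner inner_commute field_simps inner_diff_left inner_diff_right)
  moreover have "\<bar>1 / (2 * rho P) * (norm (snd v - snd u))\<^sup>2\<bar> \<le> 1 / (2 * rho P) * (norm (v - u))\<^sup>2"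
    unfolding abs_mult using rho_pos norm_snd_diff_le[of v u] by (intro mult_mono power_mono) auto
  ultimately show ?thesis
    unfolding psi_def dpsi_w_def by (simp only: inner_prod_def fst_conv snd_conv fst_diff snd_diff
      inner_scaleR_left distrib_right)
qed

text \<open>Envelope argument in quantitative form. The change of \<open>g_rho\<close> lies between
  the changes of \<open>psi\<close> at the two frozen minimizers; their first-order terms differ by
  a multiple of \<open>norm (?z' - ?z) * norm (v - u)\<close>, which is quadratic because the
  minimizer is Lipschitz.\<close>

lemma resid_remainder:
  obtains M where "\<And>u v. u \<in> C \<Longrightarrow> v \<in> C \<Longrightarrow> \<bar>R v - R u - dR u \<bullet> (v - u)\<bar> \<le> M * (norm (v - u))\<^sup>2"
proof -
  obtain K where K: "K \<ge> 0" "\<And>u v. u \<in> C \<Longrightarrow> v \<in> C \<Longrightarrow> norm (z_rho P u - z_rho P v) \<le> K * norm (u - v)"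
    using z_rho_lipschitz by blast
  define La where "La = sqrt ((Lxy P)\<^sup>2 + (1 / rho P)\<^sup>2)"
  define N where "N = Lg P / 2 + 1 / (2 * rho P)"
  have La: "La \<ge> 0" unfolding La_def by simp
  have "\<bar>R v - R u - dR u \<bullet> (v - u)\<bar> \<le> (Lg P / 2 + N + La * K) * (norm (v - u))\<^sup>2"
    if uv: "u \<in> C" "v \<in> C" for u v
  proof -
    let ?z = "z_rho P u" let ?z' = "z_rho P v"
    let ?p = "dpsi_w ?z u \<bullet> (v - u)" let ?n = "(norm (v - u))\<^sup>2"
    note z = z_rho_min(1)[OF uv(1)] z_rho_min(1)[OF uv(2)]
    have "\<bar>(dpsi_w ?z' u - dpsi_w ?z u) \<bullet> (v - u)\<bar> \<le> norm (dpsi_w ?z' u - dpsi_w ?z u) * norm (v - u)"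
      by (rule Cauchy_Schwarz_ineq2)
    also have "\<dots> \<le> (La * norm (?z' - ?z)) * norm (v - u)"
      unfolding La_def using dpsi_w_lipschitz[OF uv(1) z(2,1)] by (rule mult_right_mono) simp
    also have "\<dots> \<le> (La * (K * norm (v - u))) * norm (v - u)"
      using K(2)[OF uv(2,1)] La by (intro mult_right_mono mult_left_mono) auto
    finally have 1: "\<bar>dpsi_w ?z' u \<bullet> (v - u) - ?p\<bar> \<le> La * K * ?n"
      by (simp add: inner_diff_left power2_eq_square mult_ac)
    have 2: "\<bar>psi P ?z v - psi P ?z u - ?p\<bar> \<le> N * ?n"
      "\<bar>psi P ?z' v - psi P ?z' u - dpsi_w ?z' u \<bullet> (v - u)\<bar> \<le> N * ?n"
      unfolding N_def using psi_w_remainder uv z by blast+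
    \<comment> \<open>Minimality at \<open>v\<close> gives the upper half of the sandwich,
      minimality at \<open>u\<close> the lower half.\<close>
    have 3: "g_rho P u = psi P ?z u" "g_rho P v = psi P ?z' v" "psi P ?z u \<le> psi P ?z' u"
        "psi P ?z' v \<le> psi P ?z v"
      using g_rho_eq z_rho_min uv by auto
    have 4: "\<bar>gg P v - gg P u - grad_g P u \<bullet> (v - u)\<bar> \<le> Lg P / 2 * ?n"
      using uv C by (intro grad_lipschitz_abs[OF has_grad_g _ lip_g]) auto
    have 5: "0 \<le> La * K * ?n" using La K by simp
    have "dR u \<bullet> (v - u) = grad_g P u \<bullet> (v - u) - ?p"
      unfolding grad_resid_def grad_resid_at_eq by (simp add: inner_diff_left)
    moreover have "(Lg P / 2 + N + La * K) * ?n = Lg P / 2 * ?n + N * ?n + La * K * ?n"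
      by (simp add: distrib_right)
    ultimately show ?thesis using 1 2 3 4 5 unfolding resid_def by linarith
  qed
  then show ?thesis using that by blast
qed

lemma has_grad_R: "has_grad_on C R dR"
  using resid_remainder has_grad_on_remainder by metis

lemma R_lipschitz: "u \<in> C \<Longrightarrow> v \<in> C \<Longrightarrow> \<bar>R u - R v\<bar> \<le> BR P * norm (u - v)"
  using grad_bounded_lipschitz[OF has_grad_R C(3)] dR_bound by blast

lemma dR_lipschitz: "u \<in> C \<Longrightarrow> v \<in> C \<Longrightarrow> norm (dR u - dR v) \<le> LR P * norm (u - v)"
  using lipschitz_onD[OF lip_R] by (simp add: dist_norm)

lemma f_bounds:
  obtains fmin fmax where "\<And>w. w \<in> C \<Longrightarrow> fmin \<le> ff P w" "\<And>w. w \<in> C \<Longrightarrow> ff P w \<le> fmax"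
proof -
  have "continuous_on C (ff P)" using has_grad_f by (rule has_grad_on_imp_continuous_on)
  then show ?thesis
    using continuous_attains_inf[OF C(2,1)] continuous_attains_sup[OF C(2,1)] that by metis
qed

lemma grad_f_bound:
  obtains F where "F > 0" "\<And>w. w \<in> C \<Longrightarrow> norm (grad_f P w) \<le> F"
proof -
  have "compact (grad_f P ` C)"
    using lipschitz_on_continuous_on[OF lip_f] C(2) by (rule compact_continuous_image)
  then show ?thesis using compact_imp_bounded bounded_pos that by (metis image_eqI)
qed

text \<open>Compactness of \<open>C\<close> together with the closed graph of the normal cone:
  violations with \<open>\<nu>\<close> tending to 0 would accumulate at a point of \<open>C\<close>
  with nonnegative residual where the qualification fails.\<close>

lemma ENNAMCQ_uniform:
  assumes "ENNAMCQ P"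
  obtains \<nu> where "\<nu> > 0"
    "\<And>w v. w \<in> C \<Longrightarrow> R w \<ge> 0 \<Longrightarrow> v \<in> normal_cone C w \<Longrightarrow> \<nu> \<le> norm (dR w + v)"
proof (rule ccontr)
  assume "\<not> thesis"
  then have "\<exists>w v. w \<in> C \<and> R w \<ge> 0 \<and> v \<in> normal_cone C w \<and> norm (dR w + v) < inverse (real (Suc n))" for n
    using that[of "inverse (real (Suc n))"] not_less by (metis of_nat_0_less_iff positive_imp_inverse_positive zero_less_Suc)
  then obtain w v where wv: "\<And>n. w n \<in> C" "\<And>n. R (w n) \<ge> 0" "\<And>n. v n \<in> normal_cone C (w n)"
      "\<And>n. norm (dR (w n) + v n) < inverse (real (Suc n))"
    by metis
  obtain l s where l: "l \<in> C" "strict_mono s" "(w \<circ> s) \<longlonglongrightarrow> l"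
    using C(2) wv(1) unfolding compact_def by metis
  have "(\<lambda>n. R (w (s n))) \<longlonglongrightarrow> R l"
    using continuous_on_tendsto_compose[OF has_grad_on_imp_continuous_on[OF has_grad_R] l(3)[unfolded comp_def] l(1)] wv(1) by auto
  then have Rl: "R l \<ge> 0" by (rule LIMSEQ_le_const) (use wv(2) in auto)
  have d: "(\<lambda>n. dR (w (s n))) \<longlonglongrightarrow> dR l"
    using continuous_on_tendsto_compose[OF lipschitz_on_continuous_on[OF lip_R] l(3)[unfolded comp_def] l(1)] wv(1) by auto
  have "(\<lambda>n. inverse (real (Suc (s n)))) \<longlonglongrightarrow> 0"
    using LIMSEQ_subseq_LIMSEQ[OF LIMSEQ_inverse_real_of_nat l(2)] by (simp add: comp_def)
  then have "(\<lambda>n. dR (w (s n)) + v (s n)) \<longlonglongrightarrow> 0"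
    by (rule Lim_null_comparison[rotated]) (use wv(4) less_imp_le in \<open>auto intro!: always_eventually\<close>)
  \<comment> \<open>Normal cones are unbounded, but the normals converge here because both the sum
    and \<open>dR\<close> do.\<close>
  from tendsto_diff[OF this d] have v: "(\<lambda>n. v (s n)) \<longlonglongrightarrow> - dR l" by simp
  have "- dR l \<bullet> (u - l) \<le> 0" if "u \<in> C" for u
  proof (rule LIMSEQ_le_const2)
    show "(\<lambda>n. v (s n) \<bullet> (u - w (s n))) \<longlonglongrightarrow> - dR l \<bullet> (u - l)"
      by (intro tendsto_inner v tendsto_diff tendsto_const l(3)[unfolded comp_def])
    show "\<exists>N. \<forall>n\<ge>N. v (s n) \<bullet> (u - w (s n)) \<le> 0"
      using wv(3) that unfolding normal_cone_def by blast
  qed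
  then have "- dR l \<in> normal_cone C l" unfolding normal_cone_def by auto
  then have "0 \<in> {dR l + v | v. v \<in> normal_cone C l}" by (intro CollectI exI[of _ "- dR l"]) simp
  then show False using assms l(1) Rl unfolding ENNAMCQ_def by auto
qed

end

section \<open>Descent and stationarity of one iteration\<close>

locale ivsp_setup = moreau P
  for P :: "('a::euclidean_space, 'b::euclidean_space) problem" +
  fixes S :: smoothing and A :: "('a, 'b) params"
  assumes vs: "valid_smoothing S" and vA: "valid_params P S A"
begin

lemma mu_pos: "mu A k > 0" and mu_antimono: "i \<le> j \<Longrightarrow> mu A j \<le> mu A i"
  and zeta_pos: "zeta A k > 0" and zeta_antimono: "i \<le> j \<Longrightarrow> zeta A j \<le> zeta A i"
  and mu_lim: "mu A \<longlonglongrightarrow> 0" and ghat_lim: "ghat A \<longlonglongrightarrow> 0"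
  and ghat_pos: "ghat A t > 0" and w0_in: "w0 A \<in> C"
  and c1_pos: "c1 A > 0" and c2_pos: "c2 A > 0" and th_low_pos: "th_low A > 0"
  and th_hat_bounds: "0 < th_hat A" "th_hat A < 2"
  using vA unfolding valid_params_def by (auto dest: decseqD)

lemma ghat_antimono: "i \<le> j \<Longrightarrow> ghat A j \<le> ghat A i"
proof -
  have "decseq (ghat A)" using vA unfolding valid_params_def decseq_Suc_iff by (auto intro: less_imp_le)
  then show "i \<le> j \<Longrightarrow> ghat A j \<le> ghat A i" by (rule decseqD)
qed

lemma smoothing_consts: "a1 S \<ge> 0" "a2 S \<ge> 0" "b_phi S \<ge> 0" "c_phi S \<ge> 0" "a_phi S > 0"
  using vs unfolding valid_smoothing_def by auto

lemma Lf_nonneg: "Lf P \<ge> 0"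
  using lip_f lipschitz_on_nonneg by auto

context
  fixes \<mu> :: real
  assumes \<mu>: "\<mu> > 0"
begin

lemma phi_deriv: "(phi S \<mu> has_real_derivative dphi S \<mu> t) (at t)"
  and dphi_bounds: "0 \<le> dphi S \<mu> t" "dphi S \<mu> t \<le> 1"
  and dphi_lipschitz: "\<bar>dphi S \<mu> t - dphi S \<mu> s\<bar> \<le> b_phi S / \<mu> * \<bar>t - s\<bar>"
  and phi_bounds: "max t 0 - a1 S * \<mu> \<le> phi S \<mu> t" "phi S \<mu> t \<le> max t 0 + a2 S * \<mu>"
  and phi_mono: "t \<le> s \<Longrightarrow> phi S \<mu> t \<le> phi S \<mu> s"
  and phi_convex: "convex_on UNIV (phi S \<mu>)"
  using vs \<mu> unfolding valid_smoothing_def by (auto dest: monoD)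

lemma has_grad_phi: "has_grad_on UNIV (phi S \<mu>) (dphi S \<mu>)"
proof -
  have "(\<lambda>d. d \<bullet> dphi S \<mu> t) = (*) (dphi S \<mu> t)" for t by (simp add: fun_eq_iff mult.commute)
  then show ?thesis using phi_deriv unfolding has_grad_on_def has_field_derivative_def by simp
qed

lemma phi_tangent: "phi S \<mu> t + dphi S \<mu> t * (s - t) \<le> phi S \<mu> s"
  using convex_on_gradient_ineq[OF phi_convex has_grad_phi, of t s] by simp

lemma phi_nonexpansive: "t \<le> s \<Longrightarrow> phi S \<mu> s \<le> phi S \<mu> t + (s - t)"
  using phi_tangent[of s t] mult_right_mono[OF dphi_bounds(2)[of s], of "s - t"]
  by (simp add: algebra_simps)

text \<open>Product rule for \<open>dphi (R u) *\<^sub>R dR u\<close>: varying the first factor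
  costs \<open>b_phi S / \<mu>\<close> times \<open>BR P\<close> twice, varying the second costs
  \<open>LR P\<close>. Multiplied by \<mu>, the modulus is bounded by the Lipschitz part of the
  numerator of \<open>L_safe\<close>.\<close>

lemma merit_smooth:
  assumes "\<gamma> \<ge> 0" "u \<in> C" "v \<in> C"
  shows "\<gamma> * ff P v + phi S \<mu> (R v) \<le> \<gamma> * ff P u + phi S \<mu> (R u)
    + (\<gamma> *\<^sub>R grad_f P u + dphi S \<mu> (R u) *\<^sub>R dR u) \<bullet> (v - u)
    + (\<gamma> * Lf P + (b_phi S * (BR P)\<^sup>2 / \<mu> + LR P)) / 2 * (norm (v - u))\<^sup>2"
proof (rule grad_lipschitz_upper[OF _ C(3) _ assms(2,3)])
  show "has_grad_on C (\<lambda>v. \<gamma> * ff P v + phi S \<mu> (R v)) (\<lambda>u. \<gamma> *\<^sub>R grad_f P u + dphi S \<mu> (R u) *\<^sub>R dR u)"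
    by (intro has_grad_on_add has_grad_on_cmult has_grad_f has_grad_on_compose has_grad_R phi_deriv)
  show "(\<gamma> * Lf P + (b_phi S * (BR P)\<^sup>2 / \<mu> + LR P))-lipschitz_on C
      (\<lambda>u. \<gamma> *\<^sub>R grad_f P u + dphi S \<mu> (R u) *\<^sub>R dR u)"
  proof (rule lipschitz_on_add)
    show "(\<gamma> * Lf P)-lipschitz_on C (\<lambda>u. \<gamma> *\<^sub>R grad_f P u)"
      using lipschitz_on_cmult[OF lip_f, of \<gamma>] assms(1) by simp
    show "(b_phi S * (BR P)\<^sup>2 / \<mu> + LR P)-lipschitz_on C (\<lambda>u. dphi S \<mu> (R u) *\<^sub>R dR u)"
    proof (rule lipschitz_onI)
      show "0 \<le> b_phi S * (BR P)\<^sup>2 / \<mu> + LR P" using smoothing_consts \<mu> LR_pos by simp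
      fix u v assume uv: "u \<in> C" "v \<in> C"
      have "dphi S \<mu> (R u) *\<^sub>R dR u - dphi S \<mu> (R v) *\<^sub>R dR v
          = (dphi S \<mu> (R u) - dphi S \<mu> (R v)) *\<^sub>R dR u + dphi S \<mu> (R v) *\<^sub>R (dR u - dR v)"
        by (simp add: algebra_simps)
      then have "norm (dphi S \<mu> (R u) *\<^sub>R dR u - dphi S \<mu> (R v) *\<^sub>R dR v)
          \<le> \<bar>dphi S \<mu> (R u) - dphi S \<mu> (R v)\<bar> * norm (dR u) + dphi S \<mu> (R v) * norm (dR u - dR v)"
        using dphi_bounds norm_triangle_ineq by (metis abs_of_nonneg norm_scaleR)
      also have "\<dots> \<le> (b_phi S / \<mu> * (BR P * norm (u - v))) * BR P + 1 * (LR P * norm (u - v))"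
      proof (intro add_mono mult_mono)
        have "b_phi S / \<mu> * \<bar>R u - R v\<bar> \<le> b_phi S / \<mu> * (BR P * norm (u - v))"
          using R_lipschitz[OF uv] smoothing_consts \<mu> by (intro mult_left_mono) auto
        then show "\<bar>dphi S \<mu> (R u) - dphi S \<mu> (R v)\<bar> \<le> b_phi S / \<mu> * (BR P * norm (u - v))"
          using dphi_lipschitz[of "R u" "R v"] by linarith
      qed (use uv dR_bound dR_lipschitz dphi_bounds smoothing_consts \<mu> BR_pos in auto)
      also have "\<dots> = (b_phi S * (BR P)\<^sup>2 / \<mu> + LR P) * dist u v"
        by (simp add: dist_norm power2_eq_square algebra_simps)
      finally show "dist (dphi S \<mu> (R u) *\<^sub>R dR u) (dphi S \<mu> (R v) *\<^sub>R dR v)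
          \<le> (b_phi S * (BR P)\<^sup>2 / \<mu> + LR P) * dist u v"
        by (simp only: dist_norm)
    qed
  qed
qed

text \<open>The two summands of \<open>E_rho\<close> are the two sources of error: the inexact
  gradient gives \<open>D_rho\<close>, and the inexact argument of \<open>dphi\<close> gives the
  term with \<open>1 / \<mu>\<close>.\<close>

lemma merit_gradient_error:
  assumes "w \<in> C" "accurate P w e z"
  shows "norm (dphi S \<mu> (R w) *\<^sub>R dR w - dphi S \<mu> (resid_at P w z) *\<^sub>R grad_resid_at P w z)
    \<le> E_rho P S \<mu> e"
proof -
  let ?p = "dphi S \<mu> (R w)" let ?q = "dphi S \<mu> (resid_at P w z)"
  have "\<bar>?p - ?q\<bar> \<le> b_phi S / \<mu> * \<bar>R w - resid_at P w z\<bar>" by (rule dphi_lipschitz)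
  also have "\<dots> \<le> b_phi S / \<mu> * e"
    using resid_at_bounds[OF assms(2)] smoothing_consts \<mu> by (intro mult_left_mono) auto
  finally have 1: "\<bar>?p - ?q\<bar> \<le> b_phi S / \<mu> * e" .
  have "?p *\<^sub>R dR w - ?q *\<^sub>R grad_resid_at P w z
      = (?p - ?q) *\<^sub>R dR w + ?q *\<^sub>R (dR w - grad_resid_at P w z)" by (simp add: algebra_simps)
  then have "norm (?p *\<^sub>R dR w - ?q *\<^sub>R grad_resid_at P w z)
      \<le> \<bar>?p - ?q\<bar> * norm (dR w) + ?q * norm (dR w - grad_resid_at P w z)"
    using dphi_bounds norm_triangle_ineq by (metis abs_of_nonneg norm_scaleR)
  also have "\<dots> \<le> (b_phi S / \<mu> * e) * BR P + 1 * D_rho P e"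
    using 1 dR_bound[OF assms(1)] grad_resid_at_error[OF assms] dphi_bounds
    by (intro add_mono mult_mono) (auto simp: norm_minus_commute)
  finally show ?thesis unfolding E_rho_def by (simp add: algebra_simps)
qed

end

abbreviation search_dir :: "nat \<Rightarrow> 'a \<times> 'b \<Rightarrow> 'b \<Rightarrow> nat \<Rightarrow> 'a \<times> 'b" where
  "search_dir k w z t \<equiv> ghat A t *\<^sub>R grad_f P w
     + dphi S (mu A k) (resid_at P w z) *\<^sub>R grad_resid_at P w z"

lemma trial_w_in: "trial_w P S A k w z t l \<in> C"
  unfolding trial_w_def using C closest_point_in_set by auto

lemma trial_w_proj:
  assumes "u \<in> C"
  shows "(w - (mu A k / l) *\<^sub>R search_dir k w z t - trial_w P S A k w z t l)
     \<bullet> (u - trial_w P S A k w z t l) \<le> 0"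
  unfolding trial_w_def using C assms by (intro closest_point_dot)

lemma trial_z_accurate:
  assumes "z \<in> Y"
  shows "accurate P (trial_w P S A k w z t l) (zeta A (Suc k)) (trial_z P S A k w z t l)"
  unfolding trial_z_def using ME_ok[OF trial_w_in assms zeta_pos] unfolding ME_ok_def by auto

lemma L_safe_pos: "0 < L_safe P S A"
  unfolding L_safe_def using th_low_pos th_hat_bounds by (auto simp: less_max_iff_disj)

text \<open>The projection yields a decrease of \<open>l / mu A k\<close> times the squared step.
  Young's inequality with weight \<open>\<theta> \<le> th_hat A * l\<close> spends a part of it on
  the inexact gradient; what is left, \<open>(2 - th_hat A) * l\<close>, must cover
  \<open>c1 A\<close> and the smoothness modulus, and this is the second entry of
  \<open>L_safe\<close>.\<close>

lemma safe_accepts: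
  assumes w: "w \<in> C" and z: "accurate P w (zeta A k) z" and safe: "L_safe P S A \<le> l"
  shows "accepts P S A k w z t l"
proof -
  define w' where "w' = trial_w P S A k w z t l"
  define n where "n = norm (w' - w)"
  define \<theta> where "\<theta> = theta P S A k w z t l"
  define E where "E = E_rho P S (mu A k) (zeta A k)"
  let ?g = "ghat A t" and ?m = "mu A k" and ?d = "search_dir k w z t"
  let ?dG = "?g *\<^sub>R grad_f P w + dphi S ?m (R w) *\<^sub>R dR w"
  have l: "l > 0" using L_safe_pos safe by linarith
  have w': "w' \<in> C" unfolding w'_def by (rule trial_w_in)
  have zY: "z \<in> Y" using z unfolding accurate_def by auto
  have z': "accurate P w' (zeta A (Suc k)) (trial_z P S A k w z t l)"
    unfolding w'_def using zY by (rule trial_z_accurate)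
  have 1: "?g * ff P w' + phi S ?m (R w') \<le> ?g * ff P w + phi S ?m (R w) + ?dG \<bullet> (w' - w)
      + (?g * Lf P + (b_phi S * (BR P)\<^sup>2 / ?m + LR P)) / 2 * n\<^sup>2"
    unfolding n_def using merit_smooth[OF mu_pos _ w w', of ?g] ghat_pos[of t] by simp
  have "(w - (?m / l) *\<^sub>R ?d - w') \<bullet> (w - w') \<le> 0"
    unfolding w'_def using w by (rule trial_w_proj)
  moreover have "(w - c *\<^sub>R d - w') \<bullet> (w - w') = n\<^sup>2 + c * (d \<bullet> (w' - w))" for c d
    unfolding n_def power2_norm_eq_inner by (simp add: algebra_simps inner_commute)
  ultimately have "n\<^sup>2 + ?m / l * (?d \<bullet> (w' - w)) \<le> 0" by simp
  then have 2: "?d \<bullet> (w' - w) \<le> - (l / ?m) * n\<^sup>2"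
    using l mu_pos[of k] by (simp add: field_simps)
  have "(?dG - ?d) \<bullet> (w' - w) \<le> norm (?dG - ?d) * n"
    unfolding n_def by (rule norm_cauchy_schwarz)
  also have "\<dots> \<le> E * n"
    using merit_gradient_error[OF mu_pos w z] unfolding E_def n_def by (intro mult_right_mono) auto
  finally have 3: "?dG \<bullet> (w' - w) \<le> ?d \<bullet> (w' - w) + E * n" by (simp only: inner_diff_left)
  \<comment> \<open>The first entry of \<open>L_safe\<close> is used here: it keeps the floor
    \<open>th_low A\<close> below the cap \<open>th_hat A * l\<close>.\<close>
  have \<theta>: "\<theta> > 0" "\<theta> \<le> th_hat A * l"
  proof -
    show "\<theta> > 0" unfolding \<theta>_def theta_def Let_def using th_low_pos by (auto simp: less_max_iff_disj)
    have "th_low A / th_hat A \<le> l" using safe unfolding L_safe_def by simp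
    then have "th_low A \<le> th_hat A * l" using th_hat_bounds by (simp add: field_simps)
    then show "\<theta> \<le> th_hat A * l" unfolding \<theta>_def theta_def Let_def by simp
  qed
  have 4: "E * n \<le> \<theta> / (2 * ?m) * n\<^sup>2 + ?m / (2 * \<theta>) * E\<^sup>2"
  proof -
    have "0 \<le> (\<theta> * n - ?m * E)\<^sup>2 / (2 * ?m * \<theta>)" using \<theta> mu_pos[of k] by simp
    also have "\<dots> = \<theta> / (2 * ?m) * n\<^sup>2 + ?m / (2 * \<theta>) * E\<^sup>2 - E * n"
      using \<theta> mu_pos[of k] by (simp add: power2_eq_square field_simps)
    finally show ?thesis by simp
  qed
  have "(c1 A + ghat A 0 * mu A 0 * Lf P + L_G P S A) / (2 - th_hat A) \<le> l"
    using safe unfolding L_safe_def by simp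
  then have "c1 A + ghat A 0 * mu A 0 * Lf P + b_phi S * (BR P)\<^sup>2 + mu A 0 * LR P \<le> 2 * l - th_hat A * l"
    using th_hat_bounds unfolding L_G_def by (simp add: field_simps)
  moreover have "?g * ?m * Lf P \<le> ghat A 0 * mu A 0 * Lf P"
    using ghat_antimono[of 0 t] mu_antimono[of 0 k] ghat_pos[of 0] mu_pos[of k] Lf_nonneg
    by (intro mult_mono) auto
  moreover have "?m * LR P \<le> mu A 0 * LR P"
    using mu_antimono[of 0 k] LR_pos by (intro mult_right_mono) auto
  ultimately have "?m * (?g * Lf P) + b_phi S * (BR P)\<^sup>2 + ?m * LR P + c1 A + \<theta> \<le> 2 * l"
    using \<theta> by (simp add: mult_ac)
  then have "(?m * (?g * Lf P) + b_phi S * (BR P)\<^sup>2 + ?m * LR P + c1 A + \<theta>) / (2 * ?m) \<le> l / ?m"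
    using divide_right_mono[of _ "2 * l" "2 * ?m"] mu_pos[of k] by simp
  moreover have "(?m * (?g * Lf P) + b_phi S * (BR P)\<^sup>2 + ?m * LR P + c1 A + \<theta>) / (2 * ?m)
      = (?g * Lf P + (b_phi S * (BR P)\<^sup>2 / ?m + LR P)) / 2 + c1 A / (2 * ?m) + \<theta> / (2 * ?m)"
    using mu_pos[of k] by (simp add: field_simps)
  ultimately have "((?g * Lf P + (b_phi S * (BR P)\<^sup>2 / ?m + LR P)) / 2 + c1 A / (2 * ?m) + \<theta> / (2 * ?m)) * n\<^sup>2
      \<le> l / ?m * n\<^sup>2"
    by (intro mult_right_mono) auto
  then have 5: "- (l / ?m) * n\<^sup>2 + \<theta> / (2 * ?m) * n\<^sup>2
      + (?g * Lf P + (b_phi S * (BR P)\<^sup>2 / ?m + LR P)) / 2 * n\<^sup>2 \<le> - (c1 A / (2 * ?m) * n\<^sup>2)"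
    unfolding distrib_right by linarith
  \<comment> \<open>Passing between computed and exact residuals at \<open>w'\<close> and at
    \<open>w\<close> costs one tolerance each; these are the last two terms of
    \<open>tau\<close>.\<close>
  have 6: "phi S ?m (resid_at P w' (trial_z P S A k w z t l) + zeta A (Suc k)) \<le> phi S ?m (R w') + zeta A (Suc k)"
    using phi_mono[OF mu_pos, of _ "R w' + zeta A (Suc k)" k] resid_at_bounds(1)[OF z']
      phi_nonexpansive[OF mu_pos, of "R w'" "R w' + zeta A (Suc k)" k] zeta_pos[of "Suc k"]
    by (smt (verit))
  have 7: "phi S ?m (R w) \<le> phi S ?m (resid_at P w z) + zeta A k"
    using phi_nonexpansive[OF mu_pos resid_at_bounds(1)[OF z], of k] resid_at_bounds(2)[OF z] by linarith
  show ?thesis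
    unfolding accepts_def tau_def trial_resid_def w'_def[symmetric] n_def[symmetric] \<theta>_def[symmetric]
      E_def[symmetric]
    using 1 2 3 4 5 6 7 by linarith
qed

text \<open>The normal vector is the scaled defect of the projection. The weight \<open>dphi\<close>
  stays at the old computed residual: moving it to \<open>w'\<close> would bring in the Lipschitz
  constant \<open>b_phi S / mu A k\<close> of \<open>dphi\<close>.\<close>

lemma stationarity_residual:
  fixes t :: nat
  assumes w: "w \<in> C" and z: "accurate P w (zeta A k) z" and l: "0 < l"
  defines "w' \<equiv> trial_w P S A k w z t l"
  obtains v where "v \<in> normal_cone C w'"
    "norm (ghat A t *\<^sub>R grad_f P w' + dphi S (mu A k) (resid_at P w z) *\<^sub>R dR w' + v)
      \<le> l / mu A k * norm (w' - w) + (ghat A t * Lf P + LR P) * norm (w' - w) + D_rho P (zeta A k)"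
proof
  let ?g = "ghat A t" and ?m = "mu A k" and ?d = "search_dir k w z t" and ?q = "dphi S (mu A k) (resid_at P w z)"
  let ?v = "(l / ?m) *\<^sub>R (w - w') - ?d"
  have w': "w' \<in> C" unfolding w'_def by (rule trial_w_in)
  have v: "?v = (l / ?m) *\<^sub>R (w - (?m / l) *\<^sub>R ?d - w')"
    using l mu_pos[of k] by (simp add: scaleR_diff_right)
  show "?v \<in> normal_cone C w'"
    unfolding normal_cone_def v using trial_w_proj[of _ w k l t z] l mu_pos[of k]
    by (auto simp: w'_def[symmetric] mult_le_0_iff divide_le_0_iff simp del: scaleR_diff_right)
  have "?g *\<^sub>R grad_f P w' + ?q *\<^sub>R dR w' + ?v = ?g *\<^sub>R (grad_f P w' - grad_f P w)
      + ?q *\<^sub>R (dR w' - dR w) + ?q *\<^sub>R (dR w - grad_resid_at P w z) + (l / ?m) *\<^sub>R (w - w')"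
    by (simp add: algebra_simps)
  also have "norm \<dots> \<le> ?g * norm (grad_f P w' - grad_f P w) + ?q * norm (dR w' - dR w)
      + ?q * norm (dR w - grad_resid_at P w z) + l / ?m * norm (w - w')"
    using dphi_bounds(1)[OF mu_pos, of k "resid_at P w z"] ghat_pos[of t] l mu_pos[of k]
    by (intro order_trans[OF norm_triangle_ineq] add_mono) auto
  also have "\<dots> \<le> ?g * (Lf P * norm (w' - w)) + 1 * (LR P * norm (w' - w)) + 1 * D_rho P (zeta A k)
      + l / ?m * norm (w' - w)"
    using dphi_bounds[OF mu_pos, of k "resid_at P w z"] ghat_pos[of t] lipschitz_onD[OF lip_f w' w]
      dR_lipschitz[OF w' w] grad_resid_at_error[OF w z] l mu_pos[of k]
    by (intro add_mono mult_mono mult_left_mono) (auto simp: dist_norm norm_minus_commute)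
  finally show "norm (?g *\<^sub>R grad_f P w' + ?q *\<^sub>R dR w' + ?v)
      \<le> l / ?m * norm (w' - w) + (?g * Lf P + LR P) * norm (w' - w) + D_rho P (zeta A k)"
    by (simp add: algebra_simps)
qed

lemma normal_cone_scale: "v \<in> normal_cone T w \<Longrightarrow> 0 \<le> c \<Longrightarrow> c *\<^sub>R v \<in> normal_cone T w"
  unfolding normal_cone_def by (auto simp: mult_nonneg_nonpos)

end

text \<open>The iterates depend on the rates of \<open>\<mu>\<close> and \<open>\<zeta>\<close> only through these two consequences.\<close>

locale ivsp_rates = ivsp_setup P S A
  for P :: "('a::euclidean_space, 'b::euclidean_space) problem" and S A +
  fixes Z :: real
  assumes cq: "ENNAMCQ P" and zeta_summable: "summable (zeta A)"
    and zeta_le: "\<And>k. zeta A k \<le> Z * (mu A k)\<^sup>2"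
begin

lemma Z_pos: "Z > 0"
  using zeta_le[of 0] zeta_pos[of 0] mu_pos[of 0] by (smt (verit) zero_less_mult_iff zero_less_power)

lemma zeta_le_mu: "zeta A k \<le> Z * mu A 0 * mu A k"
proof -
  have "Z * (mu A k * mu A k) \<le> Z * (mu A 0 * mu A k)"
    using mu_antimono[of 0 k] mu_pos[of k] Z_pos by (intro mult_left_mono mult_right_mono) auto
  then show ?thesis using zeta_le[of k] by (simp add: power2_eq_square mult.assoc)
qed

text \<open>\<open>D_rho\<close> is of order \<open>sqrt (zeta A k)\<close>. In the other summand,
  one factor \<open>zeta A k\<close> of the square absorbs
  \<open>1 / (mu A k)\<^sup>2\<close>.\<close>

lemma E_rho_sq_le:
  obtains e where "e > 0" "\<And>k. (E_rho P S (mu A k) (zeta A k))\<^sup>2 \<le> e * zeta A k"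
proof
  define a where "a = ((Lxy P)\<^sup>2 + (1 / rho P)\<^sup>2) * 2 / m"
  let ?e = "2 * a + 2 * (b_phi S * BR P)\<^sup>2 * Z"
  have "a > 0" unfolding a_def using m_pos rho_pos by (simp add: add_nonneg_pos)
  then show "?e > 0" using Z_pos by (simp add: add_pos_nonneg)
  fix k
  let ?D = "D_rho P (zeta A k)" and ?F = "b_phi S * BR P / mu A k * zeta A k"
  have D: "?D\<^sup>2 = a * zeta A k"
    unfolding D_rho_def a_def using zeta_pos[of k] m_pos by (simp add: power_mult_distrib)
  have "?F\<^sup>2 = (b_phi S * BR P)\<^sup>2 * (zeta A k / (mu A k)\<^sup>2 * zeta A k)"
    by (simp add: power2_eq_square)
  also have "\<dots> \<le> (b_phi S * BR P)\<^sup>2 * (Z * zeta A k)"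
    using zeta_le[of k] zeta_pos[of k] mu_pos[of k]
    by (intro mult_left_mono mult_right_mono) (auto simp: field_simps)
  finally have F: "?F\<^sup>2 \<le> (b_phi S * BR P)\<^sup>2 * (Z * zeta A k)" .
  have "(?D + ?F)\<^sup>2 \<le> 2 * ?D\<^sup>2 + 2 * ?F\<^sup>2"
    using zero_le_power2[of "?D - ?F"] by (simp add: power2_sum power2_diff)
  then show "(E_rho P S (mu A k) (zeta A k))\<^sup>2 \<le> ?e * zeta A k"
    unfolding E_rho_def using D F by (simp add: algebra_simps)
qed

lemma D_rho_le:
  obtains d where "d > 0" "\<And>k. D_rho P (zeta A k) \<le> d * mu A k"
proof -
  obtain e where e: "e > 0" "\<And>k. (E_rho P S (mu A k) (zeta A k))\<^sup>2 \<le> e * zeta A k"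
    using E_rho_sq_le by blast
  have "D_rho P (zeta A k) \<le> sqrt (e * Z) * mu A k" for k
  proof (rule power2_le_imp_le)
    have "D_rho P (zeta A k) \<le> E_rho P S (mu A k) (zeta A k)"
      unfolding E_rho_def using smoothing_consts BR_pos mu_pos[of k] zeta_pos[of k] by simp
    then have "(D_rho P (zeta A k))\<^sup>2 \<le> e * zeta A k"
      using e(2)[of k] power_mono D_rho_nonneg zeta_pos by (meson less_imp_le order_trans)
    also have "\<dots> \<le> e * (Z * (mu A k)\<^sup>2)" using zeta_le e by (intro mult_left_mono) auto
    also have "\<dots> = (sqrt (e * Z) * mu A k)\<^sup>2" using e Z_pos by (simp add: power_mult_distrib)
    finally show "(D_rho P (zeta A k))\<^sup>2 \<le> (sqrt (e * Z) * mu A k)\<^sup>2" .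
    show "0 \<le> sqrt (e * Z) * mu A k" using e Z_pos mu_pos[of k] by simp
  qed
  then show ?thesis using that[of "sqrt (e * Z)"] e Z_pos by simp
qed

text \<open>\<open>tau\<close> with \<open>theta\<close> replaced by its floor
  \<open>th_low A\<close>: a majorant that depends neither on the run nor on the accepted step
  parameter.\<close>

definition tau_bar :: "nat \<Rightarrow> real" where
  "tau_bar k = mu A k / (2 * th_low A) * (E_rho P S (mu A k) (zeta A k))\<^sup>2 + zeta A k + zeta A (Suc k)"

lemma tau_bar_nonneg: "0 \<le> tau_bar k"
  unfolding tau_bar_def using mu_pos[of k] th_low_pos zeta_pos[of k] zeta_pos[of "Suc k"] by simp

lemma tau_le_tau_bar: "tau P S A k w z t l \<le> tau_bar k"
proof -
  have "th_low A \<le> theta P S A k w z t l" unfolding theta_def Let_def by simp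
  then show ?thesis unfolding tau_def tau_bar_def using mu_pos[of k] th_low_pos
    by (intro add_right_mono mult_right_mono divide_left_mono) auto
qed

lemma summable_tau_bar: "summable tau_bar"
proof -
  obtain e where e: "e > 0" "\<And>k. (E_rho P S (mu A k) (zeta A k))\<^sup>2 \<le> e * zeta A k"
    using E_rho_sq_le by blast
  have "summable (\<lambda>k. (mu A 0 / (2 * th_low A) * e) * zeta A k + zeta A k + zeta A (Suc k))"
    using zeta_summable by (intro summable_add summable_mult) (auto simp: summable_Suc_iff)
  moreover have "norm (tau_bar k) \<le> (mu A 0 / (2 * th_low A) * e) * zeta A k + zeta A k + zeta A (Suc k)" for k
  proof -
    have "mu A k / (2 * th_low A) * (E_rho P S (mu A k) (zeta A k))\<^sup>2 \<le> mu A 0 / (2 * th_low A) * (e * zeta A k)"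
      using mu_antimono[of 0 k] mu_pos[of 0] th_low_pos e by (intro mult_mono divide_right_mono) auto
    then show ?thesis using tau_bar_nonneg[of k] unfolding tau_bar_def by simp
  qed
  ultimately show ?thesis by (rule summable_comparison_test'[where N = 0])
qed

text \<open>A penalty update happens at a point of positive residual that is almost stationary for
  \<open>\<gamma> f + \<phi> \<circ> R\<close> with \<open>\<phi>' \<ge> 1/3\<close>; for small \<open>\<gamma>\<close> this contradicts the uniform qualification.\<close>

lemma update_needs_large_penalty:
  obtains g0 k0 where "g0 > 0"
    "\<And>k w z t l. k0 \<le> k \<Longrightarrow> w \<in> C \<Longrightarrow> accurate P w (zeta A k) z \<Longrightarrow> 0 < l \<Longrightarrow> l \<le> Lbar \<Longrightarrow>
      2 * a_phi S * mu A k < trial_resid P S A k w z t l \<Longrightarrow>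
      norm (trial_w P S A k w z t l - w) \<le> c2 A * mu A k * ghat A t \<Longrightarrow> g0 \<le> ghat A t"
proof -
  obtain \<nu> where \<nu>: "\<nu> > 0"
    "\<And>w v. w \<in> C \<Longrightarrow> R w \<ge> 0 \<Longrightarrow> v \<in> normal_cone C w \<Longrightarrow> \<nu> \<le> norm (dR w + v)"
    using ENNAMCQ_uniform[OF cq] by blast
  obtain F where F: "F > 0" "\<And>w. w \<in> C \<Longrightarrow> norm (grad_f P w) \<le> F"
    using grad_f_bound by blast
  obtain d where d: "d > 0" "\<And>k. D_rho P (zeta A k) \<le> d * mu A k"
    using D_rho_le by blast
  \<comment> \<open>Coefficient of \<open>ghat A t\<close> in the stationarity error after the step
    length is replaced by its bound \<open>c2 A * mu A k * ghat A t\<close>.\<close>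
  define Q where "Q = F + (\<bar>Lbar\<bar> + (ghat A 0 * Lf P + LR P) * mu A 0) * c2 A"
  have Q: "Q > 0" unfolding Q_def using F c2_pos ghat_pos[of 0] Lf_nonneg LR_pos mu_pos[of 0]
    by (intro add_pos_nonneg mult_nonneg_nonneg add_nonneg_nonneg) auto
  \<comment> \<open>The first entry limits the change of \<open>R\<close> over the step to
    \<open>a_phi S * \<mu> / 4\<close>, the second makes \<open>Q * \<gamma>\<close> less than
    \<open>\<nu> / 12\<close>. The threshold on \<open>mu A k\<close> below does the same for the
    tolerance and for \<open>d * \<mu>\<close>.\<close>
  define g0 where "g0 = min (a_phi S / (4 * BR P * c2 A)) (\<nu> / (12 * Q))"
  have g0: "g0 > 0" unfolding g0_def using \<nu> Q BR_pos c2_pos smoothing_consts by simp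
  have "eventually (\<lambda>k. mu A k < min (a_phi S / (4 * Z)) (\<nu> / (12 * d))) sequentially"
    using mu_lim by (rule order_tendstoD) (use smoothing_consts Z_pos \<nu> d in auto)
  then obtain k0 where k0: "\<And>k. k0 \<le> k \<Longrightarrow> mu A k < min (a_phi S / (4 * Z)) (\<nu> / (12 * d))"
    unfolding eventually_sequentially by blast
  have "g0 \<le> ghat A t"
    if k: "k0 \<le> k" and w: "w \<in> C" and z: "accurate P w (zeta A k) z" and l: "0 < l" "l \<le> Lbar"
      and up: "2 * a_phi S * mu A k < trial_resid P S A k w z t l"
        "norm (trial_w P S A k w z t l - w) \<le> c2 A * mu A k * ghat A t" for k w z t l
  proof (rule ccontr)
    define w' where "w' = trial_w P S A k w z t l"
    define n where "n = norm (w' - w)"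
    define \<gamma> where "\<gamma> = ghat A t"
    define \<mu> where "\<mu> = mu A k"
    define Rt where "Rt = resid_at P w z"
    define p where "p = dphi S \<mu> Rt"
    assume "\<not> g0 \<le> ghat A t"
    then have g: "\<gamma> < a_phi S / (4 * BR P * c2 A)" "\<gamma> < \<nu> / (12 * Q)"
      unfolding g0_def \<gamma>_def by auto
    have g': "0 < \<gamma>" "\<gamma> \<le> ghat A 0" unfolding \<gamma>_def using ghat_pos ghat_antimono by auto
    have m: "0 < \<mu>" "\<mu> \<le> mu A 0" unfolding \<mu>_def using mu_pos mu_antimono by auto
    have w': "w' \<in> C" unfolding w'_def by (rule trial_w_in)
    have n: "n \<le> c2 A * \<mu> * \<gamma>" "0 \<le> n" using up unfolding n_def w'_def \<mu>_def \<gamma>_def by auto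
    have zY: "z \<in> Y" using z unfolding accurate_def by auto
    have Rw': "2 * a_phi S * \<mu> < R w'"
      using up(1) resid_at_bounds(1)[OF trial_z_accurate[OF zY]] unfolding trial_resid_def w'_def \<mu>_def
      by (rule less_le_trans)
    have Rpos: "0 \<le> R w'" using Rw' smoothing_consts m by (smt (verit) mult_nonneg_nonneg)
    have "BR P * n \<le> BR P * (c2 A * \<mu> * \<gamma>)" using n BR_pos by simp
    also have "\<dots> \<le> a_phi S * \<mu> / 4" using g(1) m BR_pos c2_pos by (simp add: field_simps)
    finally have 1: "BR P * n \<le> a_phi S * \<mu> / 4" .
    have "zeta A k \<le> (Z * \<mu>) * \<mu>" using zeta_le[of k] unfolding \<mu>_def by (simp add: power2_eq_square mult.assoc)
    also have "\<dots> \<le> (a_phi S / 4) * \<mu>"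
      using k0[OF k] Z_pos m unfolding \<mu>_def by (intro mult_right_mono) (auto simp: field_simps)
    finally have 2: "zeta A k \<le> a_phi S * \<mu> / 4" by simp
    have "R w' \<le> R w + BR P * n" using R_lipschitz[OF w' w] unfolding n_def by linarith
    \<comment> \<open>The update test gives more than \<open>2 * (a_phi S * \<mu>)\<close> at the
      new point; going back to \<open>w\<close> and to the computed residual loses a quarter of
      \<open>a_phi S * \<mu>\<close> each.\<close>
    then have Rt: "3 / 2 * (a_phi S * \<mu>) \<le> Rt"
      using Rw' 1 2 resid_at_bounds(2)[OF z] unfolding Rt_def by linarith
    have aPos: "0 < a_phi S * \<mu>" using smoothing_consts m by simp
    \<comment> \<open>The tangent at \<open>Rt\<close>, read at 0, gives
      \<open>Rt - a_phi S * \<mu> \<le> p * Rt\<close>. As \<open>a_phi S * \<mu>\<close> is at most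
      two thirds of \<open>Rt\<close>, the slope is at least \<open>1 / 3\<close>.\<close>
    have "phi S \<mu> Rt + p * (0 - Rt) \<le> phi S \<mu> 0" unfolding p_def using m(1) by (rule phi_tangent)
    moreover have "Rt - a1 S * \<mu> \<le> phi S \<mu> Rt" using phi_bounds(1)[OF m(1), of Rt] Rt aPos by linarith
    moreover have "phi S \<mu> 0 \<le> a2 S * \<mu>" using phi_bounds(2)[OF m(1), of 0] by simp
    ultimately have "Rt - a_phi S * \<mu> \<le> p * Rt" unfolding a_phi_def by (simp add: algebra_simps)
    then have "1 / 3 * Rt \<le> p * Rt" using Rt by linarith
    then have p: "1 / 3 \<le> p" using Rt aPos by (simp add: mult_le_cancel_right)
    obtain v where v: "v \<in> normal_cone C w'" and vn: "norm (\<gamma> *\<^sub>R grad_f P w' + p *\<^sub>R dR w' + v)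
        \<le> l / \<mu> * n + (\<gamma> * Lf P + LR P) * n + D_rho P (zeta A k)"
      using stationarity_residual[OF w z l(1), of t] unfolding w'_def n_def \<gamma>_def \<mu>_def p_def Rt_def by blast
    \<comment> \<open>Rescaling by \<open>1 / p\<close> stays in the cone. The qualification then
      keeps the error above \<open>\<nu> / 3\<close>, whereas the estimates below bring it under
      \<open>\<nu> / 6\<close>.\<close>
    have "\<nu> \<le> norm (dR w' + (1 / p) *\<^sub>R v)"
      using p by (intro \<nu>(2) w' Rpos normal_cone_scale v) auto
    then have "\<nu> / 3 \<le> p * norm (dR w' + (1 / p) *\<^sub>R v)"
      using mult_mono[OF p, of \<nu> "norm (dR w' + (1 / p) *\<^sub>R v)"] p \<nu>(1) by simp
    also have "\<dots> = norm (p *\<^sub>R (dR w' + (1 / p) *\<^sub>R v))" using p by simp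
    also have "p *\<^sub>R (dR w' + (1 / p) *\<^sub>R v) = (\<gamma> *\<^sub>R grad_f P w' + p *\<^sub>R dR w' + v) - \<gamma> *\<^sub>R grad_f P w'"
      using p by (simp add: scaleR_add_right)
    also have "norm \<dots> \<le> norm (\<gamma> *\<^sub>R grad_f P w' + p *\<^sub>R dR w' + v) + norm (\<gamma> *\<^sub>R grad_f P w')"
      by (rule norm_triangle_ineq4)
    also have "\<dots> \<le> (l / \<mu> * n + (\<gamma> * Lf P + LR P) * n + D_rho P (zeta A k)) + \<gamma> * F"
      using vn g' F(2)[OF w'] by (intro add_mono) auto
    also have "\<dots> \<le> (\<bar>Lbar\<bar> / \<mu> * (c2 A * \<mu> * \<gamma>) + (ghat A 0 * Lf P + LR P) * (c2 A * mu A 0 * \<gamma>) + d * \<mu>) + \<gamma> * F"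
    proof (intro add_mono mult_mono)
      show "n \<le> c2 A * mu A 0 * \<gamma>"
        using n(1) m g' c2_pos by (intro order_trans[OF n(1)] mult_right_mono mult_left_mono) auto
    qed (use F(1) n l m g' Lf_nonneg LR_pos d(2) in \<open>auto simp: \<mu>_def[symmetric] intro: divide_right_mono mult_right_mono\<close>,
         use d(2)[of k] in \<open>simp add: \<mu>_def\<close>)
    also have "\<dots> = Q * \<gamma> + d * \<mu>" unfolding Q_def using m by (simp add: field_simps)
    also have "\<dots> < \<nu> / 12 + \<nu> / 12"
    proof (rule add_strict_mono)
      show "Q * \<gamma> < \<nu> / 12" using g(2) Q by (simp add: field_simps)
      show "d * \<mu> < \<nu> / 12" using k0[OF k] d unfolding \<mu>_def by (simp add: field_simps)
    qed
    finally show False using \<nu>(1) by simp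
  qed
  then show ?thesis using that g0 by blast
qed

end

section \<open>Lyapunov analysis of a run\<close>

lemma eps_KKT_mono: "eps_KKT P a w \<Longrightarrow> a \<le> b \<Longrightarrow> eps_KKT P b w"
  unfolding eps_KKT_def by (meson order_trans)

locale ivsp_run = ivsp_setup P S A
  for P :: "('a::euclidean_space, 'b::euclidean_space) problem" and S A +
  fixes zi :: 'b and L0 :: "nat \<Rightarrow> real"
  assumes inputs: "valid_inputs P A zi L0"
begin

abbreviation "run k \<equiv> ivsp P S A zi L0 k"
abbreviation "W k \<equiv> ivsp_w P S A zi L0 k"
abbreviation "Zt k \<equiv> fst (snd (run k))"
abbreviation "T k \<equiv> snd (snd (run k))"
abbreviation "Lk k \<equiv> step_L P S A L0 k (W k) (Zt k) (T k)"
abbreviation "Rt k \<equiv> resid_at P (W k) (Zt k)"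
abbreviation "step k \<equiv> norm (W (Suc k) - W k)"

text \<open>\<open>ls_bound\<close>, \<open>evaluations_ok\<close> and the step cost take the state
  apart by pattern matching; this puts them in terms of the component abbreviations.\<close>

lemma case_run: "(case run k of (w, z, t) \<Rightarrow> Q w z t) = Q (W k) (Zt k) (T k)"
  by (simp add: ivsp_w_def split_beta)

lemma run_0: "W 0 = w0 A" "Zt 0 = ME P (w0 A) zi (zeta A 0)" "T 0 = 0"
  by (simp_all add: ivsp_w_def)

lemma run_Suc:
  "W (Suc k) = trial_w P S A k (W k) (Zt k) (T k) (Lk k)"
  "Zt (Suc k) = trial_z P S A k (W k) (Zt k) (T k) (Lk k)"
  "T (Suc k) = (if 2 * a_phi S * mu A k < Rt (Suc k) \<and> step k \<le> c2 A * mu A k * ghat A (T k)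
                then Suc (T k) else T k)"
  by (simp_all add: ivsp_w_def ivsp_step_def Let_def split_beta)

lemma Rt_Suc: "Rt (Suc k) = trial_resid P S A k (W k) (Zt k) (T k) (Lk k)"
  unfolding trial_resid_def run_Suc(1,2) ..

lemma run_invariant: "W k \<in> C \<and> accurate P (W k) (zeta A k) (Zt k)"
proof (induction k)
  case 0
  have "zi \<in> Y" using inputs unfolding valid_inputs_def by simp
  then show ?case
    using ME_ok[OF w0_in _ zeta_pos] w0_in unfolding ME_ok_def run_0 by auto
next
  case (Suc k)
  then have "Zt k \<in> Y" unfolding accurate_def by auto
  then show ?case unfolding run_Suc(1,2) using trial_w_in trial_z_accurate by auto
qed

lemma W_in: "W k \<in> C" and Zt_accurate: "accurate P (W k) (zeta A k) (Zt k)" and Zt_in: "Zt k \<in> Y"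
  using run_invariant[of k] unfolding accurate_def by auto

lemma run_evaluations_ok: "evaluations_ok P S A zi L0"
proof -
  have "zi \<in> Y" using inputs unfolding valid_inputs_def by simp
  then show ?thesis
    unfolding evaluations_ok_def case_run using ME_ok w0_in zeta_pos trial_w_in Zt_in by simp
qed

end

locale ivsp_ls_run = ivsp_run P S A zi L0
  for P :: "('a::euclidean_space, 'b::euclidean_space) problem" and S A zi L0 +
  fixes B :: nat
  assumes ls: "ls_bound P S A zi L0 B"
begin

lemma ls_doubling:
  assumes "rule A = Doubling Lmin Lmax"
  obtains i where "Suc i \<le> B" "accepts P S A k (W k) (Zt k) (T k) (trial_L A L0 k i)"
proof -
  have "case run k of (w, z, t) \<Rightarrow> \<exists>i. Suc i \<le> B \<and> accepts P S A k w z t (trial_L A L0 k i)"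
    using ls assms unfolding ls_bound_def by simp
  then show ?thesis using that unfolding case_run by auto
qed

lemma accepted_less: "accepted P S A L0 k (W k) (Zt k) (T k) < B"
proof (cases "rule A")
  case Fixed
  then show ?thesis using ls unfolding accepted_def ls_bound_def by simp
next
  case (Doubling Lmin Lmax)
  then obtain i where i: "Suc i \<le> B" "accepts P S A k (W k) (Zt k) (T k) (trial_L A L0 k i)"
    by (rule ls_doubling)
  have "(LEAST i. accepts P S A k (W k) (Zt k) (T k) (trial_L A L0 k i)) \<le> i"
    using i(2) by (rule Least_le)
  then show ?thesis using i Doubling unfolding accepted_def by simp
qed

text \<open>Every trial value above \<open>L_safe\<close> is accepted, so the doubling overshoots it at most by a
  factor of two.\<close>

lemma step_L:
  shows "accepts P S A k (W k) (Zt k) (T k) (Lk k)"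
    and "0 < Lk k"
    and "Lk k \<le> (case rule A of Fixed l \<Rightarrow> l | Doubling Lmin Lmax \<Rightarrow> max Lmax (2 * L_safe P S A))"
proof -
  note safe = safe_accepts[OF W_in Zt_accurate]
  have "accepts P S A k (W k) (Zt k) (T k) (Lk k) \<and> 0 < Lk k \<and>
    Lk k \<le> (case rule A of Fixed l \<Rightarrow> l | Doubling Lmin Lmax \<Rightarrow> max Lmax (2 * L_safe P S A))"
  proof (cases "rule A")
    case (Fixed l)
    then have "L_safe P S A \<le> l" using vA unfolding valid_params_def valid_rule_def by simp
    then show ?thesis
      using Fixed safe L_safe_pos unfolding step_L_def trial_L_def by simp
  next
    case (Doubling Lmin Lmax)
    define i where "i = accepted P S A L0 k (W k) (Zt k) (T k)"
    let ?acc = "\<lambda>i. accepts P S A k (W k) (Zt k) (T k) (trial_L A L0 k i)"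
    have i: "i = (LEAST i. ?acc i)" unfolding i_def accepted_def Doubling by simp
    have Lk: "Lk k = trial_L A L0 k i" unfolding step_L_def i_def ..
    have tL: "trial_L A L0 k j = 2 ^ j * L0 k" for j unfolding trial_L_def Doubling by simp
    have L0: "0 < L0 k" "L0 k \<le> Lmax"
      using vA inputs Doubling unfolding valid_params_def valid_rule_def valid_inputs_def
      by (auto intro: less_le_trans)
    have "?acc i" unfolding i using ls_doubling[OF Doubling] by (metis (mono_tags, lifting) LeastI)
    moreover have "2 ^ i * L0 k \<le> max Lmax (2 * L_safe P S A)"
    proof (cases i)
      case (Suc j)
      then have "\<not> ?acc j" unfolding i by (metis lessI not_less_Least)
      then have "2 ^ j * L0 k < L_safe P S A" using safe tL not_le by metis
      then show ?thesis unfolding Suc by simp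
    qed (use L0 in simp)
    ultimately show ?thesis using L0 Doubling unfolding Lk tL by simp
  qed
  then show "accepts P S A k (W k) (Zt k) (T k) (Lk k)" and "0 < Lk k"
    and "Lk k \<le> (case rule A of Fixed l \<Rightarrow> l | Doubling Lmin Lmax \<Rightarrow> max Lmax (2 * L_safe P S A))"
    by auto
qed

lemma T_mono: "T k \<le> T (Suc k)"
  unfolding run_Suc(3) by simp

lemma T_le: "T k \<le> k"
proof (induction k)
  case (Suc k)
  have "T (Suc k) \<le> Suc (T k)" unfolding run_Suc(3) by simp
  then show ?case using Suc by linarith
qed (simp add: run_0)

text \<open>Subtracting \<open>fmin\<close> makes the first factor nonnegative, so lowering the
  penalty weight can only lower \<open>V\<close>; the last term pays for the growth of
  \<open>phi\<close> when \<mu> shrinks. The computed residual is used because it is what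
  consecutive acceptance tests share, so they telescope.\<close>

definition V :: "real \<Rightarrow> nat \<Rightarrow> real" where
  "V fmin k = ghat A (T k) * (ff P (W k) - fmin) + phi S (mu A k) (Rt k) + c_phi S * mu A k"

lemma V_decrease:
  assumes "\<And>w. w \<in> C \<Longrightarrow> fmin \<le> ff P w"
  shows "V fmin (Suc k) + c1 A / 2 * ((step k)\<^sup>2 / mu A k)
    \<le> V fmin k + tau P S A k (W k) (Zt k) (T k) (Lk k)"
proof -
  let ?R = "Rt (Suc k)"
  have "ghat A (T k) * ff P (W (Suc k)) + phi S (mu A k) (?R + zeta A (Suc k))
      \<le> ghat A (T k) * ff P (W k) + phi S (mu A k) (Rt k)
       - c1 A / (2 * mu A k) * (step k)\<^sup>2 + tau P S A k (W k) (Zt k) (T k) (Lk k)"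
    using step_L(1)[of k] unfolding accepts_def Rt_Suc[symmetric] run_Suc(1)[symmetric] .
  moreover have "phi S (mu A k) ?R \<le> phi S (mu A k) (?R + zeta A (Suc k))"
    using mu_pos by (rule phi_mono) (use zeta_pos[of "Suc k"] in simp)
  moreover have "phi S (mu A (Suc k)) ?R \<le> phi S (mu A k) ?R + c_phi S * (mu A k - mu A (Suc k))"
    using vs mu_pos mu_antimono[of k "Suc k"] unfolding valid_smoothing_def by simp
  moreover have "ghat A (T (Suc k)) * (ff P (W (Suc k)) - fmin) \<le> ghat A (T k) * (ff P (W (Suc k)) - fmin)"
    using ghat_antimono[OF T_mono] assms[OF W_in, of "Suc k"] by (intro mult_right_mono) auto
  moreover have "c1 A / (2 * mu A k) * (step k)\<^sup>2 = c1 A / 2 * ((step k)\<^sup>2 / mu A k)" by simp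
  ultimately show ?thesis unfolding V_def by (simp add: right_diff_distrib)
qed

text \<open>The initial value is compared with the exact residual at \<open>w0 A\<close>, since
  \<open>Rt 0\<close> depends on \<open>zi\<close> and the bound must not.\<close>

lemma V_bounds:
  assumes "\<And>w. w \<in> C \<Longrightarrow> fmin \<le> ff P w" "\<And>w. w \<in> C \<Longrightarrow> ff P w \<le> fmax"
  shows "V fmin 0 \<le> ghat A 0 * (fmax - fmin) + phi S (mu A 0) (R (w0 A)) + c_phi S * mu A 0"
    and "- a1 S * mu A 0 \<le> V fmin k"
proof -
  have "phi S (mu A 0) (Rt 0) \<le> phi S (mu A 0) (R (W 0))"
    using mu_pos resid_at_bounds(1)[OF Zt_accurate] by (rule phi_mono)
  moreover have "ghat A 0 * (ff P (W 0) - fmin) \<le> ghat A 0 * (fmax - fmin)"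
    using assms(2)[OF W_in] ghat_pos[of 0] by (intro mult_left_mono) auto
  ultimately show "V fmin 0 \<le> ghat A 0 * (fmax - fmin) + phi S (mu A 0) (R (w0 A)) + c_phi S * mu A 0"
    unfolding V_def run_0 by simp
  have "- a1 S * mu A k \<le> phi S (mu A k) (Rt k)"
    using phi_bounds(1)[OF mu_pos, of "Rt k" k] by linarith
  moreover have "a1 S * mu A k \<le> a1 S * mu A 0"
    using smoothing_consts mu_antimono[of 0 k] by (intro mult_left_mono) auto
  moreover have "0 \<le> ghat A (T k) * (ff P (W k) - fmin)"
    using assms(1)[OF W_in] ghat_pos[of "T k"] by simp
  moreover have "0 \<le> c_phi S * mu A k" using smoothing_consts mu_pos[of k] by simp
  ultimately show "- a1 S * mu A 0 \<le> V fmin k" unfolding V_def by linarith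
qed

end

section \<open>Bounds uniform over all runs\<close>

context ivsp_rates
begin

abbreviation is_run :: "'b \<Rightarrow> (nat \<Rightarrow> real) \<Rightarrow> nat \<Rightarrow> bool" where
  "is_run zi L0 B \<equiv> ivsp_ls_run P S A zi L0 B"

text \<open>Telescoping the decrease of \<open>V\<close> with summable errors. Only the bounds on
  \<open>V\<close> and the run-independent \<open>tau_bar\<close> enter \<open>H\<close>, so it
  precedes the choice of the run.\<close>

lemma uniform_step_sum:
  obtains H where "\<And>zi L0 B n. is_run zi L0 B \<Longrightarrow>
    (\<Sum>k<n. (norm (ivsp_w P S A zi L0 (Suc k) - ivsp_w P S A zi L0 k))\<^sup>2 / mu A k) \<le> H"
proof -
  obtain fmin fmax where f: "\<And>w. w \<in> C \<Longrightarrow> fmin \<le> ff P w" "\<And>w. w \<in> C \<Longrightarrow> ff P w \<le> fmax"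
    using f_bounds by blast
  define H where "H = 2 / c1 A * (ghat A 0 * (fmax - fmin) + phi S (mu A 0) (R (w0 A)) + c_phi S * mu A 0
    + a1 S * mu A 0 + suminf tau_bar)"
  have "(\<Sum>k<n. (norm (ivsp_w P S A zi L0 (Suc k) - ivsp_w P S A zi L0 k))\<^sup>2 / mu A k) \<le> H"
    if "is_run zi L0 B" for zi L0 B n
  proof -
    interpret ivsp_ls_run P S A zi L0 B by (fact that)
    have "V fmin n + c1 A / 2 * (\<Sum>k<n. (step k)\<^sup>2 / mu A k) \<le> V fmin 0 + (\<Sum>k<n. tau_bar k)"
    proof (induction n)
      case (Suc n)
      have "V fmin (Suc n) + c1 A / 2 * ((step n)\<^sup>2 / mu A n) \<le> V fmin n + tau_bar n"
        using V_decrease[OF f(1), of n] tau_le_tau_bar order_trans add_left_mono by (meson)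
      then show ?case using Suc by (simp add: distrib_left)
    qed simp
    moreover have "(\<Sum>k<n. tau_bar k) \<le> suminf tau_bar"
      using summable_tau_bar tau_bar_nonneg by (intro sum_le_suminf) auto
    moreover note V_bounds(1)[OF f] V_bounds(2)[OF f, of n]
    ultimately have "c1 A / 2 * (\<Sum>k<n. (step k)\<^sup>2 / mu A k)
      \<le> ghat A 0 * (fmax - fmin) + phi S (mu A 0) (R (w0 A)) + c_phi S * mu A 0
        + a1 S * mu A 0 + suminf tau_bar" by linarith
    then have "2 / c1 A * (c1 A / 2 * (\<Sum>k<n. (step k)\<^sup>2 / mu A k)) \<le> H"
      unfolding H_def using c1_pos by (intro mult_left_mono) auto
    then show ?thesis using c1_pos by simp
  qed
  then show ?thesis by (rule that)
qed

definition "Lbar = (case rule A of Fixed l \<Rightarrow> l | Doubling Lmin Lmax \<Rightarrow> max Lmax (2 * L_safe P S A))"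

text \<open>Up to iteration \<open>k0\<close> the index grows by at most one per iteration. Later an
  update forces \<open>ghat A (T k)\<close> to be at least \<open>g0\<close>, hence
  \<open>T k < j0\<close>.\<close>

lemma uniform_penalty_bound:
  obtains Tmax where "\<And>zi L0 B k. is_run zi L0 B \<Longrightarrow> snd (snd (ivsp P S A zi L0 k)) \<le> Tmax"
proof -
  obtain g0 k0 where g0: "g0 > 0"
    and up: "\<And>k w z t l. k0 \<le> k \<Longrightarrow> w \<in> C \<Longrightarrow> accurate P w (zeta A k) z \<Longrightarrow> 0 < l \<Longrightarrow> l \<le> Lbar \<Longrightarrow>
      2 * a_phi S * mu A k < trial_resid P S A k w z t l \<Longrightarrow>
      norm (trial_w P S A k w z t l - w) \<le> c2 A * mu A k * ghat A t \<Longrightarrow> g0 \<le> ghat A t"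
    using update_needs_large_penalty[of Lbar] by metis
  have "eventually (\<lambda>t. ghat A t < g0) sequentially"
    using ghat_lim g0 by (rule order_tendstoD)
  then obtain j0 where j0: "ghat A j0 < g0" unfolding eventually_sequentially by blast
  have "snd (snd (ivsp P S A zi L0 k)) \<le> k0 + j0" if "is_run zi L0 B" for zi L0 B k
  proof -
    interpret ivsp_ls_run P S A zi L0 B by (fact that)
    show "T k \<le> k0 + j0"
    proof (induction k)
      case (Suc k)
      show ?case
      proof (cases "k0 \<le> k \<and> 2 * a_phi S * mu A k < Rt (Suc k) \<and> step k \<le> c2 A * mu A k * ghat A (T k)")
        case True
        have "g0 \<le> ghat A (T k)"
          using True step_L(2,3)[of k] unfolding Rt_Suc unfolding run_Suc(1) Lbar_def[symmetric]
          by (intro up[of k "W k" "Zt k" "Lk k"] W_in Zt_accurate) auto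
        then have "T k < j0" using j0 ghat_antimono[of j0 "T k"] by (meson leD leI order_trans)
        then show ?thesis unfolding run_Suc(3) by simp
      next
        case False
        then show ?thesis
        proof (cases "k0 \<le> k")
          case True
          then show ?thesis using False Suc unfolding run_Suc(3) by auto
        next
          case False
          then show ?thesis using T_le[of "Suc k"] by linarith
        qed
      qed
    qed (simp add: run_0)
  qed
  then show ?thesis by (rule that)
qed

text \<open>The multiplier is \<open>p / \<gamma>\<close>: stationarity of the merit function is
  divided by \<open>\<gamma> \<ge> gmin\<close>. Feasibility comes from the absence of an update,
  and complementarity from convexity of \<open>phi\<close>, whose slope must be small where the
  residual is very negative.\<close>

lemma eps_KKT_of_small_step:
  assumes gmin: "gmin > 0"
  obtains Q where "Q > 0" "\<And>zi L0 B k. is_run zi L0 B \<Longrightarrow> gmin \<le> ghat A (snd (snd (ivsp P S A zi L0 k))) \<Longrightarrow>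
    snd (snd (ivsp P S A zi L0 (Suc k))) = snd (snd (ivsp P S A zi L0 k)) \<Longrightarrow>
    norm (ivsp_w P S A zi L0 (Suc k) - ivsp_w P S A zi L0 k) \<le> c2 A * mu A k * gmin \<Longrightarrow>
    eps_KKT P (Q * (mu A k + norm (ivsp_w P S A zi L0 (Suc k) - ivsp_w P S A zi L0 k) / mu A k))
      (ivsp_w P S A zi L0 (Suc k))"
proof -
  obtain d where d: "d > 0" "\<And>k. D_rho P (zeta A k) \<le> d * mu A k"
    using D_rho_le by blast
  define a where "a = a_phi S"
  \<comment> \<open>\<open>Q1\<close> collects the stationarity errors, divided by
    \<open>gmin\<close>. \<open>Q3\<close> is one constant large enough both for the positive
    residual and for \<open>p\<close> times its absolute value.\<close>
  define Q1 where "Q1 = (\<bar>Lbar\<bar> + (ghat A 0 * Lf P + LR P) * mu A 0 + d) / gmin"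
  define Q3 where "Q3 = 2 * a + 2 * Z * mu A 0 + BR P * mu A 0"
  have a: "a > 0" unfolding a_def using smoothing_consts by simp
  have Q1: "Q1 > 0" unfolding Q1_def using gmin d ghat_pos[of 0] Lf_nonneg LR_pos mu_pos[of 0]
    by (intro divide_pos_pos add_nonneg_pos add_nonneg_nonneg mult_nonneg_nonneg) auto
  have Q3: "Q3 > 0" unfolding Q3_def using a Z_pos mu_pos[of 0] BR_pos by (simp add: add_pos_pos)
  let ?Q = "Q1 + Q3 / gmin + Q3"
  have "eps_KKT P (?Q * (mu A k + norm (ivsp_w P S A zi L0 (Suc k) - ivsp_w P S A zi L0 k) / mu A k))
      (ivsp_w P S A zi L0 (Suc k))"
    if "is_run zi L0 B" and gk: "gmin \<le> ghat A (snd (snd (ivsp P S A zi L0 k)))"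
      and noup: "snd (snd (ivsp P S A zi L0 (Suc k))) = snd (snd (ivsp P S A zi L0 k))"
      and small: "norm (ivsp_w P S A zi L0 (Suc k) - ivsp_w P S A zi L0 k) \<le> c2 A * mu A k * gmin"
    for zi L0 B k
  proof -
    interpret ivsp_ls_run P S A zi L0 B by (fact that)
    define w' where "w' = W (Suc k)"
    define n where "n = step k"
    define \<gamma> where "\<gamma> = ghat A (T k)"
    define \<mu> where "\<mu> = mu A k"
    define p where "p = dphi S \<mu> (Rt k)"
    define e where "e = \<mu> + n / \<mu>"
    have m: "0 < \<mu>" "\<mu> \<le> mu A 0" unfolding \<mu>_def using mu_pos mu_antimono by auto
    have g: "gmin \<le> \<gamma>" "\<gamma> \<le> ghat A 0" "0 < \<gamma>" unfolding \<gamma>_def using gk ghat_antimono ghat_pos by auto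
    have p: "0 \<le> p" "p \<le> 1" unfolding p_def using dphi_bounds[OF m(1)] by auto
    have w': "w' \<in> C" unfolding w'_def by (rule W_in)
    have n: "0 \<le> n" "n / \<mu> \<le> e" "\<mu> \<le> e" "0 \<le> e" unfolding n_def e_def using m by auto
    have ne: "n \<le> mu A 0 * e"
    proof -
      have "n = \<mu> * (n / \<mu>)" using m by simp
      also have "\<dots> \<le> mu A 0 * e" using m n mu_pos[of 0] by (intro mult_mono) auto
      finally show ?thesis .
    qed
    have zk: "zeta A k \<le> Z * mu A 0 * e" "zeta A (Suc k) \<le> Z * mu A 0 * e"
    proof -
      have "Z * mu A 0 * mu A k \<le> Z * mu A 0 * e"
        using n Z_pos mu_pos[of 0] unfolding \<mu>_def by (intro mult_left_mono) auto
      then show "zeta A k \<le> Z * mu A 0 * e" "zeta A (Suc k) \<le> Z * mu A 0 * e"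
        using zeta_le_mu[of k] zeta_antimono[of k "Suc k"] by auto
    qed
    have ae: "a * \<mu> \<le> a * e" using a n by simp
    have Q3e: "Q3 * e = 2 * (a * e) + 2 * (Z * mu A 0 * e) + BR P * (mu A 0 * e)"
      unfolding Q3_def by (simp add: algebra_simps)
    have Zme: "0 \<le> Z * mu A 0 * e" "0 \<le> BR P * (mu A 0 * e)" using Z_pos mu_pos[of 0] n BR_pos by auto
    have BRn: "BR P * n \<le> BR P * (mu A 0 * e)" using ne BR_pos by simp
    obtain v where v: "v \<in> normal_cone C w'" and vn: "norm (\<gamma> *\<^sub>R grad_f P w' + p *\<^sub>R dR w' + v)
        \<le> Lk k / \<mu> * n + (\<gamma> * Lf P + LR P) * n + D_rho P (zeta A k)"
      using stationarity_residual[OF W_in Zt_accurate step_L(2), of k "T k"]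
      unfolding w'_def n_def \<gamma>_def \<mu>_def p_def run_Suc(1) by blast
    have "norm (\<gamma> *\<^sub>R grad_f P w' + p *\<^sub>R dR w' + v)
        \<le> \<bar>Lbar\<bar> * e + (ghat A 0 * Lf P + LR P) * (mu A 0 * e) + d * e"
    proof (rule order_trans[OF vn], intro add_mono)
      have "Lk k * (n / \<mu>) \<le> \<bar>Lbar\<bar> * e"
        using step_L(2,3)[of k] n m unfolding Lbar_def by (intro mult_mono) auto
      then show "Lk k / \<mu> * n \<le> \<bar>Lbar\<bar> * e" by simp
      show "(\<gamma> * Lf P + LR P) * n \<le> (ghat A 0 * Lf P + LR P) * (mu A 0 * e)"
        using g n ne Lf_nonneg LR_pos ghat_pos[of 0] by (intro mult_mono add_right_mono mult_right_mono) auto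
      have "d * \<mu> \<le> d * e" using d(1) n by simp
      then show "D_rho P (zeta A k) \<le> d * e" using d(2)[of k] unfolding \<mu>_def by linarith
    qed
    also have "\<dots> = (\<bar>Lbar\<bar> + (ghat A 0 * Lf P + LR P) * mu A 0 + d) * e" by (simp add: algebra_simps)
    also have "\<dots> = gmin * Q1 * e" unfolding Q1_def using gmin by simp
    also have "\<dots> \<le> \<gamma> * Q1 * e" using g Q1 n by (intro mult_right_mono) auto
    finally have "(1 / \<gamma>) * norm (\<gamma> *\<^sub>R grad_f P w' + p *\<^sub>R dR w' + v) \<le> (1 / \<gamma>) * (\<gamma> * Q1 * e)"
      using g by (intro mult_left_mono) auto
    also have "(1 / \<gamma>) * norm (\<gamma> *\<^sub>R grad_f P w' + p *\<^sub>R dR w' + v)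
        = norm ((1 / \<gamma>) *\<^sub>R (\<gamma> *\<^sub>R grad_f P w' + p *\<^sub>R dR w' + v))" using g by simp
    also have "(1 / \<gamma>) *\<^sub>R (\<gamma> *\<^sub>R grad_f P w' + p *\<^sub>R dR w' + v)
        = grad_f P w' + (p / \<gamma>) *\<^sub>R dR w' + (1 / \<gamma>) *\<^sub>R v" using g by (simp add: scaleR_add_right)
    finally have stat: "norm (grad_f P w' + (p / \<gamma>) *\<^sub>R dR w' + (1 / \<gamma>) *\<^sub>R v) \<le> Q1 * e" using g by simp
    have vg: "(1 / \<gamma>) *\<^sub>R v \<in> normal_cone C w'" using v g by (intro normal_cone_scale) auto
    have "infdist 0 {grad_f P w' + (p / \<gamma>) *\<^sub>R dR w' + v | v. v \<in> normal_cone C w'} \<le>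
        dist 0 (grad_f P w' + (p / \<gamma>) *\<^sub>R dR w' + (1 / \<gamma>) *\<^sub>R v)"
      using vg by (intro infdist_le CollectI exI[of _ "(1 / \<gamma>) *\<^sub>R v"] conjI refl)
    then have K1: "infdist 0 {grad_f P w' + (p / \<gamma>) *\<^sub>R dR w' + v | v. v \<in> normal_cone C w'} \<le> Q1 * e"
      using stat by simp
    \<comment> \<open>The step clause of the update test holds, so without an update the residual
      clause must fail.\<close>
    have "step k \<le> c2 A * mu A k * ghat A (T k)"
      using small gk c2_pos mu_pos[of k] by (meson less_imp_le mult_left_mono mult_pos_pos order_trans)
    then have "Rt (Suc k) \<le> 2 * a * \<mu>" using noup unfolding run_Suc(3) a_def \<mu>_def by (auto split: if_splits)
    then have Rw': "R w' \<le> 2 * (a * \<mu>) + zeta A (Suc k)"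
      using resid_at_bounds(2)[OF Zt_accurate, of "Suc k"] unfolding w'_def by linarith
    then have "R w' \<le> Q3 * e" unfolding Q3e using ae zk Zme by linarith
    then have K2: "max (R w') 0 \<le> Q3 * e" using Q3 n(4) by simp
    have Rdiff: "\<bar>R w' - Rt k\<bar> \<le> BR P * n + zeta A k"
      using R_lipschitz[OF W_in W_in, of "Suc k" k] resid_at_bounds[OF Zt_accurate, of k]
      unfolding w'_def n_def by linarith
    have comp: "p * \<bar>R w'\<bar> \<le> Q3 * e"
    proof (cases "0 \<le> R w'")
      case True
      then have "\<bar>R w'\<bar> \<le> Q3 * e" using K2 by simp
      then show ?thesis using p mult_mono[OF p(2), of "\<bar>R w'\<bar>" "Q3 * e"] by simp
    next
      case neg: False
      have pd: "p * (BR P * n + zeta A k) \<le> BR P * n + zeta A k"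
        using p BR_pos n zeta_pos[of k] mult_right_mono[OF p(2), of "BR P * n + zeta A k"] by simp
      show ?thesis
      proof (cases "0 \<le> Rt k")
        case True
        then have "\<bar>R w'\<bar> \<le> BR P * n + zeta A k" using Rdiff neg by linarith
        then have "p * \<bar>R w'\<bar> \<le> BR P * n + zeta A k" using p pd mult_left_mono by (meson order_trans)
        then show ?thesis unfolding Q3e using BRn zk(1) Zme ae a m by (smt (verit) mult_pos_pos)
      next
        case False
        \<comment> \<open>In the case of two negative residuals \<open>\<bar>R w'\<bar>\<close> need
          not be small, but its product with \<open>p\<close> is: by the tangent inequality
          \<open>p * (- Rt k)\<close> is at most the rise of \<open>phi\<close> from
          \<open>Rt k\<close> to 0, and that is at most \<open>a * \<mu>\<close>.\<close>
        have "p * (0 - Rt k) \<le> phi S \<mu> 0 - phi S \<mu> (Rt k)"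
          using phi_tangent[OF m(1), of "Rt k" 0] unfolding p_def by linarith
        also have "\<dots> \<le> a * \<mu>"
          using phi_bounds(2)[OF m(1), of 0] phi_bounds(1)[OF m(1), of "Rt k"] False
          unfolding a_def a_phi_def by (simp add: algebra_simps)
        finally have "p * (- Rt k) \<le> a * \<mu>" by simp
        moreover have "\<bar>R w'\<bar> \<le> - Rt k + (BR P * n + zeta A k)" using Rdiff neg by linarith
        then have "p * \<bar>R w'\<bar> \<le> p * (- Rt k) + p * (BR P * n + zeta A k)"
          using p(1) mult_left_mono by (metis distrib_left)
        ultimately show ?thesis unfolding Q3e using pd BRn zk(1) Zme ae a m by (smt (verit) mult_pos_pos)
      qed
    qed
    have "\<bar>p / \<gamma> * R w'\<bar> = p * \<bar>R w'\<bar> / \<gamma>" using p g by (simp add: abs_mult)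
    also have "\<dots> \<le> Q3 * e / gmin" using comp g gmin p Q3 n by (intro frac_le) auto
    finally have K3: "\<bar>p / \<gamma> * R w'\<bar> \<le> Q3 / gmin * e" by simp
    have pos: "0 \<le> Q1 * e" "0 \<le> Q3 / gmin * e" "0 \<le> Q3 * e" using Q1 Q3 gmin n by auto
    have Qe: "?Q * e = Q1 * e + Q3 / gmin * e + Q3 * e" by (simp add: distrib_right)
    have "eps_KKT P (?Q * e) w'"
      unfolding eps_KKT_def Qe using w' K1 K2 K3 pos p g
      by (intro conjI exI[of _ "p / \<gamma>"]) auto
    then show ?thesis unfolding e_def w'_def n_def \<mu>_def .
  qed
  then show ?thesis using that[of ?Q] Q1 Q3 gmin by (simp add: add_pos_pos)
qed

end

section \<open>Complexity\<close>

context ivsp_rates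
begin

text \<open>Adding the number of penalty updates to the sum of squared steps turns the choice of an
  iteration with a small step and no update into a single pigeonhole argument.\<close>

lemma eps_KKT_in_window:
  assumes mu_rate: "a > 0" "\<And>k. a * (1 + real k) powr (- 1 / 3) \<le> mu A k"
      "b > 0" "\<And>k. mu A k \<le> b * (1 + real k) powr (- 1 / 3)"
  obtains Q N0 where "Q > 0" "\<And>zi L0 B N. is_run zi L0 B \<Longrightarrow> N0 \<le> N \<Longrightarrow>
    \<exists>k. N \<le> k \<and> k \<le> 2 * N \<and> eps_KKT P (Q * real N powr (- 1 / 3)) (ivsp_w P S A zi L0 (Suc k))"
proof -
  obtain H where H: "\<And>zi L0 B n. is_run zi L0 B \<Longrightarrow>
    (\<Sum>k<n. (norm (ivsp_w P S A zi L0 (Suc k) - ivsp_w P S A zi L0 k))\<^sup>2 / mu A k) \<le> H"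
    using uniform_step_sum by blast
  obtain Tmax where Tmax: "\<And>zi L0 B k. is_run zi L0 B \<Longrightarrow> snd (snd (ivsp P S A zi L0 k)) \<le> Tmax"
    using uniform_penalty_bound by blast
  define gmin where "gmin = ghat A Tmax"
  have gmin: "gmin > 0" unfolding gmin_def by (rule ghat_pos)
  obtain Q where Q: "Q > 0" "\<And>zi L0 B k. is_run zi L0 B \<Longrightarrow> gmin \<le> ghat A (snd (snd (ivsp P S A zi L0 k))) \<Longrightarrow>
    snd (snd (ivsp P S A zi L0 (Suc k))) = snd (snd (ivsp P S A zi L0 k)) \<Longrightarrow>
    norm (ivsp_w P S A zi L0 (Suc k) - ivsp_w P S A zi L0 k) \<le> c2 A * mu A k * gmin \<Longrightarrow>
    eps_KKT P (Q * (mu A k + norm (ivsp_w P S A zi L0 (Suc k) - ivsp_w P S A zi L0 k) / mu A k))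
      (ivsp_w P S A zi L0 (Suc k))"
    using eps_KKT_of_small_step[OF gmin] by metis
  define H1 where "H1 = \<bar>H\<bar> + real Tmax + 1"
  have H1: "H1 > 0" unfolding H1_def by simp
  \<comment> \<open>For \<open>k \<le> 2 * N\<close> one has \<open>1 + k \<le> 3 * N\<close>; the
    factor \<open>3 powr (- 1 / 3)\<close> turns the lower bound for \<open>mu A k\<close> into one
    in terms of \<open>N\<close>.\<close>
  define a' where "a' = a * 3 powr (- 1 / 3)"
  have a': "a' > 0" unfolding a'_def using mu_rate by simp
  define h where "h = sqrt (H1 / a')"
  have h: "h > 0" unfolding h_def using H1 a' by simp
  have "(\<lambda>n. real n powr (- 1 / 3)) \<longlonglongrightarrow> 0"
    by (rule tendsto_neg_powr) (auto simp: filterlim_real_sequentially)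
  then have "eventually (\<lambda>n. real n powr (- 1 / 3) < c2 A * gmin / h) sequentially"
    by (rule order_tendstoD) (use c2_pos gmin h in simp)
  then obtain N1 where N1: "\<And>n. N1 \<le> n \<Longrightarrow> real n powr (- 1 / 3) < c2 A * gmin / h"
    unfolding eventually_sequentially by blast
  \<comment> \<open>\<open>N > H1\<close> brings the average of \<open>G\<close> over the window
    below 1, and \<open>N1\<close> makes the step small enough for the KKT estimate.\<close>
  define N0 where "N0 = max N1 (Suc (nat \<lceil>H1\<rceil>))"
  have "\<exists>k. N \<le> k \<and> k \<le> 2 * N \<and> eps_KKT P (Q * (b + h) * real N powr (- 1 / 3)) (ivsp_w P S A zi L0 (Suc k))"
    if "is_run zi L0 B" and N: "N0 \<le> N" for zi L0 B N
  proof -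
    interpret ivsp_ls_run P S A zi L0 B by (fact that)
    have N': "H1 < real N" "0 < real N" "N1 \<le> N"
      using N H1 unfolding N0_def by linarith+
    define x where "x = real N powr (- 1 / 3)"
    have x: "x > 0" unfolding x_def using N' by simp
    have "x ^ 3 = x powr 3" using x by simp
    also have "\<dots> = 1 / real N" unfolding x_def powr_powr using N' by (simp add: powr_minus_divide)
    finally have x3: "x ^ 3 = 1 / real N" .
    define G where "G k = (step k)\<^sup>2 / mu A k + (real (T (Suc k)) - real (T k))" for k
    have G0: "0 \<le> G k" for k unfolding G_def using T_mono[of k] mu_pos[of k] by simp
    have "(\<Sum>k\<in>{N..2 * N}. G k) \<le> (\<Sum>k<Suc (2 * N). G k)"
      using G0 by (intro sum_mono2) auto
    also have "\<dots> = (\<Sum>k<Suc (2 * N). (step k)\<^sup>2 / mu A k) + real (T (Suc (2 * N)))"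
    proof -
      have "(\<Sum>k<n. G k) = (\<Sum>k<n. (step k)\<^sup>2 / mu A k) + real (T n)" for n
        by (induction n) (simp_all add: G_def run_0 del: ivsp.simps)
      then show ?thesis .
    qed
    also have "\<dots> \<le> H1"
      using H[OF that(1), of "Suc (2 * N)"] Tmax[OF that(1), of "Suc (2 * N)"] unfolding H1_def
      by linarith
    finally have sumG: "(\<Sum>k\<in>{N..2 * N}. G k) \<le> H1" .
    have "\<exists>k\<in>{N..2 * N}. G k \<le> H1 / real N"
    proof (rule ccontr)
      assume "\<not> ?thesis"
      then have "H1 / real N \<le> G k" if "k \<in> {N..2 * N}" for k using that by force
      then have "real (card {N..2 * N}) * (H1 / real N) \<le> (\<Sum>k\<in>{N..2 * N}. G k)"
        by (rule sum_bounded_below)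
      moreover have "H1 < real (card {N..2 * N}) * (H1 / real N)"
        using N' H1 by (simp add: field_simps)
      ultimately show False using sumG by linarith
    qed
    then obtain k where k: "N \<le> k" "k \<le> 2 * N" "G k \<le> H1 / real N" by auto
    have s0: "0 \<le> (step k)\<^sup>2 / mu A k" using mu_pos[of k] by simp
    have "H1 / real N < 1" using N' by simp
    then have "G k < 1" using k(3) by linarith
    \<comment> \<open>Penalty indices are integers and nondecreasing, so an increment below 1 is
      0.\<close>
    then have noup: "T (Suc k) = T k" using T_mono[of k] s0 unfolding G_def by linarith
    then have "(step k)\<^sup>2 / mu A k \<le> H1 * x ^ 3" using k(3) unfolding G_def x3 by simp
    moreover have mk: "a' * x \<le> mu A k" "mu A k \<le> b * x"
    proof -
      have "x \<ge> (1 + real k) powr (- 1 / 3)"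
        unfolding x_def using N' k by (intro powr_mono2') auto
      then show "mu A k \<le> b * x" using mu_rate(3) mu_rate(4)[of k] mult_left_mono by (meson less_imp_le order_trans)
      have "3 powr (- 1 / 3) * x = (3 * real N) powr (- 1 / 3)" unfolding x_def by (simp add: powr_mult)
      also have "\<dots> \<le> (1 + real k) powr (- 1 / 3)"
        using N' k by (intro powr_mono2') auto
      finally have "a * (3 powr (- 1 / 3) * x) \<le> mu A k"
        using mu_rate(1) mu_rate(2)[of k] mult_left_mono by (meson less_imp_le order_trans)
      then show "a' * x \<le> mu A k" unfolding a'_def by (simp add: mult.assoc)
    qed
    ultimately have "(step k)\<^sup>2 / mu A k / mu A k \<le> H1 * x ^ 3 / (a' * x)"
      using H1 x a' by (intro frac_le) auto
    also have "\<dots> = (h * x)\<^sup>2" unfolding h_def power_mult_distrib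
      using x H1 a' by (simp add: power2_eq_square power3_eq_cube field_simps)
    finally have "(step k / mu A k)\<^sup>2 \<le> (h * x)\<^sup>2" by (simp add: power2_eq_square)
    then have sx: "step k / mu A k \<le> h * x" by (rule power2_le_imp_le) (use h x in simp)
    have "h * x \<le> c2 A * gmin" using N1[OF N'(3)] h unfolding x_def by (simp add: field_simps)
    then have "step k / mu A k \<le> c2 A * gmin" using sx by linarith
    then have "step k \<le> c2 A * mu A k * gmin" using mu_pos[of k] by (simp add: field_simps)
    moreover have "gmin \<le> ghat A (T k)" unfolding gmin_def using Tmax[OF that(1)] by (rule ghat_antimono)
    ultimately have "eps_KKT P (Q * (mu A k + step k / mu A k)) (W (Suc k))"
      using noup by (intro Q(2)[OF that(1)])
    moreover have "Q * (mu A k + step k / mu A k) \<le> Q * (b + h) * x"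
      using mk sx Q(1) by (simp add: mult.assoc distrib_right)
    ultimately show ?thesis using k eps_KKT_mono unfolding x_def by blast
  qed
  then show ?thesis using that[of "Q * (b + h)" N0] Q(1) h mu_rate(3) by simp
qed

end

section \<open>Counting gradients and projections\<close>

context ivsp_setup
begin

text \<open>A polynomial bound on \<open>1 / zeta A k\<close> makes every inner evaluation
  logarithmic in \<open>K\<close>. With \<open>K \<ge> 2\<close>, additive constants become
  multiples of \<open>ln (real K)\<close> by the factor \<open>1 / ln 2\<close>, which explains
  \<open>U\<close> and \<open>U'\<close>.\<close>

lemma ivsp_cost_bound:
  assumes M0: "M0 > 0" "s \<ge> 0" "\<And>k. 1 / zeta A k \<le> M0 * (1 + real k) powr s"
  obtains c where "c > 0" "\<And>zi L0 B K. ivsp_ls_run P S A zi L0 B \<Longrightarrow> 2 \<le> K \<Longrightarrow>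
    real (ivsp_cost P S A zi L0 K) \<le> c * (real B * kappa P * real K * ln (real K))"
proof -
  define D0 where "D0 = 2 * L\<^sup>2 * (diameter Y)\<^sup>2 / m"
  have D0: "D0 \<ge> 0" unfolding D0_def using m_pos by simp
  define M where "M = max 1 (D0 * M0)"
  have kap: "kappa P > 0" unfolding kappa_def using m_pos L_pos by simp
  define U where "U = (kappa P * ln M + 2) / ln 2 + 2 * kappa P * s"
  have M1: "1 \<le> M" unfolding M_def by simp
  have "0 \<le> kappa P * ln M" using M1 kap by simp
  then have "0 < (kappa P * ln M + 2) / ln 2" by simp
  then have U: "U > 0" unfolding U_def using kap M0 by (intro add_pos_nonneg) auto
  define U' where "U' = 4 / ln 2 + 2 * U"
  have U': "U' > 0" unfolding U'_def using U by (simp add: add_pos_pos)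
  have cost: "real (ME_cost P w zi (zeta A k)) \<le> 2 * (U * ln (real K))"
    if w: "w \<in> C" "zi \<in> Y" and k: "k \<le> Suc K" "2 \<le> K" for w zi k K
  proof -
    have lnK: "ln 2 \<le> ln (real K)" using k by simp
    have k1: "1 \<le> (1 + real k) powr s" using M0 by (intro ge_one_powr_ge_zero) auto
    have "2 * L\<^sup>2 * (diameter Y)\<^sup>2 / (m * zeta A k) = D0 * (1 / zeta A k)" unfolding D0_def by simp
    also have "\<dots> \<le> D0 * (M0 * (1 + real k) powr s)" using D0 M0 by (intro mult_left_mono) auto
    also have "\<dots> \<le> M * (1 + real k) powr s" unfolding M_def by (simp add: mult.assoc[symmetric] mult_right_mono)
    finally have "real (ME_steps P w zi (zeta A k)) \<le> kappa P * ln (M * (1 + real k) powr s) + 2"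
      using w zeta_pos M1 k1 mult_mono[of 1 M 1 "(1 + real k) powr s"] by (intro ME_steps_bound) auto
    also have "ln (M * (1 + real k) powr s) = ln M + s * ln (1 + real k)"
      using M1 by (simp add: ln_mult ln_powr)
    also have "ln (1 + real k) \<le> 2 * ln (real K)"
    proof -
      \<comment> \<open>Iteration \<open>K\<close> already uses the tolerance with index
        \<open>Suc K\<close>, so \<open>k\<close> may be \<open>K + 1\<close>;
        \<open>K + 2 \<le> K\<^sup>2\<close> is tight at \<open>K = 2\<close>.\<close>
      have "1 + real k \<le> real K ^ 2"
      proof -
        have "1 + k \<le> K * K" using k mult_le_mono1[OF k(2), of K] by linarith
        then have "1 + k \<le> K ^ 2" by (simp add: power2_eq_square)
        then show ?thesis by (metis of_nat_1 of_nat_add of_nat_le_iff of_nat_power)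
      qed
      then have "ln (1 + real k) \<le> ln (real K ^ 2)" using k by (intro ln_mono) auto
      then show ?thesis using k by (simp add: ln_realpow)
    qed
    finally have "real (ME_steps P w zi (zeta A k)) \<le> kappa P * (ln M + s * (2 * ln (real K))) + 2"
      using kap M0 by (simp add: mult_left_mono)
    also have "\<dots> = (kappa P * ln M + 2) * 1 + 2 * kappa P * s * ln (real K)" by (simp add: algebra_simps)
    also have "\<dots> \<le> (kappa P * ln M + 2) * (ln (real K) / ln 2) + 2 * kappa P * s * ln (real K)"
      using lnK kap M1 by (intro add_right_mono mult_left_mono) auto
    also have "\<dots> = U * ln (real K)" unfolding U_def by (simp add: distrib_right)
    finally show ?thesis unfolding ME_cost_def by simp
  qed
  \<comment> \<open>\<open>U\<close> already contains \<open>kappa P\<close>; the division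
    compensates for the explicit factor in the claim.\<close>
  have "real (ivsp_cost P S A zi L0 K) \<le> (2 * U + 2 * U') / kappa P * (real B * kappa P * real K * ln (real K))"
    if "ivsp_ls_run P S A zi L0 B" and K: "2 \<le> K" for zi L0 B K
  proof -
    interpret ivsp_ls_run P S A zi L0 B by (fact that)
    have lnK: "ln 2 \<le> ln (real K)" using K by simp
    have lnK0: "0 < ln (real K)" using K by simp
    have B1: "1 \<le> real B" using accepted_less[of 0] by linarith
    have stepc: "real (ivsp_step_cost P S A L0 k (run k)) \<le> real B * (U' * ln (real K))" if k: "k \<le> K" for k
    proof -
      let ?acc = "accepted P S A L0 k (W k) (Zt k) (T k)"
      have "real (ivsp_step_cost P S A L0 k (run k)) = 3 + (\<Sum>i\<le>?acc. 1 + real (ME_cost P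
          (trial_w P S A k (W k) (Zt k) (T k) (trial_L A L0 k i)) (Zt k) (zeta A (Suc k))))"
        unfolding ivsp_step_cost_def case_run by simp
      also have "\<dots> \<le> 3 + (\<Sum>i\<le>?acc. 1 + 2 * (U * ln (real K)))"
        using k K by (intro add_left_mono sum_mono cost trial_w_in Zt_in) auto
      also have "\<dots> = 3 + real (Suc ?acc) * (1 + 2 * (U * ln (real K)))" by simp
      also have "\<dots> \<le> 3 * real B + real B * (1 + 2 * (U * ln (real K)))"
        using accepted_less[of k] B1 U lnK0 by (intro add_mono mult_right_mono) auto
      also have "\<dots> = real B * (4 * 1 + 2 * U * ln (real K))" by (simp add: algebra_simps)
      also have "\<dots> \<le> real B * (4 * (ln (real K) / ln 2) + 2 * U * ln (real K))"
        using lnK by (intro mult_left_mono add_right_mono) auto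
      also have "\<dots> = real B * (U' * ln (real K))" unfolding U'_def by (simp add: distrib_right)
      finally show ?thesis .
    qed
    have "zi \<in> Y" using inputs unfolding valid_inputs_def by simp
    then have "real (ME_cost P (w0 A) zi (zeta A 0)) \<le> 2 * (U * ln (real K))"
      using w0_in K by (intro cost) auto
    moreover have "(\<Sum>k\<le>K. real (ivsp_step_cost P S A L0 k (run k))) \<le> (\<Sum>k\<le>K. real B * (U' * ln (real K)))"
      using stepc by (intro sum_mono) auto
    ultimately have "real (ivsp_cost P S A zi L0 K) \<le> 2 * (U * ln (real K)) + (1 + real K) * (real B * (U' * ln (real K)))"
      unfolding ivsp_cost_def by simp
    also have "\<dots> \<le> (real B * real K) * (2 * (U * ln (real K))) + (2 * real K) * (real B * (U' * ln (real K)))"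
    proof (rule add_mono)
      have "1 \<le> real B * real K" using B1 K mult_mono[of 1 "real B" 1 "real K"] by simp
      then show "2 * (U * ln (real K)) \<le> (real B * real K) * (2 * (U * ln (real K)))"
        using U lnK0 mult_right_mono[of 1 "real B * real K" "2 * (U * ln (real K))"] by simp
      show "(1 + real K) * (real B * (U' * ln (real K))) \<le> (2 * real K) * (real B * (U' * ln (real K)))"
        using K U' lnK0 by (intro mult_right_mono) auto
    qed
    also have "\<dots> = (2 * U + 2 * U') / kappa P * (real B * kappa P * real K * ln (real K))"
      using kap by (simp add: field_simps)
    finally show ?thesis .
  qed
  then show ?thesis using that[of "(2 * U + 2 * U') / kappa P"] U U' kap by simp
qed

end

section \<open>From asymptotic rates to explicit constants\<close>

lemma bigo_pos_le:
  fixes f g :: "nat \<Rightarrow> real"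
  assumes "f \<in> O(g)" "\<And>n. f n > 0" "\<And>n. g n > 0"
  obtains c where "c > 0" "\<And>n. f n \<le> c * g n"
proof -
  obtain c where c: "c > 0" "eventually (\<lambda>n. norm (f n) \<le> c * norm (g n)) sequentially"
    using landau_o.bigE[OF assms(1)] by blast
  then obtain N where N: "\<And>n. N \<le> n \<Longrightarrow> f n \<le> c * g n"
    unfolding eventually_sequentially using assms(2,3) by (auto simp: less_imp_le)
  \<comment> \<open>The finitely many indices below \<open>N\<close> are absorbed by the sum of
    their ratios.\<close>
  let ?s = "\<Sum>n<N. f n / g n"
  have pos: "0 \<le> f n / g n" for n using assms(2,3)[of n] by simp
  have s: "0 \<le> ?s" using pos by (intro sum_nonneg)
  have "f n \<le> (c + ?s) * g n" for n
  proof (cases "N \<le> n")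
    case True
    then show ?thesis using N[OF True] s assms(3)[of n] by (simp add: distrib_right add_increasing2)
  next
    case False
    then have "f n / g n \<le> ?s" using pos by (intro member_le_sum) auto
    then have "f n / g n \<le> c + ?s" using c by simp
    then show ?thesis using assms(3)[of n] by (simp add: pos_divide_le_eq)
  qed
  then show ?thesis using that[of "c + ?s"] c s by simp
qed

theorem corollary7:
  fixes P :: "('a::euclidean_space, 'b::euclidean_space) problem"
    and S :: smoothing
    and A :: "('a, 'b) params"
    and M\<^sub>\<gamma> r q \<zeta>bar :: real
  assumes "valid_problem P"
    and "valid_smoothing S"
    and "valid_params P S A"
    and "ENNAMCQ P"
    and "M\<^sub>\<gamma> > 1" and "\<And>t. ghat A t \<le> M\<^sub>\<gamma> * ghat A (Suc t)"
    and "0 < r" and "r < 1" and "mu A \<in> \<Theta>(\<lambda>k. (1 + real k) powr (- r))"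
    and "\<zeta>bar > 0" and "q > 1 / r" and "\<And>k. zeta A k \<le> \<zeta>bar * mu A k powr q"
    and "zeta A \<in> \<Theta>(\<lambda>k. mu A k powr q)"
  shows "(\<exists>c>0. \<forall>zi L0 B\<^sub>l\<^sub>s.
            valid_inputs P A zi L0 \<longrightarrow> ls_bound P S A zi L0 B\<^sub>l\<^sub>s \<longrightarrow>
              evaluations_ok P S A zi L0 \<and>
              (\<forall>K\<ge>2. real (ivsp_cost P S A zi L0 K)
                       \<le> c * (real B\<^sub>l\<^sub>s * kappa P * real K * ln (real K))))
       \<and> (r = 1 / 3 \<longrightarrow>
          (\<exists>c>0. \<exists>\<epsilon>\<^sub>0>0. \<forall>zi L0 B\<^sub>l\<^sub>s.
            valid_inputs P A zi L0 \<longrightarrow> ls_bound P S A zi L0 B\<^sub>l\<^sub>s \<longrightarrow>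
              (\<exists>N :: real \<Rightarrow> nat.
                 (\<forall>\<epsilon>. 0 < \<epsilon> \<and> \<epsilon> < \<epsilon>\<^sub>0 \<longrightarrow>
                    eps_KKT P \<epsilon> (ivsp_w P S A zi L0 (Suc (N \<epsilon>))) \<and>
                    real (ivsp_cost P S A zi L0 (N \<epsilon>))
                      \<le> c * (real B\<^sub>l\<^sub>s * kappa P * (1 / \<epsilon> ^ 3) * ln (1 / \<epsilon>))) \<and>
                 (\<lambda>\<epsilon>. real (ivsp_cost P S A zi L0 (N \<epsilon>)))
                   \<in> soft_O (at_right 0) (\<lambda>\<epsilon>. 1 / \<epsilon> ^ 3))))"
proof -
  interpret ivsp_setup P S A using assms(1-3) by unfold_locales
  have runI: "ivsp_ls_run P S A zi L0 B" if "valid_inputs P A zi L0" "ls_bound P S A zi L0 B" for zi L0 B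
    using that by unfold_locales
  have q: "q > 1" "r * q > 1"
    using assms(7,8,11) by (auto simp: field_simps intro: less_trans[of 1 "1 / r"])
  obtain b where b: "b > 0" "\<And>k. mu A k \<le> b * (1 + real k) powr (- r)"
    using bigo_pos_le[OF bigthetaD1[OF assms(9)]] mu_pos by auto
  obtain a where a: "a > 0" "\<And>k. (1 + real k) powr (- r) \<le> a * mu A k"
    using bigo_pos_le[of "\<lambda>k. (1 + real k) powr (- r)" "mu A"] assms(9) mu_pos
    by (auto simp: bigtheta_def bigomega_iff_bigo)
  obtain d where d: "d > 0" "\<And>k. mu A k powr q \<le> d * zeta A k"
    using bigo_pos_le[of "\<lambda>k. mu A k powr q" "zeta A"] assms(13) mu_pos zeta_pos
    by (auto simp: bigtheta_def bigomega_iff_bigo less_imp_neq[symmetric])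
  have zeta_lower: "1 / zeta A k \<le> a powr q * d * (1 + real k) powr (r * q)" for k
  proof -
    have "((1 + real k) powr (- r)) powr q \<le> (a * mu A k) powr q"
      using a(2) q by (intro powr_mono2) auto
    also have "\<dots> \<le> a powr q * (d * zeta A k)"
      using a(1) mu_pos[of k] d(2)[of k] by (simp add: powr_mult mult_left_mono)
    finally have "(1 + real k) powr (- (r * q)) \<le> a powr q * d * zeta A k" by (simp add: powr_powr)
    then have "1 \<le> a powr q * d * zeta A k * (1 + real k) powr (r * q)"
      by (simp add: powr_minus_divide pos_divide_le_eq)
    then show ?thesis using zeta_pos[of k] by (simp add: field_simps)
  qed
  obtain c where c: "c > 0" "\<And>zi L0 B K. ivsp_ls_run P S A zi L0 B \<Longrightarrow> 2 \<le> K \<Longrightarrow>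
    real (ivsp_cost P S A zi L0 K) \<le> c * (real B * kappa P * real K * ln (real K))"
    using ivsp_cost_bound[OF _ _ zeta_lower] a d q assms(7) by auto
  have part1: "\<exists>c>0. \<forall>zi L0 B. valid_inputs P A zi L0 \<longrightarrow> ls_bound P S A zi L0 B \<longrightarrow>
      evaluations_ok P S A zi L0 \<and> (\<forall>K\<ge>2. real (ivsp_cost P S A zi L0 K)
        \<le> c * (real B * kappa P * real K * ln (real K)))"
  proof (intro exI[of _ c] conjI allI impI)
    fix zi L0 B assume "valid_inputs P A zi L0" "ls_bound P S A zi L0 B"
    then interpret ivsp_ls_run P S A zi L0 B by (rule runI)
    show "evaluations_ok P S A zi L0" by (rule run_evaluations_ok)
  qed (use c runI in auto)
  moreover have "\<exists>c>0. \<exists>\<epsilon>\<^sub>0>0. \<forall>zi L0 B. valid_inputs P A zi L0 \<longrightarrow> ls_bound P S A zi L0 B \<longrightarrow>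
      (\<exists>N :: real \<Rightarrow> nat. (\<forall>\<epsilon>. 0 < \<epsilon> \<and> \<epsilon> < \<epsilon>\<^sub>0 \<longrightarrow>
          eps_KKT P \<epsilon> (ivsp_w P S A zi L0 (Suc (N \<epsilon>))) \<and>
          real (ivsp_cost P S A zi L0 (N \<epsilon>)) \<le> c * (real B * kappa P * (1 / \<epsilon> ^ 3) * ln (1 / \<epsilon>))) \<and>
        (\<lambda>\<epsilon>. real (ivsp_cost P S A zi L0 (N \<epsilon>))) \<in> soft_O (at_right 0) (\<lambda>\<epsilon>. 1 / \<epsilon> ^ 3))"
    if r: "r = 1 / 3"
  proof -
    \<comment> \<open>This leaves a positive exponent \<open>q - 2\<close> to be bounded at index 0,
      which gives the quadratic bound on the tolerance.\<close>
    have q3: "q > 3" using assms(11) r by simp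
    have "zeta A k \<le> (\<zeta>bar * mu A 0 powr (q - 2)) * (mu A k)\<^sup>2" for k
    proof -
      have "mu A k powr q = mu A k powr (q - 2) * (mu A k)\<^sup>2"
        using mu_pos[of k] by (simp add: powr_diff powr_numeral)
      also have "\<dots> \<le> mu A 0 powr (q - 2) * (mu A k)\<^sup>2"
        using mu_pos[of k] mu_antimono[of 0 k] q3 by (intro mult_right_mono powr_mono2) auto
      finally have "\<zeta>bar * mu A k powr q \<le> \<zeta>bar * (mu A 0 powr (q - 2) * (mu A k)\<^sup>2)"
        using assms(10) by (intro mult_left_mono) auto
      then show ?thesis using assms(12)[of k] by (simp add: mult.assoc)
    qed
    moreover have "summable (zeta A)"
    proof (rule summable_comparison_test'[where N = 0])
      have "summable (\<lambda>k. real (Suc k) powr (- (r * q)))"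
        using q by (subst summable_Suc_iff) (simp add: summable_real_powr_iff)
      then show "summable (\<lambda>k. (\<zeta>bar * b powr q) * real (Suc k) powr (- (r * q)))"
        by (rule summable_mult)
      fix k
      have "mu A k powr q \<le> (b * (1 + real k) powr (- r)) powr q"
        using b(2)[of k] mu_pos[of k] q by (intro powr_mono2) auto
      then have "\<zeta>bar * mu A k powr q \<le> \<zeta>bar * (b powr q * (1 + real k) powr (- (r * q)))"
        using assms(10) b(1) by (simp add: powr_mult powr_powr)
      then show "norm (zeta A k) \<le> (\<zeta>bar * b powr q) * real (Suc k) powr (- (r * q))"
        using assms(12)[of k] zeta_pos[of k] by (simp add: mult.assoc)
    qed
    ultimately interpret ivsp_rates P S A "\<zeta>bar * mu A 0 powr (q - 2)"
      using assms(4) by unfold_locales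
    have a3: "1 / a * (1 + real k) powr (- 1 / 3) \<le> mu A k" for k
      using a(1) a(2)[of k] r by (simp add: field_simps)
    have b3: "mu A k \<le> b * (1 + real k) powr (- 1 / 3)" for k using b(2)[of k] r by simp
    have "0 < 1 / a" using a(1) by simp
    from eps_KKT_in_window[OF this a3 b(1) b3]
    obtain Q N0 where Q: "Q > 0" and win: "\<And>zi L0 B N. is_run zi L0 B \<Longrightarrow> N0 \<le> N \<Longrightarrow>
      \<exists>k. N \<le> k \<and> k \<le> 2 * N \<and> eps_KKT P (Q * real N powr (- 1 / 3)) (ivsp_w P S A zi L0 (Suc k))"
      by metis
    define N1 where "N1 = max N0 2"
    \<comment> \<open>The entries ensure, in order: a window starting at \<open>N1\<close> or later;
      \<open>4 * Q ^ 3 \<le> 1 / \<epsilon>\<close>, whence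
      \<open>ln (real k) \<le> 4 * ln (1 / \<epsilon>)\<close>; and
      \<open>ln (1 / \<epsilon>) > 0\<close>.\<close>
    define \<epsilon>\<^sub>0 where "\<epsilon>\<^sub>0 = min (Q / real N1) (min (1 / (4 * Q ^ 3)) (1 / 2))"
    have e0: "\<epsilon>\<^sub>0 > 0" unfolding \<epsilon>\<^sub>0_def N1_def using Q by simp
    define c' where "c' = 16 * c * Q ^ 3"
    have c': "c' > 0" unfolding c'_def using c Q by simp
    \<comment> \<open>Iteration \<open>k\<close> produces the iterate with index
      \<open>Suc k\<close>, so its cost, counted through \<open>k\<close>, includes everything
      needed for that point.\<close>
    have main: "\<exists>k. eps_KKT P \<epsilon> (ivsp_w P S A zi L0 (Suc k)) \<and>
        real (ivsp_cost P S A zi L0 k) \<le> c' * (real B * kappa P * (1 / \<epsilon> ^ 3) * ln (1 / \<epsilon>))"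
      if run: "is_run zi L0 B" and e: "0 < \<epsilon>" "\<epsilon> < \<epsilon>\<^sub>0" for zi L0 B \<epsilon>
    proof -
      have e': "\<epsilon> < Q / real N1" "\<epsilon> < 1 / (4 * Q ^ 3)" "\<epsilon> < 1 / 2"
        using e unfolding \<epsilon>\<^sub>0_def by auto
      \<comment> \<open>The real solution of \<open>Q * y powr (- 1 / 3) = \<epsilon>\<close>; the
        window starts at its ceiling.\<close>
      define y where "y = (Q / \<epsilon>) ^ 3"
      define n where "n = nat \<lceil>y\<rceil>"
      have N1: "2 \<le> N1" "N0 \<le> N1" unfolding N1_def by auto
      have N1Q: "real N1 < Q / \<epsilon>" using e' e N1 by (simp add: field_simps)
      then have Q1: "1 \<le> Q / \<epsilon>" using N1 by linarith
      have "Q / \<epsilon> \<le> y" unfolding y_def using Q1 by (simp add: self_le_power)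
      then have y: "real N1 < y" using N1Q by linarith
      have ny: "y \<le> real n" "real n \<le> y + 1" unfolding n_def using y by linarith+
      then have n: "N1 \<le> n" using y by linarith
      obtain k where k: "n \<le> k" "k \<le> 2 * n" "eps_KKT P (Q * real n powr (- 1 / 3)) (ivsp_w P S A zi L0 (Suc k))"
        using win[OF run, of n] n N1 by auto
      have "real n powr (- 1 / 3) \<le> y powr (- 1 / 3)" using ny y N1 by (intro powr_mono2') auto
      also have "\<dots> = (Q / \<epsilon>) powr (- 1)"
      proof -
        have "y = (Q / \<epsilon>) powr 3" unfolding y_def using Q e by simp
        then show ?thesis by (simp only: powr_powr) simp
      qed
      also have "\<dots> = \<epsilon> / Q" using Q e by (simp add: powr_minus_divide)
      finally have "Q * real n powr (- 1 / 3) \<le> \<epsilon>" using Q by (simp add: field_simps)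
      then have kkt: "eps_KKT P \<epsilon> (ivsp_w P S A zi L0 (Suc k))" using k(3) eps_KKT_mono by blast
      have k2: "2 \<le> k" using k n N1 by linarith
      have ky: "real k \<le> 4 * y" using k ny y N1 by linarith
      have ye: "4 * y = 4 * Q ^ 3 * (1 / \<epsilon> ^ 3)" unfolding y_def by (simp add: power_divide)
      have "4 * Q ^ 3 \<le> 1 / \<epsilon>" using e' e Q by (simp add: field_simps)
      then have "real k \<le> 1 / \<epsilon> * (1 / \<epsilon> ^ 3)"
        using ky e unfolding ye by (meson divide_nonneg_pos less_imp_le mult_right_mono order_trans zero_le_one zero_less_power)
      also have "\<dots> = (1 / \<epsilon>) ^ 4" by (simp add: power_divide eval_nat_numeral)
      finally have "ln (real k) \<le> ln ((1 / \<epsilon>) ^ 4)" using k2 by (intro ln_mono) auto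
      also have "\<dots> = 4 * ln (1 / \<epsilon>)" using e by (simp only: ln_realpow)
      finally have lnk: "ln (real k) \<le> 4 * ln (1 / \<epsilon>)" .
      have kap: "kappa P > 0" unfolding kappa_def using m_pos L_pos by simp
      have "real (ivsp_cost P S A zi L0 k) \<le> c * (real B * kappa P * real k * ln (real k))"
        using run k2 by (rule c(2))
      also have "\<dots> \<le> c * (real B * kappa P * (4 * Q ^ 3 * (1 / \<epsilon> ^ 3)) * (4 * ln (1 / \<epsilon>)))"
        using ky lnk c(1) kap k2 e Q unfolding ye by (intro mult_left_mono mult_mono) auto
      also have "\<dots> = c' * (real B * kappa P * (1 / \<epsilon> ^ 3) * ln (1 / \<epsilon>))" unfolding c'_def by simp
      finally show ?thesis using kkt by blast
    qed
    show ?thesis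
    proof (rule exI[of _ c'], rule conjI[OF c'], rule exI[of _ \<epsilon>\<^sub>0], rule conjI[OF e0], intro allI impI)
      fix zi L0 B assume "valid_inputs P A zi L0" "ls_bound P S A zi L0 B"
      then have run: "is_run zi L0 B" by (rule runI)
      obtain N where N: "\<And>\<epsilon>. 0 < \<epsilon> \<Longrightarrow> \<epsilon> < \<epsilon>\<^sub>0 \<Longrightarrow> eps_KKT P \<epsilon> (ivsp_w P S A zi L0 (Suc (N \<epsilon>))) \<and>
          real (ivsp_cost P S A zi L0 (N \<epsilon>)) \<le> c' * (real B * kappa P * (1 / \<epsilon> ^ 3) * ln (1 / \<epsilon>))"
        using main[OF run] by metis
      \<comment> \<open>One logarithmic factor suffices; since \<open>soft_O\<close> takes the
        logarithm of \<open>1 / \<epsilon> ^ 3\<close> itself, the constant is divided by 3.\<close>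
      have "(\<lambda>\<epsilon>. real (ivsp_cost P S A zi L0 (N \<epsilon>))) \<in> O[at_right 0](\<lambda>\<epsilon>. 1 / \<epsilon> ^ 3 * ln (1 / \<epsilon> ^ 3) ^ 1)"
      proof (rule bigoI)
        show "eventually (\<lambda>\<epsilon>. norm (real (ivsp_cost P S A zi L0 (N \<epsilon>)))
            \<le> (c' * (real B * kappa P) / 3) * norm (1 / \<epsilon> ^ 3 * ln (1 / \<epsilon> ^ 3) ^ 1)) (at_right 0)"
        proof (rule eventually_at_rightI[of 0 \<epsilon>\<^sub>0])
          fix \<epsilon> assume "\<epsilon> \<in> {0<..<\<epsilon>\<^sub>0}"
          then have e: "0 < \<epsilon>" "\<epsilon> < \<epsilon>\<^sub>0" by auto
          then have "\<epsilon> < 1 / 2" unfolding \<epsilon>\<^sub>0_def by simp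
          then have "0 \<le> ln (1 / \<epsilon>)" using e by simp
          moreover have "ln (1 / \<epsilon> ^ 3) = 3 * ln (1 / \<epsilon>)"
            using e ln_realpow[of "1 / \<epsilon>" 3] by (simp add: power_divide)
          ultimately have "norm (1 / \<epsilon> ^ 3 * ln (1 / \<epsilon> ^ 3) ^ 1) = 1 / \<epsilon> ^ 3 * (3 * ln (1 / \<epsilon>))"
            using e by simp
          then show "norm (real (ivsp_cost P S A zi L0 (N \<epsilon>)))
              \<le> (c' * (real B * kappa P) / 3) * norm (1 / \<epsilon> ^ 3 * ln (1 / \<epsilon> ^ 3) ^ 1)"
            using N[OF e] by simp
        qed (rule e0)
      qed
      then have "(\<lambda>\<epsilon>. real (ivsp_cost P S A zi L0 (N \<epsilon>))) \<in> soft_O (at_right 0) (\<lambda>\<epsilon>. 1 / \<epsilon> ^ 3)"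
        unfolding soft_O_def by blast
      then show "\<exists>N :: real \<Rightarrow> nat. (\<forall>\<epsilon>. 0 < \<epsilon> \<and> \<epsilon> < \<epsilon>\<^sub>0 \<longrightarrow>
          eps_KKT P \<epsilon> (ivsp_w P S A zi L0 (Suc (N \<epsilon>))) \<and>
          real (ivsp_cost P S A zi L0 (N \<epsilon>)) \<le> c' * (real B * kappa P * (1 / \<epsilon> ^ 3) * ln (1 / \<epsilon>))) \<and>
        (\<lambda>\<epsilon>. real (ivsp_cost P S A zi L0 (N \<epsilon>))) \<in> soft_O (at_right 0) (\<lambda>\<epsilon>. 1 / \<epsilon> ^ 3)"
        using N by blast
    qed
  qed
  ultimately show ?thesis by blast
qed

end
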